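(* Fix an iteration $t$ and the current iterate $w_t\in\mathbb{R}^d$. Let $\mu\in[1,n/d]$ be the row coherence of $A_t$. Suppose $\gamma=1$ and $s\ge \frac{3\mu d}{\eta^2}\log\frac{md}{\delta}$ for some $\eta,\delta\in(0,1)$, and $0\le\alpha<\beta<1/2$. Suppose the Hessian of $f$ is $L$-Lipschitz continuous, i.e. $\|\nabla^2 f(w)-\nabla^2 f(w')\|_2\le L\|w-w'\|$ for all $w,w'$. Then, with probability exceeding $1-\delta$, the robust update $w_{t+1}=w_t-\hat p_t$ (described in the context) satisfies $$\|\Delta_{t+1}\|\le \max\Big\{\sqrt{\kappa_t\Big(\frac{\zeta_{byz}^2}{1-\zeta_{byz}^2}\Big)}\,\|\Delta_t\|,\ \frac{L}{\sigma_{\min}(H_t)}\|\Delta_t\|^2\Big\}+\frac{2\epsilon_{byz}}{\sqrt{\sigma_{\min}(H_t)}},$$ where $\Delta_t=w_t-w^*$, $\Delta_{t+1}=w_{t+1}-w^*$, $$\epsilon_{byz}^2=\Big[3\Big(\frac{1-\alpha}{1-\beta}\Big)^2+4\kappa_t\Big(\frac{\alpha}{1-\beta}\Big)^2\Big]\epsilon^2,$$ $$\zeta_{byz}^2=2\Big(\frac{1-\alpha}{1-\beta}\Big)^2\Big(\frac{\nu}{1-\eta}\Big)^2+\nu^2\Big(\frac{1-\alpha}{1-\beta}\Big)^2\Big(\frac{\eta}{\sqrt{(1-\alpha)m}}+\frac{\eta^2}{1-\eta}\Big)^2+4\kappa_t\Big(\frac{\alpha}{1-\beta}\Big)^2\Big[2+\Big(\frac{\nu}{1-\eta}\Big)^2\Big],$$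 $\nu=\frac{\sigma_{\max}(A_t^\top A_t)}{\sigma_{\max}(A_t^\top A_t)+n\lambda}$, and $\epsilon=\frac{1}{1-\eta}\,\frac{1}{\sqrt{\sigma_{\min}(H_t)}}\big(1+\sqrt{2\ln(m/\delta)}\big)\sqrt{\frac1s}\,\max_{j\in[n]}\|b_j\|.$
   Context: Problem: data $x_1,\dots,x_n\in\mathbb{R}^d$, loss functions $\ell_j:\mathbb{R}\to\mathbb{R}$ convex, twice differentiable and smooth, $\lambda>0$; $f(w)=\frac1n\sum_{j=1}^n\ell_j(w^\top x_j)+\frac\lambda2\|w\|^2$, assumed strongly convex with unique minimizer $w^*$. At iterate $w_t$: $g_t=\nabla f(w_t)$, $H_t=\nabla^2f(w_t)=\frac1n\sum_j\ell_j''(w_t^\top x_j)x_jx_j^\top+\lambda I$; $A_t\in\mathbb{R}^{n\times d}$ has rows $a_j^\top$, $a_j=\sqrt{\ell_j''(w_t^\top x_j)}\,x_j$; $b_j=\ell_j'(w_t^\top x_j)x_j$; $\kappa_t=\sigma_{\max}(H_t)/\sigma_{\min}(H_t)$. Row coherence of $A\in\mathbb{R}^{n\times d}$: $\mu(A)=\frac nd\max_i\|u_i\|^2$ where $u_i$ are the rows of an orthonormal basis $U$ of the column space of $A$. Distributed setup: $m$ workers; worker $i$ holds a multiset $S_i$ of $s$ indices drawn independently and uniformly at random from $[n]$ (independently across workers) and can form $g_{i,t}=\frac1s\sum_{j\in S_i}\ell_j'(w_t^\top x_j)x_j+\lambda w_t$, $H_{i,t}=\frac1s\sum_{j\in S_i}\ell_j''(w_t^\top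 x_j)x_jx_j^\top+\lambda I$. An $\alpha$ fraction of the workers are Byzantine: they may send arbitrary vectors in $\mathbb{R}^d$ (possibly colluding, with full knowledge of the algorithm); each non-Byzantine worker $i$ sends $\hat p_{i,t}=H_{i,t}^{-1}g_{i,t}$. The center machine sorts the $m$ received vectors in non-decreasing order of Euclidean norm, lets $\mathcal U_t$ be the indices of the first $(1-\beta)m$ of them, sets $\hat p_t=\frac{1}{|\mathcal U_t|}\sum_{i\in\mathcal U_t}(\text{vector received from }i)$, and updates $w_{t+1}=w_t-\gamma\hat p_t$.
   Formalization: The formal theorem adds the hypothesis ζ_byz² < 1, without which the square root of κ_t ζ_byz²/(1−ζ_byz²) is undefined, and takes αm and (1−β)m to be integers, as the trimming step implicitly requires. *)

theory Defs
  imports "HOL-Probability.Probability"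
begin

text \<open>Vectors in R^d are \<open>real^'d\<close>; the data index set [n] is a finite type \<open>'n\<close>
  with n = CARD('n). Matrices are \<open>real^'c^'r\<close> (rows indexed by 'r).\<close>

definition sigma_max :: "real^'c^'r \<Rightarrow> real" where
  "sigma_max M = onorm (\<lambda>v. M *v v)"

definition sigma_min :: "real^'c^'r \<Rightarrow> real" where
  "sigma_min M = Inf {norm (M *v v) | v. norm v = 1}"

definition outer :: "real^'d \<Rightarrow> real^'d^'d" where
  "outer x = (\<chi> i k. x$i * x$k)"

text \<open>Column space of A and row coherence mu(A) = n/d max_i ||u_i||^2, where u_i are
  the rows of an orthonormal basis U of the column space (U given as a set of
  orthonormal column vectors, so ||u_i||^2 = sum over u in U of (u$i)^2).\<close>
definition colspace :: "real^'d^'n \<Rightarrow> (real^'n) set" where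
  "colspace A = range (\<lambda>v. A *v v)"

definition is_onb :: "(real^'n) set \<Rightarrow> (real^'n) set \<Rightarrow> bool" where
  "is_onb B V \<longleftrightarrow> B \<subseteq> V \<and> pairwise orthogonal B \<and> (\<forall>u\<in>B. norm u = 1) \<and> span B = V"

definition row_coherence :: "real^'d^'n \<Rightarrow> real" where
  "row_coherence A =
     (let B = (SOME B. is_onb B (colspace A))
      in real CARD('n) / real CARD('d) * Max (range (\<lambda>i. \<Sum>u\<in>B. (u$i)^2)))"

text \<open>The objective f(w) = 1/n sum_j l_j(w.x_j) + lambda/2 ||w||^2, its gradient and
  Hessian (with l1 j = l_j', l2 j = l_j'').\<close>
definition obj :: "('n::finite \<Rightarrow> real \<Rightarrow> real) \<Rightarrow> ('n \<Rightarrow> real^'d) \<Rightarrow> real \<Rightarrow> real^'d \<Rightarrow> real" where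
  "obj l x lam w = (\<Sum>j\<in>UNIV. l j (w \<bullet> x j)) / real CARD('n) + lam / 2 * (norm w)^2"

definition grad :: "('n::finite \<Rightarrow> real \<Rightarrow> real) \<Rightarrow> ('n \<Rightarrow> real^'d) \<Rightarrow> real \<Rightarrow> real^'d \<Rightarrow> real^'d" where
  "grad l1 x lam w = (1 / real CARD('n)) *\<^sub>R (\<Sum>j\<in>UNIV. l1 j (w \<bullet> x j) *\<^sub>R x j) + lam *\<^sub>R w"

definition hess :: "('n::finite \<Rightarrow> real \<Rightarrow> real) \<Rightarrow> ('n \<Rightarrow> real^'d) \<Rightarrow> real \<Rightarrow> real^'d \<Rightarrow> real^'d^'d" where
  "hess l2 x lam w = (1 / real CARD('n)) *\<^sub>R (\<Sum>j\<in>UNIV. l2 j (w \<bullet> x j) *\<^sub>R outer (x j)) + lam *\<^sub>R mat 1"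

definition Amat :: "('n \<Rightarrow> real \<Rightarrow> real) \<Rightarrow> ('n \<Rightarrow> real^'d) \<Rightarrow> real^'d \<Rightarrow> real^'d^'n" where
  "Amat l2 x w = (\<chi> j. sqrt (l2 j (w \<bullet> x j)) *\<^sub>R x j)"

definition bvec :: "('n \<Rightarrow> real \<Rightarrow> real) \<Rightarrow> ('n \<Rightarrow> real^'d) \<Rightarrow> real^'d \<Rightarrow> 'n \<Rightarrow> real^'d" where
  "bvec l1 x w j = l1 j (w \<bullet> x j) *\<^sub>R x j"

text \<open>Local gradient / Hessian of worker i, whose multiset S_i consists of the s indices
  S k, k < s.\<close>
definition loc_grad :: "('n \<Rightarrow> real \<Rightarrow> real) \<Rightarrow> ('n \<Rightarrow> real^'d) \<Rightarrow> real \<Rightarrow> nat \<Rightarrow> (nat \<Rightarrow> 'n) \<Rightarrow> real^'d \<Rightarrow> real^'d" where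
  "loc_grad l1 x lam s S w = (1 / real s) *\<^sub>R (\<Sum>k<s. l1 (S k) (w \<bullet> x (S k)) *\<^sub>R x (S k)) + lam *\<^sub>R w"

definition loc_hess :: "('n \<Rightarrow> real \<Rightarrow> real) \<Rightarrow> ('n \<Rightarrow> real^'d) \<Rightarrow> real \<Rightarrow> nat \<Rightarrow> (nat \<Rightarrow> 'n) \<Rightarrow> real^'d \<Rightarrow> real^'d^'d" where
  "loc_hess l2 x lam s S w = (1 / real s) *\<^sub>R (\<Sum>k<s. l2 (S k) (w \<bullet> x (S k)) *\<^sub>R outer (x (S k))) + lam *\<^sub>R mat 1"

text \<open>Sampling distribution: \<omega>(i,k) is the k-th index drawn by worker i (i < m, k < s),
  all drawn independently and uniformly from [n].\<close>
definition sample_pmf :: "nat \<Rightarrow> nat \<Rightarrow> (nat \<times> nat \<Rightarrow> 'n::finite) pmf" where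
  "sample_pmf m s = pmf_of_set (PiE ({..<m} \<times> {..<s}) (\<lambda>_. UNIV))"

text \<open>Valid trimming sets: indices of the (1-beta)m received vectors of smallest norm
  (any tie-breaking).\<close>
definition valid_trim :: "nat \<Rightarrow> nat \<Rightarrow> (nat \<Rightarrow> real^'d) \<Rightarrow> nat set \<Rightarrow> bool" where
  "valid_trim m q r U \<longleftrightarrow> U \<subseteq> {..<m} \<and> card U = q \<and>
     (\<forall>i\<in>U. \<forall>j\<in>{..<m} - U. norm (r i) \<le> norm (r j))"


definition cond_num :: "real^'d^'d \<Rightarrow> real" where
  "cond_num H = sigma_max H / sigma_min H"

definition nu_const :: "real^'d^'n::finite \<Rightarrow> real \<Rightarrow> real" where
  "nu_const A lam = sigma_max (transpose A ** A) / (sigma_max (transpose A ** A) + real CARD('n) * lam)"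

definition eps_const :: "real \<Rightarrow> real \<Rightarrow> real \<Rightarrow> nat \<Rightarrow> nat \<Rightarrow> real \<Rightarrow> real" where
  "eps_const \<eta> smin \<delta> m s bmax =
     1 / (1 - \<eta>) * (1 / sqrt smin) * (1 + sqrt (2 * ln (real m / \<delta>))) * sqrt (1 / real s) * bmax"

definition eps_byz2 :: "real \<Rightarrow> real \<Rightarrow> real \<Rightarrow> real \<Rightarrow> real" where
  "eps_byz2 \<alpha> \<beta> \<kappa> \<epsilon> = (3 * ((1 - \<alpha>) / (1 - \<beta>))^2 + 4 * \<kappa> * (\<alpha> / (1 - \<beta>))^2) * \<epsilon>^2"

definition zeta_byz2 :: "real \<Rightarrow> real \<Rightarrow> real \<Rightarrow> nat \<Rightarrow> real \<Rightarrow> real \<Rightarrow> real" where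
  "zeta_byz2 \<alpha> \<beta> \<eta> m \<nu> \<kappa> =
     2 * ((1 - \<alpha>) / (1 - \<beta>))^2 * (\<nu> / (1 - \<eta>))^2
     + \<nu>^2 * ((1 - \<alpha>) / (1 - \<beta>))^2 * (\<eta> / sqrt ((1 - \<alpha>) * real m) + \<eta>^2 / (1 - \<eta>))^2
     + 4 * \<kappa> * (\<alpha> / (1 - \<beta>))^2 * (2 + (\<nu> / (1 - \<eta>))^2)"

definition recv :: "('n \<Rightarrow> real \<Rightarrow> real) \<Rightarrow> ('n \<Rightarrow> real \<Rightarrow> real) \<Rightarrow> ('n \<Rightarrow> real^'d) \<Rightarrow> real \<Rightarrow> nat
     \<Rightarrow> real^'d \<Rightarrow> nat set \<Rightarrow> (nat \<times> nat \<Rightarrow> 'n) \<Rightarrow> (nat \<Rightarrow> real^'d) \<Rightarrow> nat \<Rightarrow> real^'d" where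
  "recv l1 l2 x lam s w Byz \<omega> v i =
     (if i \<in> Byz then v i
      else matrix_inv (loc_hess l2 x lam s (\<lambda>k. \<omega> (i, k)) w) *v loc_grad l1 x lam s (\<lambda>k. \<omega> (i, k)) w)"

end

theory Submission
  imports Defs
begin

text \<open>Write \<open>\<Delta>\<close> for the current error, \<open>p = H\<inverse> g\<close> for the exact Newton direction and
  \<open>\<theta> = \<alpha> / (1 - \<beta>)\<close>. A Byzantine vector that survives trimming is no longer than some honest one,
  so the new error is at most \<open>norm (\<Delta> - (1 - \<theta>) p) + \<theta> norm p + e\<close>, where \<open>e\<close> is the largest
  deviation of an honest direction from \<open>p\<close>. Since \<open>g = Hb \<Delta>\<close> for an averaged Hessian \<open>Hb\<close>, the
  first two terms are governed by the spectrum of \<open>H - Hb\<close>, which the Lipschitz condition bounds on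
  both sides and convexity bounds from above. The hypothesis \<open>\<zeta>\<^sup>2 < 1\<close> makes \<open>\<nu> / (1 - \<eta>)\<close> and
  \<open>sqrt \<kappa> \<theta>\<close> small enough for the sum to stay below the claimed maximum.

  The deviation \<open>e\<close> is controlled with high probability by a matrix Chernoff bound for the sampled
  Hessians and a Hoeffding bound for the sampled gradients. The samples are rank one, hence the
  trace of a high matrix power replaces the trace of the matrix exponential and an elementary
  moment inequality replaces Golden--Thompson.\<close>

section \<open>Moments of positive definite operators and rank-one updates\<close>

text \<open>The claim has a maximum of a linear and a quadratic term where the triangle inequality
  yields their sum. Mixed contributions can be absorbed only if their coefficients, measured against
  the two arguments of the maximum, add up to at most 1, and this decides how sharp everything else
  must be: the upper error of the averaged Hessian has to carry b / 8 instead of the b / 2 of the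
  plain Lipschitz estimate, where b = L norm \<Delta> / sigma_min, and the comparison point is (1 -
  \<theta>) p, because in one of the two spectral cases the shrinking of p cancels the cost \<theta>
  norm p. Powers enter because the N-th power of I + (a / N) X tends to exp (a X). All operator
  estimates are made at finite N, by Cauchy-Schwarz and by scalar differential inequalities along a
  rank-one update; the exponential Chernoff bounds appear only in the limit.\<close>

lemma logconvex_ratio_mono:
  fixes a :: "nat \<Rightarrow> real"
  assumes pos: "\<And>k. a k > 0" and lc: "\<And>k. (a (Suc k))\<^sup>2 \<le> a k * a (Suc (Suc k))"
    and "i \<le> j"
  shows "a (Suc i) / a i \<le> a (Suc j) / a j"
  using \<open>i \<le> j\<close>
proof (induction j rule: dec_induct)
  case (step j)
  have "a (Suc j) / a j \<le> a (Suc (Suc j)) / a (Suc j)"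
    using lc[of j] pos[of j] pos[of "Suc j"] by (simp add: field_simps power2_eq_square)
  then show ?case using step by linarith
qed simp

text \<open>a i / a 0 is the product of the first \<open>i\<close> ratios of consecutive terms;
  shifting all of them by \<open>j\<close> can only increase each one.\<close>

lemma logconvex_supermultiplicative:
  fixes a :: "nat \<Rightarrow> real"
  assumes pos: "\<And>k. a k > 0" and lc: "\<And>k. (a (Suc k))\<^sup>2 \<le> a k * a (Suc (Suc k))"
  shows "a i * a j \<le> a 0 * a (i + j)"
proof (induction i)
  case (Suc i)
  have r: "a (Suc i) / a i \<le> a (Suc (i + j)) / a (i + j)"
    using pos lc by (rule logconvex_ratio_mono) simp
  have "a (Suc i) * a j = (a (Suc i) / a i) * (a i * a j)"
    using pos[of i] by simp
  also have "\<dots> \<le> (a (Suc (i + j)) / a (i + j)) * (a 0 * a (i + j))"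
    by (rule mult_mono'[OF r Suc.IH]) (simp_all add: pos less_imp_le)
  also have "\<dots> = a 0 * a (Suc i + j)"
    using pos[of "i + j"] by simp
  finally show ?case .
qed simp

section \<open>Self-adjoint operators and the moments of a vector\<close>

definition selfadj :: "('a::euclidean_space \<Rightarrow> 'a) \<Rightarrow> bool" where
  "selfadj C \<longleftrightarrow> linear C \<and> (\<forall>u v. C u \<bullet> v = u \<bullet> C v)"

lemma selfadj_funpow:
  assumes "selfadj C"
  shows "(C ^^ k) u \<bullet> v = u \<bullet> (C ^^ k) v"
proof (induction k arbitrary: u v)
  case (Suc k)
  have "(C ^^ Suc k) u \<bullet> v = (C ^^ k) u \<bullet> C v"
    using assms by (simp add: selfadj_def)
  also have "\<dots> = u \<bullet> (C ^^ k) (C v)" by (rule Suc)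
  finally show ?case by (simp add: funpow_swap1)
qed simp

lemma linear_funpow:
  fixes C :: "'a::real_vector \<Rightarrow> 'a"
  shows "linear C \<Longrightarrow> linear (C ^^ k)"
proof (induction k)
  case 0 then show ?case using linear_id by (simp only: funpow.simps)
next
  case (Suc k) then show ?case using linear_compose[of "C ^^ k" C] by (simp add: o_def)
qed

text \<open>Positivity is only required on an invariant subspace: in the application this is the
  column space of the data matrix, and its dimension is what enters the Chernoff bound.\<close>

definition posdef_on :: "'a::euclidean_space set \<Rightarrow> real \<Rightarrow> ('a \<Rightarrow> 'a) \<Rightarrow> bool" where
  "posdef_on V c C \<longleftrightarrow> selfadj C \<and> C ` V \<subseteq> V \<and> subspace V \<and> (\<forall>v\<in>V. c * (norm v)\<^sup>2 \<le> v \<bullet> C v)"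

lemma posdef_on_funpow_mem:
  assumes "posdef_on V c C" "v \<in> V"
  shows "(C ^^ k) v \<in> V"
  using assms by (induction k) (auto simp: posdef_on_def)

text \<open>The form may be degenerate on \<open>V\<close>: a later application takes for
  \<open>v\<close> a null vector of the form and concludes that it is a null vector of the
  operator.\<close>

lemma form_Cauchy_Schwarz:
  fixes C :: "'a::euclidean_space \<Rightarrow> 'a"
  assumes C: "selfadj C" and V: "subspace V" and pos: "\<And>v. v \<in> V \<Longrightarrow> 0 \<le> v \<bullet> C v"
    and u: "u \<in> V" and v: "v \<in> V"
  shows "(u \<bullet> C v)\<^sup>2 \<le> (u \<bullet> C u) * (v \<bullet> C v)"
proof -
  have lin: "linear C" and sa: "\<And>a b. C a \<bullet> b = a \<bullet> C b" using C by (auto simp: selfadj_def)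
  have q: "0 \<le> (u \<bullet> C u) + 2 * t * (u \<bullet> C v) + t\<^sup>2 * (v \<bullet> C v)" for t
  proof -
    have mem: "u + t *\<^sub>R v \<in> V" using V u v by (simp add: subspace_add subspace_scale)
    have "v \<bullet> C u = u \<bullet> C v" using sa[of v u] by (simp add: inner_commute)
    then have "(u + t *\<^sub>R v) \<bullet> C (u + t *\<^sub>R v) = (u \<bullet> C u) + 2 * t * (u \<bullet> C v) + t\<^sup>2 * (v \<bullet> C v)"
      by (simp add: linear_add[OF lin] linear_cmul[OF lin] inner_add_left inner_add_right
          algebra_simps power2_eq_square)
    with pos[OF mem] show ?thesis by simp
  qed
  show ?thesis
  proof (cases "v \<bullet> C v = 0")
    case True
    have "u \<bullet> C v = 0"
    proof (rule ccontr)
      assume ne: "u \<bullet> C v \<noteq> 0"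
      \<comment> \<open>With v . C v = 0 the polynomial is affine in t, and this t drives it to
        -1.\<close>
      have "0 \<le> (u \<bullet> C u) + 2 * (- (u \<bullet> C u + 1) / (2 * (u \<bullet> C v))) * (u \<bullet> C v)"
        using q[of "- (u \<bullet> C u + 1) / (2 * (u \<bullet> C v))"] True by simp
      also have "\<dots> = - 1" using ne by (simp add: field_simps)
      finally show False by simp
    qed
    then show ?thesis using True by simp
  next
    case False
    then have p: "v \<bullet> C v > 0" using pos[OF v] by simp
    have "0 \<le> (u \<bullet> C u) + 2 * (- (u \<bullet> C v) / (v \<bullet> C v)) * (u \<bullet> C v)
              + (- (u \<bullet> C v) / (v \<bullet> C v))\<^sup>2 * (v \<bullet> C v)" by (rule q)
    also have "\<dots> = (u \<bullet> C u) - (u \<bullet> C v)\<^sup>2 / (v \<bullet> C v)"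
      using p by (simp add: field_simps power2_eq_square)
    finally show ?thesis using p by (simp add: field_simps)
  qed
qed

text \<open>With u = C^i y the moments of order 2i to 2i+3 are u . u, u . C u, C u . C u and C u . C
  (C u). Log-convexity is then Cauchy-Schwarz, for the inner product if \<open>k\<close> is even and
  for the form of \<open>C\<close> if \<open>k\<close> is odd, so no square root of \<open>C\<close>
  has to be constructed.\<close>

lemma moment_step:
  assumes C: "posdef_on V c C" and c: "c > 0" and y: "y \<in> V"
  shows "c * (y \<bullet> (C ^^ k) y) \<le> y \<bullet> (C ^^ Suc k) y"
    and "(y \<bullet> (C ^^ Suc k) y)\<^sup>2 \<le> (y \<bullet> (C ^^ k) y) * (y \<bullet> (C ^^ Suc (Suc k)) y)"
proof -
  have sa: "selfadj C" and V: "subspace V"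
    and pos: "\<And>v. v \<in> V \<Longrightarrow> c * (norm v)\<^sup>2 \<le> v \<bullet> C v"
    using C by (auto simp: posdef_on_def)
  have sa': "\<And>a b. C a \<bullet> b = a \<bullet> C b" using sa by (auto simp: selfadj_def)
  have pos0: "\<And>v. v \<in> V \<Longrightarrow> 0 \<le> v \<bullet> C v"
    using pos c by (metis order_trans mult_nonneg_nonneg less_imp_le zero_le_power2)
  have add: "y \<bullet> (C ^^ (i + j)) y = (C ^^ i) y \<bullet> (C ^^ j) y" for i j
    by (simp add: funpow_add selfadj_funpow[OF sa])
  obtain i where i: "k = 2 * i \<or> k = 2 * i + 1" by (metis oddE evenE)
  define u where "u = (C ^^ i) y"
  have uV: "u \<in> V" and CuV: "C u \<in> V"
    using posdef_on_funpow_mem[OF C y] posdef_on_funpow_mem[OF C y, of "Suc i"] by (auto simp: u_def)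
  have m0: "y \<bullet> (C ^^ (2 * i)) y = u \<bullet> u"
    using add[of i i] by (simp add: u_def mult_2)
  have m1: "y \<bullet> (C ^^ (2 * i + 1)) y = u \<bullet> C u"
    using add[of i "Suc i"] by (simp add: u_def mult_2)
  have m2: "y \<bullet> (C ^^ (2 * i + 2)) y = C u \<bullet> C u"
    using add[of "Suc i" "Suc i"] by (simp add: u_def mult_2)
  have m3: "y \<bullet> (C ^^ (2 * i + 3)) y = C u \<bullet> C (C u)"
    using add[of "Suc i" "Suc (Suc i)"] by (simp add: u_def mult_2 eval_nat_numeral)
  \<comment> \<open>c |u|^2 <= u . C u <= |u| |C u| gives c |u| <= |C u|; one more factor |C u|
    yields the odd case of the first claim.\<close>
  have n2: "c * (u \<bullet> C u) \<le> C u \<bullet> C u"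
  proof -
    have "c * (norm u)\<^sup>2 \<le> norm u * norm (C u)"
      using pos[OF uV] norm_cauchy_schwarz[of u "C u"] by linarith
    then have "c * norm u \<le> norm (C u)"
      by (cases "u = 0") (auto simp: power2_eq_square mult.assoc mult_le_cancel_left)
    then have "(c * norm u) * norm (C u) \<le> norm (C u) * norm (C u)"
      by (intro mult_right_mono) auto
    moreover have "c * (u \<bullet> C u) \<le> c * (norm u * norm (C u))"
      using c norm_cauchy_schwarz[of u "C u"] by (intro mult_left_mono) auto
    ultimately show ?thesis by (simp add: dot_square_norm power2_eq_square mult.assoc)
  qed
  have lc0: "(u \<bullet> C u)\<^sup>2 \<le> (u \<bullet> u) * (C u \<bullet> C u)"
    by (rule Cauchy_Schwarz_ineq)
  have lc1: "(C u \<bullet> C u)\<^sup>2 \<le> (u \<bullet> C u) * (C u \<bullet> C (C u))"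
    using form_Cauchy_Schwarz[OF sa V pos0 uV CuV] sa' by simp
  have e: "2 * i + 1 = Suc (2*i)" "2 * i + 2 = Suc (Suc (2*i))" "2 * i + 3 = Suc (Suc (Suc (2*i)))"
    by auto
  show "c * (y \<bullet> (C ^^ k) y) \<le> y \<bullet> (C ^^ Suc k) y"
    using i
  proof
    assume "k = 2 * i"
    then show ?thesis using m0 m1 pos[OF uV] by (simp add: e dot_square_norm)
  next
    assume k: "k = 2 * i + 1"
    then have "Suc k = 2 * i + 2" by simp
    then show ?thesis using n2 unfolding k m1 m2 by (metis k m1 m2)
  qed
  show "(y \<bullet> (C ^^ Suc k) y)\<^sup>2 \<le> (y \<bullet> (C ^^ k) y) * (y \<bullet> (C ^^ Suc (Suc k)) y)"
    using i
  proof
    assume k: "k = 2 * i"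
    have "Suc k = 2*i+1" "Suc (Suc k) = 2*i+2" using k by auto
    then show ?thesis using lc0 m0 m1 m2 k by metis
  next
    assume k: "k = 2 * i + 1"
    have "Suc k = 2*i+2" "Suc (Suc k) = 2*i+3" using k by auto
    then show ?thesis using lc1 m1 m2 m3 k by metis
  qed
qed

lemma moment_pos:
  assumes C: "posdef_on V c C" and c: "c > 0" and y: "y \<in> V" "y \<noteq> 0"
  shows "y \<bullet> (C ^^ k) y > 0"
proof (induction k)
  case (Suc k)
  then have "0 < c * (y \<bullet> (C ^^ k) y)" using c by simp
  then show ?case using moment_step(1)[OF C c y(1), of k] by linarith
qed (use y in simp)

lemma moment_nonneg:
  assumes C: "posdef_on V c C" and c: "c > 0" and y: "y \<in> V"
  shows "y \<bullet> (C ^^ k) y \<ge> 0"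
proof (cases "y = 0")
  case False then show ?thesis using moment_pos[OF C c y] by (simp add: less_imp_le)
qed simp

text \<open>Chebyshev's association inequality for the spectral measure of \<open>C\<close> at \<open>y\<close>.\<close>

lemma moment_supermultiplicative:
  assumes C: "posdef_on V c C" and c: "c > 0" and y: "y \<in> V"
  shows "(y \<bullet> (C ^^ i) y) * (y \<bullet> (C ^^ j) y) \<le> (y \<bullet> y) * (y \<bullet> (C ^^ (i + j)) y)"
proof (cases "y = 0")
  case False
  show ?thesis
    using logconvex_supermultiplicative[of "\<lambda>k. y \<bullet> (C ^^ k) y" i j, OF moment_pos[OF C c y False]
        moment_step(2)[OF C c y]] by simp
qed simp

text \<open>Jensen's inequality for the spectral measure of \<open>C\<close> at \<open>y\<close>. It
  carries a large value of the quadratic form over to the high power, whose trace Markov's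
  inequality tests.\<close>

lemma moment_power_le:
  assumes C: "posdef_on V c C" and c: "c > 0" and y: "y \<in> V" and y1: "norm y = 1"
  shows "(y \<bullet> C y) ^ k \<le> y \<bullet> (C ^^ k) y"
proof (induction k)
  case 0 then show ?case using y1 by (simp add: dot_square_norm)
next
  case (Suc k)
  have "(y \<bullet> C y) ^ Suc k = (y \<bullet> (C ^^ 1) y) * (y \<bullet> C y) ^ k" by simp
  also have "\<dots> \<le> (y \<bullet> (C ^^ 1) y) * (y \<bullet> (C ^^ k) y)"
    using Suc moment_nonneg[OF C c y, of 1] by (intro mult_left_mono) auto
  also have "\<dots> \<le> (y \<bullet> y) * (y \<bullet> (C ^^ (1 + k)) y)"
    by (rule moment_supermultiplicative[OF C c y])
  finally show ?case using y1 by (simp add: dot_square_norm)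
qed

section \<open>Powers and traces along a rank-one update\<close>

definition rank1_add :: "('a::euclidean_space \<Rightarrow> 'a) \<Rightarrow> 'a \<Rightarrow> real \<Rightarrow> 'a \<Rightarrow> 'a" where
  "rank1_add B y t v = B v + (t * (y \<bullet> v)) *\<^sub>R y"

lemma selfadj_rank1_add:
  assumes "selfadj B" shows "selfadj (rank1_add B y t)"
  using assms unfolding selfadj_def rank1_add_def
  by (auto intro!: linearI simp: linear_add linear_cmul algebra_simps inner_add_left inner_add_right inner_commute)

text \<open>Product rule for the k-th power: the increment y y^T may sit at any of the k places. The
  induction peels off the outermost factor.\<close>

lemma rank1_add_power_derivative:
  fixes B :: "'a::euclidean_space \<Rightarrow> 'a"
  assumes "selfadj B"
  shows "((\<lambda>t. (rank1_add B y t ^^ k) v) has_vector_derivative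
     (\<Sum>i<k. (y \<bullet> (rank1_add B y t ^^ (k - 1 - i)) v) *\<^sub>R (rank1_add B y t ^^ i) y)) (at t)"
proof (induction k)
  case 0 then show ?case by simp
next
  case (Suc k)
  define D where "D = (\<Sum>i<k. (y \<bullet> (rank1_add B y t ^^ (k - 1 - i)) v) *\<^sub>R (rank1_add B y t ^^ i) y)"
  define F where "F = (\<lambda>t. (rank1_add B y t ^^ k) v)"
  have F: "(F has_vector_derivative D) (at t)" using Suc by (simp add: D_def F_def)
  have lin: "linear B" using assms by (simp add: selfadj_def)
  have linC: "linear (rank1_add B y t)" using selfadj_rank1_add[OF assms] by (simp add: selfadj_def)
  have 1: "((\<lambda>t. B (F t)) has_vector_derivative B D) (at t)"
    using bounded_linear.has_vector_derivative[OF linear_conv_bounded_linear[THEN iffD1, OF lin] F] .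
  have 2: "((\<lambda>t. (t * (y \<bullet> F t)) *\<^sub>R y) has_vector_derivative (t * (y \<bullet> D) + (y \<bullet> F t)) *\<^sub>R y) (at t)"
  proof -
    have "((\<lambda>t. y \<bullet> F t) has_vector_derivative (y \<bullet> D)) (at t)"
      by (rule bounded_linear.has_vector_derivative[OF bounded_linear_inner_right F])
    then have "((\<lambda>t. y \<bullet> F t) has_real_derivative (y \<bullet> D)) (at t)"
      by (simp add: has_real_derivative_iff_has_vector_derivative)
    then have "((\<lambda>t. t * (y \<bullet> F t)) has_real_derivative (t * (y \<bullet> D) + (y \<bullet> F t))) (at t)"
      by (auto intro!: derivative_eq_intros)
    then show ?thesis
      by (intro bounded_linear.has_vector_derivative[OF bounded_linear_scaleR_left])
         (simp add: has_real_derivative_iff_has_vector_derivative)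
  qed
  have "((\<lambda>t. (rank1_add B y t ^^ Suc k) v) has_vector_derivative
      (B D + (t * (y \<bullet> D) + (y \<bullet> F t)) *\<^sub>R y)) (at t)"
    using has_vector_derivative_add[OF 1 2] by (simp add: rank1_add_def F_def)
  also have "B D + (t * (y \<bullet> D) + (y \<bullet> F t)) *\<^sub>R y = rank1_add B y t D + (y \<bullet> F t) *\<^sub>R y"
    by (simp add: rank1_add_def scaleR_add_left)
  also have "rank1_add B y t D =
      (\<Sum>i<k. (y \<bullet> (rank1_add B y t ^^ (k - 1 - i)) v) *\<^sub>R (rank1_add B y t ^^ Suc i) y)"
    unfolding D_def by (simp add: linear_sum[OF linC] linear_cmul[OF linC])
  finally show ?case
    unfolding sum.lessThan_Suc_shift by (simp add: F_def add.commute)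
qed

lemma rank1_add_moment_derivative:
  assumes "selfadj B"
  shows "((\<lambda>t. u \<bullet> (rank1_add B y t ^^ k) v) has_real_derivative
     (\<Sum>i<k. (y \<bullet> (rank1_add B y t ^^ (k - 1 - i)) v) * (u \<bullet> (rank1_add B y t ^^ i) y))) (at t)"
proof -
  have "((\<lambda>t. u \<bullet> (rank1_add B y t ^^ k) v) has_vector_derivative
     u \<bullet> (\<Sum>i<k. (y \<bullet> (rank1_add B y t ^^ (k - 1 - i)) v) *\<^sub>R (rank1_add B y t ^^ i) y)) (at t)"
    by (rule bounded_linear.has_vector_derivative[OF bounded_linear_inner_right
          rank1_add_power_derivative[OF assms]])
  then show ?thesis
    by (simp add: has_real_derivative_iff_has_vector_derivative inner_sum_right)
qed

definition orthonormal_set :: "'a::euclidean_space set \<Rightarrow> bool" where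
  "orthonormal_set E \<longleftrightarrow> finite E \<and> pairwise orthogonal E \<and> (\<forall>e\<in>E. norm e = 1)"

lemma orthonormal_set_Parseval:
  assumes "orthonormal_set E" "u \<in> span E"
  shows "(\<Sum>e\<in>E. (e \<bullet> u) * (e \<bullet> v)) = u \<bullet> v"
proof -
  have "u \<bullet> v = (\<Sum>e\<in>E. (u \<bullet> e) *\<^sub>R e) \<bullet> v"
    using orthonormal_basis_expand[of E u] assms by (simp add: orthonormal_set_def)
  also have "\<dots> = (\<Sum>e\<in>E. (e \<bullet> u) * (e \<bullet> v))"
    unfolding inner_sum_left by (simp add: inner_commute)
  finally show ?thesis by simp
qed

definition trace_on :: "'a::euclidean_space set \<Rightarrow> ('a \<Rightarrow> 'a) \<Rightarrow> real" where
  "trace_on E C = (\<Sum>e\<in>E. e \<bullet> C e)"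

text \<open>Parseval over \<open>E\<close> plays the part of cyclicity of the trace: each of the k
  terms of the product rule collapses to the same moment of y. Rank one makes the derivative of the
  trace a scalar moment.\<close>

lemma trace_rank1_add_derivative:
  assumes B: "selfadj B" and E: "orthonormal_set E"
    and V: "\<And>i. (rank1_add B y t ^^ i) y \<in> span E"
  shows "((\<lambda>t. trace_on E (rank1_add B y t ^^ k)) has_real_derivative
     k * (y \<bullet> (rank1_add B y t ^^ (k - 1)) y)) (at t)"
proof -
  let ?C = "rank1_add B y t"
  have sa: "selfadj ?C" by (rule selfadj_rank1_add[OF B])
  have "((\<lambda>t. trace_on E (rank1_add B y t ^^ k)) has_real_derivative
      (\<Sum>e\<in>E. \<Sum>i<k. (y \<bullet> (?C ^^ (k - 1 - i)) e) * (e \<bullet> (?C ^^ i) y))) (at t)"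
    unfolding trace_on_def by (intro DERIV_sum rank1_add_moment_derivative[OF B])
  also have "(\<Sum>e\<in>E. \<Sum>i<k. (y \<bullet> (?C ^^ (k - 1 - i)) e) * (e \<bullet> (?C ^^ i) y)) =
      (\<Sum>i<k. \<Sum>e\<in>E. (e \<bullet> (?C ^^ i) y) * (e \<bullet> (?C ^^ (k - 1 - i)) y))"
  proof (subst sum.swap, intro sum.cong refl)
    fix i e
    have "y \<bullet> (?C ^^ (k - 1 - i)) e = e \<bullet> (?C ^^ (k - 1 - i)) y"
      using selfadj_funpow[OF sa, of "k - 1 - i" y e] by (metis inner_commute)
    then show "(y \<bullet> (?C ^^ (k - 1 - i)) e) * (e \<bullet> (?C ^^ i) y) =
        (e \<bullet> (?C ^^ i) y) * (e \<bullet> (?C ^^ (k - 1 - i)) y)"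
      by simp
  qed
  also have "\<dots> = (\<Sum>i<k. (?C ^^ i) y \<bullet> (?C ^^ (k - 1 - i)) y)"
    by (intro sum.cong refl orthonormal_set_Parseval[OF E V])
  also have "\<dots> = (\<Sum>i<k. y \<bullet> (?C ^^ (k - 1)) y)"
  proof (intro sum.cong refl)
    fix i assume "i \<in> {..<k}"
    then have e: "k - 1 = i + (k - 1 - i)" by auto
    have "(?C ^^ i) y \<bullet> (?C ^^ (k - 1 - i)) y = y \<bullet> (?C ^^ i) ((?C ^^ (k - 1 - i)) y)"
      by (rule selfadj_funpow[OF sa])
    also have "\<dots> = y \<bullet> (?C ^^ (k - 1)) y"
      by (subst (2) e, simp only: funpow_add o_apply)
    finally show "(?C ^^ i) y \<bullet> (?C ^^ (k - 1 - i)) y = y \<bullet> (?C ^^ (k - 1)) y" .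
  qed
  finally show ?thesis by simp
qed

text \<open>The form is affine in t, so a lower bound at both ends persists between them.
  \<open>closed_segment\<close> admits negative \<open>\<tau>\<close>, which the lower tail
  needs.\<close>

lemma posdef_on_rank1_between:
  assumes "posdef_on V c B" "posdef_on V c (rank1_add B y \<tau>)" "y \<in> V" "t \<in> closed_segment 0 \<tau>"
  shows "posdef_on V c (rank1_add B y t)"
proof -
  obtain u where u: "0 \<le> u" "u \<le> 1" "t = u * \<tau>"
    using assms(4) by (auto simp: in_segment)
  have "c * (norm v)\<^sup>2 \<le> v \<bullet> rank1_add B y t v" if v: "v \<in> V" for v
  proof -
    have "(1 - u) * (c * (norm v)\<^sup>2) + u * (c * (norm v)\<^sup>2)
        \<le> (1 - u) * (v \<bullet> B v) + u * (v \<bullet> rank1_add B y \<tau> v)"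
      using assms u v by (intro add_mono mult_left_mono) (auto simp: posdef_on_def)
    then show ?thesis using u by (simp add: rank1_add_def inner_add_right algebra_simps)
  qed
  moreover have "rank1_add B y t v \<in> V" if "v \<in> V" for v
    using assms that by (auto simp: posdef_on_def rank1_add_def intro!: subspace_add subspace_scale)
  ultimately show ?thesis
    using assms selfadj_rank1_add by (auto simp: posdef_on_def)
qed

text \<open>A rank-one substitute for the Golden--Thompson inequality, with \<open>C\<^sup>N\<close> in place of
  the matrix exponential. Along \<open>C\<^sub>t = B + t y y\<^sup>T\<close> the moment
  \<open>\<psi> t = y \<bullet> C\<^sub>t\<^sup>N\<^sup>-\<^sup>1 y\<close> satisfies \<open>\<psi>' \<le> N R \<psi>\<close>, by the association
  inequality, and the trace of \<open>C\<^sub>t\<^sup>N\<close> has derivative \<open>N \<psi>\<close>.\<close>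

lemma trace_power_rank1_le:
  fixes B :: "'a::euclidean_space \<Rightarrow> 'a"
  assumes E: "orthonormal_set E" and B: "posdef_on (span E) c B"
    and B\<tau>: "posdef_on (span E) c (rank1_add B y \<tau>)" and c: "c > 0"
    and y: "y \<in> span E" and R: "(norm y)\<^sup>2 \<le> c * R" "R > 0" and N: "N \<ge> 2"
  shows "trace_on E (rank1_add B y \<tau> ^^ N) \<le>
     trace_on E (B ^^ N) + (exp (N * R * \<tau>) - 1) / R * (y \<bullet> (B ^^ (N - 1)) y)"
proof -
  define C where "C = rank1_add B y"
  define \<psi> where "\<psi> t = y \<bullet> (C t ^^ (N - 1)) y" for t
  have saB: "selfadj B" using B by (simp add: posdef_on_def)
  have C0: "C 0 = B" by (rule ext) (simp add: C_def rank1_add_def)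
  have pd: "posdef_on (span E) c (C t)" if "t \<in> closed_segment 0 \<tau>" for t
    unfolding C_def by (rule posdef_on_rank1_between[OF B B\<tau> y that])
  have \<psi>_deriv: "\<exists>d. (\<psi> has_real_derivative d) (at t) \<and> d \<le> N * R * \<psi> t"
    if t: "t \<in> closed_segment 0 \<tau>" for t
  proof (intro exI conjI)
    let ?d = "\<Sum>i<N - 1. (y \<bullet> (C t ^^ (N - 1 - 1 - i)) y) * (y \<bullet> (C t ^^ i) y)"
    show "(\<psi> has_real_derivative ?d) (at t)"
      unfolding \<psi>_def C_def by (rule rank1_add_moment_derivative[OF saB])
    have ge0: "y \<bullet> (C t ^^ i) y \<ge> 0" for i by (rule moment_nonneg[OF pd[OF t] c y])
    \<comment> \<open>A product of two moments of total order N - 2 is at most |y|^2 <= c R times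
      the moment of order N - 2; the factor c is then spent on raising the order to N - 1.\<close>
    have "?d \<le> (\<Sum>i<N - 1. R * \<psi> t)"
    proof (rule sum_mono)
      fix i assume i: "i \<in> {..<N - 1}"
      have "(y \<bullet> (C t ^^ (N - 1 - 1 - i)) y) * (y \<bullet> (C t ^^ i) y)
          \<le> (y \<bullet> y) * (y \<bullet> (C t ^^ (N - 1 - 1 - i + i)) y)"
        by (rule moment_supermultiplicative[OF pd[OF t] c y])
      also have "N - 1 - 1 - i + i = N - 2" using i by auto
      also have "(y \<bullet> y) * (y \<bullet> (C t ^^ (N - 2)) y) \<le> (c * R) * (y \<bullet> (C t ^^ (N - 2)) y)"
        using R ge0 by (intro mult_right_mono) (auto simp: dot_square_norm)
      also have "\<dots> = R * (c * (y \<bullet> (C t ^^ (N - 2)) y))" by simp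
      also have "\<dots> \<le> R * (y \<bullet> (C t ^^ Suc (N - 2)) y)"
        using R moment_step(1)[OF pd[OF t] c y] by (intro mult_left_mono) auto
      also have "Suc (N - 2) = N - 1" using N by simp
      finally show "(y \<bullet> (C t ^^ (N - 1 - 1 - i)) y) * (y \<bullet> (C t ^^ i) y) \<le> R * \<psi> t"
        by (simp add: \<psi>_def)
    qed
    \<comment> \<open>Rounding N - 1 up to N matches the factor N in the derivative of the trace, so
      that (exp (N R t) - 1) / R is the exact primitive.\<close>
    also have "\<dots> \<le> N * (R * \<psi> t)"
      using R ge0[of "N - 1"] N by (auto simp: \<psi>_def intro!: mult_right_mono)
    finally show "?d \<le> N * R * \<psi> t" by simp
  qed
  \<comment> \<open>Gronwall's integrating factor, which makes h nonincreasing.\<close>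
  define h where "h t = exp (- (N * R) * t) * \<psi> t" for t
  have h_deriv: "\<exists>d. (h has_real_derivative d) (at t) \<and> d \<le> 0" if t: "t \<in> closed_segment 0 \<tau>" for t
  proof -
    obtain d where d: "(\<psi> has_real_derivative d) (at t)" "d \<le> N * R * \<psi> t"
      using \<psi>_deriv[OF t] by blast
    have "(h has_real_derivative (exp (- (N * R) * t) * (d - N * R * \<psi> t))) (at t)"
      unfolding h_def by (rule derivative_eq_intros d refl | simp add: algebra_simps)+
    moreover have "exp (- (N * R) * t) * (d - N * R * \<psi> t) \<le> 0"
      using d by (intro mult_nonneg_nonpos) auto
    ultimately show ?thesis by blast
  qed
  have h_mono: "h b \<le> h a" if "a \<le> b" "{a..b} \<subseteq> closed_segment 0 \<tau>" for a b
    using that h_deriv by (intro DERIV_nonpos_imp_nonincreasing[of a b h]) auto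
  \<comment> \<open>The derivative of G has the sign of h t - h 0: nonpositive for t > 0 and
    nonnegative for t < 0. Hence G is largest at 0 whatever the sign of
    \<open>\<tau>\<close>.\<close>
  define G where "G t = trace_on E (C t ^^ N) - (exp (N * R * t) - 1) / R * \<psi> 0" for t
  have G_deriv: "(G has_real_derivative (N * exp (N * R * t) * (h t - h 0))) (at t)"
    if t: "t \<in> closed_segment 0 \<tau>" for t
  proof -
    have "((\<lambda>t. trace_on E (C t ^^ N)) has_real_derivative (N * \<psi> t)) (at t)"
      unfolding C_def \<psi>_def
      using posdef_on_funpow_mem[OF pd[OF t] y] by (intro trace_rank1_add_derivative saB E) (simp add: C_def)
    then have "(G has_real_derivative (N * \<psi> t - N * exp (N * R * t) * \<psi> 0)) (at t)"
      unfolding G_def using R by (auto intro!: derivative_eq_intros)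
    also have "N * \<psi> t - N * exp (N * R * t) * \<psi> 0 = N * exp (N * R * t) * (h t - h 0)"
      by (simp add: h_def algebra_simps exp_minus)
    finally show ?thesis .
  qed
  have "G \<tau> \<le> G 0"
  proof (cases "\<tau> \<ge> 0")
    case True
    then have seg: "closed_segment 0 \<tau> = {0..\<tau>}" by (simp add: closed_segment_eq_real_ivl)
    show ?thesis
    proof (rule DERIV_nonpos_imp_nonincreasing[of 0 \<tau> G, OF True])
      fix t assume t: "0 \<le> t" "t \<le> \<tau>"
      have "h t \<le> h 0" using t by (intro h_mono) (auto simp: seg)
      then have "N * exp (N * R * t) * (h t - h 0) \<le> 0" by (intro mult_nonneg_nonpos) auto
      then show "\<exists>y. (G has_real_derivative y) (at t) \<and> y \<le> 0"
        using G_deriv[of t] t by (auto simp: seg)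
    qed
  next
    case False
    then have seg: "closed_segment 0 \<tau> = {\<tau>..0}" by (simp add: closed_segment_eq_real_ivl)
    show ?thesis
    proof (rule DERIV_nonneg_imp_nondecreasing[of \<tau> 0 G])
      show "\<tau> \<le> 0" using False by simp
      fix t assume t: "\<tau> \<le> t" "t \<le> 0"
      have "h 0 \<le> h t" using t by (intro h_mono) (auto simp: seg)
      then have "N * exp (N * R * t) * (h t - h 0) \<ge> 0" by (intro mult_nonneg_nonneg) auto
      then show "\<exists>y. (G has_real_derivative y) (at t) \<and> y \<ge> 0"
        using G_deriv[of t] t by (auto simp: seg)
    qed
  qed
  then show ?thesis by (simp add: G_def C0 \<psi>_def) (simp add: C_def)
qed

section \<open>Matrix Chernoff bounds for sampled tight frames\<close>

text \<open>Serves the lower tail, where the trace of the power N - 1 enters with a negative factor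
  and must not be smaller than that of the power N. If the lower order is odd, log-convexity turns
  the inequality one step ahead into the wanted one.\<close>

lemma moment_contract:
  assumes C: "posdef_on V c C" and c: "c > 0" and y: "y \<in> V"
    and le: "\<And>v. v \<in> V \<Longrightarrow> v \<bullet> C v \<le> (norm v)\<^sup>2"
  shows "y \<bullet> (C ^^ Suc k) y \<le> y \<bullet> (C ^^ k) y"
proof (induction k)
  case 0
  then show ?case using le[OF y] by (simp add: dot_square_norm)
next
  case (Suc k)
  show ?case
  proof (cases "y = 0")
    case False
    note pos = moment_pos[OF C c y False]
    obtain i where i: "Suc k = 2 * i \<or> Suc k = 2 * i + 1" by (metis oddE evenE)
    define u where "u = (C ^^ i) y"
    have sa: "selfadj C" using C by (simp add: posdef_on_def)
    have add: "y \<bullet> (C ^^ (i + j)) y = (C ^^ i) y \<bullet> (C ^^ j) y" for i j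
      by (simp add: funpow_add selfadj_funpow[OF sa])
    have uV: "u \<in> V" and CuV: "C u \<in> V"
      using posdef_on_funpow_mem[OF C y] posdef_on_funpow_mem[OF C y, of "Suc i"] by (auto simp: u_def)
    have m0: "y \<bullet> (C ^^ (2 * i)) y = u \<bullet> u"
      using add[of i i] by (simp add: u_def mult_2)
    have m1: "y \<bullet> (C ^^ (2 * i + 1)) y = u \<bullet> C u"
      using add[of i "Suc i"] by (simp add: u_def mult_2)
    have m2: "y \<bullet> (C ^^ (2 * i + 2)) y = C u \<bullet> C u"
      using add[of "Suc i" "Suc i"] by (simp add: u_def mult_2)
    have m3: "y \<bullet> (C ^^ (2 * i + 3)) y = C u \<bullet> C (C u)"
      using add[of "Suc i" "Suc (Suc i)"] by (simp add: u_def mult_2 eval_nat_numeral)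
    show ?thesis using i
    proof
      assume k: "Suc k = 2 * i"
      then have "y \<bullet> (C ^^ Suc (Suc k)) y = u \<bullet> C u" using m1 by (metis Suc_eq_plus1)
      then show ?thesis using m0 k le[OF uV] by (metis dot_square_norm)
    next
      assume k: "Suc k = 2 * i + 1"
      have e2: "Suc (Suc k) = 2 * i + 2" and e3: "Suc (Suc (Suc k)) = 2 * i + 3" using k by auto
      have "(C u \<bullet> C u)\<^sup>2 \<le> (u \<bullet> C u) * (C u \<bullet> C (C u))"
        using moment_step(2)[OF C c y, of "Suc k"] unfolding e2 e3 k m1 m2 m3 by (metis e2 e3 k m1 m2 m3)
      also have "\<dots> \<le> (u \<bullet> C u) * (C u \<bullet> C u)"
        using le[OF CuV] pos[of "2 * i + 1"] unfolding m1
        by (intro mult_left_mono) (auto simp: dot_square_norm)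
      finally have "(C u \<bullet> C u) * (C u \<bullet> C u) \<le> (u \<bullet> C u) * (C u \<bullet> C u)"
        by (simp add: power2_eq_square)
      then have "C u \<bullet> C u \<le> u \<bullet> C u"
        using pos[of "2 * i + 2"] unfolding m2 by (simp add: mult_le_cancel_right)
      then show ?thesis unfolding e2 k m1 m2 by (metis e2 k m1 m2)
    qed
  qed simp
qed

text \<open>An even power is a square, so its trace is the squared Hilbert-Schmidt norm of C^p; this
  avoids completing f to an orthonormal basis.\<close>

lemma moment_le_trace:
  assumes E: "orthonormal_set E" and C: "posdef_on (span E) c C" and f: "f \<in> span E" "norm f = 1"
  shows "f \<bullet> (C ^^ (2 * p)) f \<le> trace_on E (C ^^ (2 * p))"
proof -
  have sa: "selfadj C" using C by (simp add: posdef_on_def)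
  have sq: "v \<bullet> (C ^^ (2 * p)) v = (norm ((C ^^ p) v))\<^sup>2" for v
    using selfadj_funpow[OF sa, of p v "(C ^^ p) v"]
    by (simp add: mult_2 funpow_add dot_square_norm)
  have g: "(C ^^ p) f \<in> span E" by (rule posdef_on_funpow_mem[OF C f(1)])
  have "f \<bullet> (C ^^ (2 * p)) f = (\<Sum>e\<in>E. (e \<bullet> (C ^^ p) f) * (e \<bullet> (C ^^ p) f))"
    using orthonormal_set_Parseval[OF E g, of "(C ^^ p) f"] by (simp add: sq dot_square_norm)
  also have "\<dots> \<le> (\<Sum>e\<in>E. (norm ((C ^^ p) e))\<^sup>2)"
  proof (rule sum_mono)
    fix e
    have "(e \<bullet> (C ^^ p) f)\<^sup>2 = ((C ^^ p) e \<bullet> f)\<^sup>2" by (simp add: selfadj_funpow[OF sa])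
    also have "\<dots> \<le> ((C ^^ p) e \<bullet> (C ^^ p) e) * (f \<bullet> f)" by (rule Cauchy_Schwarz_ineq)
    also have "\<dots> = (norm ((C ^^ p) e))\<^sup>2" using f by (simp add: dot_square_norm)
    finally show "(e \<bullet> (C ^^ p) f) * (e \<bullet> (C ^^ p) f) \<le> (norm ((C ^^ p) e))\<^sup>2"
      by (simp add: power2_eq_square)
  qed
  also have "\<dots> = trace_on E (C ^^ (2 * p))" by (simp add: trace_on_def sq)
  finally show ?thesis .
qed

section \<open>Independent uniform samples\<close>

definition iid_uniform :: "nat \<Rightarrow> (nat \<Rightarrow> 'n::finite) pmf" where
  "iid_uniform k = Pi_pmf {..<k} undefined (\<lambda>_. pmf_of_set UNIV)"

lemma finite_set_iid_uniform: "finite (set_pmf (iid_uniform k :: (nat \<Rightarrow> 'n::finite) pmf))"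
  unfolding iid_uniform_def by (subst set_Pi_pmf) (auto intro!: finite_PiE_dflt)

lemma integrable_iid_uniform [simp]:
  fixes F :: "(nat \<Rightarrow> 'n::finite) \<Rightarrow> real"
  shows "integrable (measure_pmf (iid_uniform k)) F"
  by (rule integrable_measure_pmf_finite[OF finite_set_iid_uniform])

lemma expectation_iid_uniform_0:
  fixes F :: "(nat \<Rightarrow> 'n::finite) \<Rightarrow> real"
  shows "measure_pmf.expectation (iid_uniform 0) F = F (\<lambda>_. undefined)"
  by (simp add: iid_uniform_def)

text \<open>Conditioning on all draws but the last. The moment bounds below are inductions along
  this recursion.\<close>

lemma expectation_iid_uniform_Suc:
  fixes F :: "(nat \<Rightarrow> 'n::finite) \<Rightarrow> real"
  shows "measure_pmf.expectation (iid_uniform (Suc k)) F =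
    measure_pmf.expectation (iid_uniform k) (\<lambda>\<omega>. (\<Sum>j\<in>UNIV. F (fun_upd \<omega> k j)) / CARD('n))"
proof -
  let ?A = "set_pmf (iid_uniform k :: (nat \<Rightarrow> 'n) pmf)"
  have "(iid_uniform (Suc k) :: (nat \<Rightarrow> 'n) pmf) =
      bind_pmf (pmf_of_set UNIV) (\<lambda>j. bind_pmf (iid_uniform k) (\<lambda>\<omega>. return_pmf (fun_upd \<omega> k j)))"
    unfolding iid_uniform_def lessThan_Suc by (subst Pi_pmf_insert') auto
  also have "\<dots> = bind_pmf (iid_uniform k) (\<lambda>\<omega>. map_pmf (\<lambda>j. fun_upd \<omega> k j) (pmf_of_set UNIV))"
    by (subst bind_commute_pmf) (simp add: map_pmf_def)
  finally have eq: "(iid_uniform (Suc k) :: (nat \<Rightarrow> 'n) pmf) = \<dots>" .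
  have "measure_pmf.expectation (iid_uniform (Suc k)) F =
      (\<Sum>\<omega>\<in>?A. pmf (iid_uniform k) \<omega> *\<^sub>R
        measure_pmf.expectation (map_pmf (\<lambda>j. fun_upd \<omega> k j) (pmf_of_set UNIV)) F)"
    unfolding eq by (rule pmf_expectation_bind) (use finite_set_iid_uniform in auto)
  also have "\<dots> = (\<Sum>\<omega>\<in>?A. pmf (iid_uniform k) \<omega> *\<^sub>R ((\<Sum>j\<in>UNIV. F (fun_upd \<omega> k j)) / CARD('n)))"
    by (simp add: integral_map_pmf integral_pmf_of_set)
  also have "\<dots> = measure_pmf.expectation (iid_uniform k) (\<lambda>\<omega>. (\<Sum>j\<in>UNIV. F (fun_upd \<omega> k j)) / CARD('n))"
    by (rule integral_measure_pmf[symmetric]) (use finite_set_iid_uniform in \<open>auto simp: set_pmf_iff\<close>)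
  finally show ?thesis .
qed

lemma iid_uniform_Markov:
  fixes W :: "(nat \<Rightarrow> 'n::finite) \<Rightarrow> real"
  assumes W: "\<And>\<omega>. W \<omega> \<ge> 0" and a: "a > 0" and S: "\<And>\<omega>. \<omega> \<in> S \<Longrightarrow> W \<omega> \<ge> a"
  shows "measure_pmf.prob (iid_uniform k) S \<le> measure_pmf.expectation (iid_uniform k) W / a"
proof -
  have "measure_pmf.prob (iid_uniform k) S = measure_pmf.expectation (iid_uniform k) (indicator S)"
    by simp
  also have "\<dots> \<le> measure_pmf.expectation (iid_uniform k) (\<lambda>\<omega>. W \<omega> / a)"
    using W a S by (intro integral_mono) (auto simp: indicator_def field_simps)
  finally show ?thesis by simp
qed

text \<open>\<open>frame\<close> is isotropy: for uniform j the mean of y_j y_j^T is the identity on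
  the span of \<open>E\<close>. The Chernoff bounds depend on the data only through \<open>R\<close>
  and the cardinality of \<open>E\<close>.\<close>

locale tight_frame =
  fixes E :: "'a::euclidean_space set" and y :: "'n::finite \<Rightarrow> 'a" and R :: real
  assumes E: "orthonormal_set E"
    and y_span: "y j \<in> span E"
    and frame: "u \<in> span E \<Longrightarrow> v \<in> span E \<Longrightarrow> (\<Sum>j\<in>UNIV. (y j \<bullet> u) * (y j \<bullet> v)) = CARD('n) * (u \<bullet> v)"
    and y_bound: "(norm (y j))\<^sup>2 \<le> R" and R_pos: "R > 0"
begin

text \<open>For \<open>\<tau>\<close> = a / N the trace of the N-th power stands in for the matrix
  moment generating function at a.\<close>

definition sampled_op :: "real \<Rightarrow> nat \<Rightarrow> (nat \<Rightarrow> 'n) \<Rightarrow> 'a \<Rightarrow> 'a" where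
  "sampled_op \<tau> k \<omega> v = v + \<tau> *\<^sub>R (\<Sum>i<k. (y (\<omega> i) \<bullet> v) *\<^sub>R y (\<omega> i))"

lemma sampled_op_Suc: "sampled_op \<tau> (Suc k) \<omega> = rank1_add (sampled_op \<tau> k \<omega>) (y (\<omega> k)) \<tau>"
  by (rule ext) (simp add: sampled_op_def rank1_add_def algebra_simps)

lemma sampled_op_cong: "(\<And>i. i < k \<Longrightarrow> \<omega> i = \<omega>' i) \<Longrightarrow> sampled_op \<tau> k \<omega> = sampled_op \<tau> k \<omega>'"
  by (rule ext) (simp add: sampled_op_def)

lemma sampled_op_form: "v \<bullet> sampled_op \<tau> k \<omega> v = (norm v)\<^sup>2 + \<tau> * (\<Sum>i<k. (y (\<omega> i) \<bullet> v)\<^sup>2)"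
  by (simp add: sampled_op_def inner_add_right inner_sum_right dot_square_norm power2_eq_square
      inner_commute)

lemma selfadj_sampled_op: "selfadj (sampled_op \<tau> k \<omega>)"
proof (induction k)
  case 0
  have "sampled_op \<tau> 0 \<omega> = (\<lambda>v. v)" by (rule ext) (simp add: sampled_op_def)
  then show ?case by (simp add: selfadj_def linear_ident)
qed (simp add: sampled_op_Suc selfadj_rank1_add)

lemma posdef_on_sampled_opI:
  assumes "\<And>v. v \<in> span E \<Longrightarrow> c * (norm v)\<^sup>2 \<le> (norm v)\<^sup>2 + \<tau> * (\<Sum>i<k. (y (\<omega> i) \<bullet> v)\<^sup>2)"
  shows "posdef_on (span E) c (sampled_op \<tau> k \<omega>)"
proof -
  have "sampled_op \<tau> k \<omega> v \<in> span E" if "v \<in> span E" for v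
    using that y_span by (auto simp: sampled_op_def intro!: span_add span_scale span_sum)
  then show ?thesis
    using assms by (auto simp: posdef_on_def selfadj_sampled_op sampled_op_form)
qed

lemma sum_sq_le:
  fixes k :: nat
  shows "(\<Sum>i<k. (y (\<omega> i) \<bullet> v)\<^sup>2) \<le> k * R * (norm v)\<^sup>2"
proof -
  have "(y j \<bullet> v)\<^sup>2 \<le> R * (norm v)\<^sup>2" for j
  proof -
    have "(y j \<bullet> v)\<^sup>2 \<le> (y j \<bullet> y j) * (v \<bullet> v)" by (rule Cauchy_Schwarz_ineq)
    also have "\<dots> \<le> R * (norm v)\<^sup>2"
      unfolding dot_square_norm by (intro mult_right_mono y_bound) auto
    finally show ?thesis .
  qed
  then have "(\<Sum>i<k. (y (\<omega> i) \<bullet> v)\<^sup>2) \<le> (\<Sum>i<k. R * (norm v)\<^sup>2)" by (intro sum_mono)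
  then show ?thesis by simp
qed

lemma posdef_on_sampled_op_nonneg: "\<tau> \<ge> 0 \<Longrightarrow> posdef_on (span E) 1 (sampled_op \<tau> k \<omega>)"
  by (rule posdef_on_sampled_opI) (auto intro!: mult_nonneg_nonneg sum_nonneg)

lemma posdef_on_sampled_op_neg:
  fixes k s :: nat and \<tau> :: real
  assumes "\<tau> \<ge> 0" "k \<le> s"
  shows "posdef_on (span E) (1 - \<tau> * s * R) (sampled_op (- \<tau>) k \<omega>)"
proof (rule posdef_on_sampled_opI)
  fix v
  have "\<tau> * (\<Sum>i<k. (y (\<omega> i) \<bullet> v)\<^sup>2) \<le> \<tau> * (k * R * (norm v)\<^sup>2)"
    using assms by (intro mult_left_mono sum_sq_le)
  also have "\<dots> \<le> \<tau> * (s * R * (norm v)\<^sup>2)"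
    using assms R_pos by (intro mult_left_mono mult_right_mono) auto
  finally show "(1 - \<tau> * s * R) * (norm v)\<^sup>2 \<le> (norm v)\<^sup>2 + (- \<tau>) * (\<Sum>i<k. (y (\<omega> i) \<bullet> v)\<^sup>2)"
    by (simp add: algebra_simps)
qed

text \<open>Isotropy converts the average of the moments of the y_j back into a trace, which closes
  the recursion over the draws.\<close>

lemma frame_trace:
  assumes C: "selfadj C" "\<And>v. v \<in> span E \<Longrightarrow> C v \<in> span E"
  shows "(\<Sum>j\<in>UNIV. y j \<bullet> C (y j)) = CARD('n) * trace_on E C"
proof -
  have "(\<Sum>j\<in>UNIV. y j \<bullet> C (y j)) = (\<Sum>j\<in>UNIV. \<Sum>e\<in>E. (e \<bullet> y j) * (e \<bullet> C (y j)))"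
    by (simp add: orthonormal_set_Parseval[OF E y_span])
  also have "\<dots> = (\<Sum>e\<in>E. \<Sum>j\<in>UNIV. (y j \<bullet> e) * (y j \<bullet> C e))"
  proof (subst sum.swap, intro sum.cong refl)
    fix e j
    have "e \<bullet> C (y j) = y j \<bullet> C e" using C(1) by (metis inner_commute selfadj_def)
    then show "(e \<bullet> y j) * (e \<bullet> C (y j)) = (y j \<bullet> e) * (y j \<bullet> C e)" by (simp add: inner_commute)
  qed
  also have "\<dots> = CARD('n) * trace_on E C"
    by (simp add: frame C(2) span_base trace_on_def sum_distrib_left)
  finally show ?thesis .
qed

text \<open>Averaging the rank-one bound over the last draw gives tr B^N + g tr B^(N-1), where g =
  (exp (N R' \<tau>) - 1) / R'; \<open>h\<close> raises the exponent N - 1 to N, and 1 + g <= exp g.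
  Stating \<open>h\<close> with the factor g lets positive g (upper tail) and negative g (lower
  tail) share one induction.\<close>

lemma expected_trace_step:
  assumes pd: "\<And>\<omega> k. k \<le> s \<Longrightarrow> posdef_on (span E) c (sampled_op \<tau> k \<omega>)" and c: "c > 0"
    and R': "R \<le> c * R'" "R' > 0" and N: "N \<ge> 2"
    and h: "\<And>\<omega> k. k \<le> s \<Longrightarrow> (exp (N * R' * \<tau>) - 1) / R' * trace_on E (sampled_op \<tau> k \<omega> ^^ (N - 1))
        \<le> (exp (N * R' * \<tau>) - 1) / R' * trace_on E (sampled_op \<tau> k \<omega> ^^ N)"
    and k: "k \<le> s"
  shows "measure_pmf.expectation (iid_uniform k) (\<lambda>\<omega>. trace_on E (sampled_op \<tau> k \<omega> ^^ N))
     \<le> card E * exp (k * ((exp (N * R' * \<tau>) - 1) / R'))"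
  using k
proof (induction k)
  case 0
  have "sampled_op \<tau> 0 \<omega> = id" for \<omega> by (rule ext) (simp add: sampled_op_def)
  then have "trace_on E (sampled_op \<tau> 0 \<omega> ^^ N) = card E" for \<omega>
    using E by (simp add: trace_on_def dot_square_norm orthonormal_set_def)
  then show ?case by simp
next
  case (Suc k)
  let ?g = "(exp (N * R' * \<tau>) - 1) / R'"
  have step: "(\<Sum>j\<in>UNIV. trace_on E (sampled_op \<tau> (Suc k) (fun_upd \<omega> k j) ^^ N)) / CARD('n)
      \<le> exp ?g * trace_on E (sampled_op \<tau> k \<omega> ^^ N)" for \<omega>
  proof -
    let ?B = "sampled_op \<tau> k \<omega>"
    have upd: "sampled_op \<tau> (Suc k) (fun_upd \<omega> k j) = rank1_add ?B (y j) \<tau>" for j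
      unfolding sampled_op_Suc by (subst sampled_op_cong[of k _ \<omega>]) auto
    have pB: "posdef_on (span E) c ?B" using Suc.prems by (intro pd) simp
    have pC: "posdef_on (span E) c (rank1_add ?B (y j) \<tau>)" for j
      using pd[OF Suc.prems, of "fun_upd \<omega> k j"] by (simp add: upd)
    have bound: "trace_on E (rank1_add ?B (y j) \<tau> ^^ N)
        \<le> trace_on E (?B ^^ N) + ?g * (y j \<bullet> (?B ^^ (N - 1)) (y j))" for j
      using y_bound[of j] R' by (intro trace_power_rank1_le[OF E pB pC c y_span _ _ N]) auto
    have sa: "selfadj (?B ^^ (N - 1))"
      using selfadj_funpow[OF selfadj_sampled_op] linear_funpow[of ?B] selfadj_sampled_op
      unfolding selfadj_def by blast
    have "(\<Sum>j\<in>UNIV. trace_on E (sampled_op \<tau> (Suc k) (fun_upd \<omega> k j) ^^ N))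
        \<le> (\<Sum>j\<in>UNIV. trace_on E (?B ^^ N) + ?g * (y j \<bullet> (?B ^^ (N - 1)) (y j)))"
      unfolding upd by (intro sum_mono bound)
    also have "\<dots> = CARD('n) * trace_on E (?B ^^ N) + ?g * (\<Sum>j\<in>UNIV. y j \<bullet> (?B ^^ (N - 1)) (y j))"
      by (simp add: sum.distrib sum_distrib_left)
    also have "\<dots> = CARD('n) * (trace_on E (?B ^^ N) + ?g * trace_on E (?B ^^ (N - 1)))"
      by (subst frame_trace[OF sa posdef_on_funpow_mem[OF pB]]) (auto simp: algebra_simps)
    finally have "(\<Sum>j\<in>UNIV. trace_on E (sampled_op \<tau> (Suc k) (fun_upd \<omega> k j) ^^ N)) / CARD('n)
        \<le> trace_on E (?B ^^ N) + ?g * trace_on E (?B ^^ (N - 1))"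
      by (simp add: field_simps)
    also have "\<dots> \<le> trace_on E (?B ^^ N) + ?g * trace_on E (?B ^^ N)"
      using h[of k \<omega>] Suc.prems by simp
    also have "\<dots> = (1 + ?g) * trace_on E (?B ^^ N)" by (simp add: algebra_simps)
    also have "\<dots> \<le> exp ?g * trace_on E (?B ^^ N)"
      using moment_nonneg[OF pB c span_base]
      by (intro mult_right_mono exp_ge_add_one_self) (auto simp: trace_on_def intro!: sum_nonneg)
    finally show ?thesis .
  qed
  have "measure_pmf.expectation (iid_uniform (Suc k)) (\<lambda>\<omega>. trace_on E (sampled_op \<tau> (Suc k) \<omega> ^^ N))
      \<le> measure_pmf.expectation (iid_uniform k) (\<lambda>\<omega>. exp ?g * trace_on E (sampled_op \<tau> k \<omega> ^^ N))"
    unfolding expectation_iid_uniform_Suc by (intro integral_mono step) auto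
  also have "\<dots> \<le> exp ?g * (card E * exp (k * ?g))"
    using Suc by simp
  also have "\<dots> = card E * exp (Suc k * ?g)"
  proof -
    have "exp g * (a * exp (k * g)) = a * exp (Suc k * g)" for a g :: real
      by (simp add: distrib_right exp_add)
    then show ?thesis .
  qed
  finally show ?case .
qed

lemma trace_tail:
  assumes pd: "\<And>\<omega> k. k \<le> s \<Longrightarrow> posdef_on (span E) c (sampled_op \<tau> k \<omega>)" and c: "c > 0"
    and R': "R \<le> c * R'" "R' > 0" and p: "p \<ge> 1"
    and h: "\<And>\<omega> k. k \<le> s \<Longrightarrow> (exp (real (2 * p) * R' * \<tau>) - 1) / R' * trace_on E (sampled_op \<tau> k \<omega> ^^ (2 * p - 1))
        \<le> (exp (real (2 * p) * R' * \<tau>) - 1) / R' * trace_on E (sampled_op \<tau> k \<omega> ^^ (2 * p))"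
    and a: "a > 0"
  shows "measure_pmf.prob (iid_uniform s) {\<omega>. \<exists>f\<in>span E. norm f = 1 \<and> a \<le> f \<bullet> sampled_op \<tau> s \<omega> f}
     \<le> card E * exp (s * ((exp (real (2 * p) * R' * \<tau>) - 1) / R')) / a ^ (2 * p)"
proof -
  let ?W = "\<lambda>\<omega>. trace_on E (sampled_op \<tau> s \<omega> ^^ (2 * p))"
  have "measure_pmf.prob (iid_uniform s) {\<omega>. \<exists>f\<in>span E. norm f = 1 \<and> a \<le> f \<bullet> sampled_op \<tau> s \<omega> f}
      \<le> measure_pmf.expectation (iid_uniform s) ?W / a ^ (2 * p)"
  proof (rule iid_uniform_Markov)
    show "?W \<omega> \<ge> 0" for \<omega>
      using moment_nonneg[OF pd[OF order_refl] c span_base] by (auto simp: trace_on_def intro!: sum_nonneg)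
    show "a ^ (2 * p) > 0" using a by simp
    fix \<omega> assume "\<omega> \<in> {\<omega>. \<exists>f\<in>span E. norm f = 1 \<and> a \<le> f \<bullet> sampled_op \<tau> s \<omega> f}"
    then obtain f where f: "f \<in> span E" "norm f = 1" "a \<le> f \<bullet> sampled_op \<tau> s \<omega> f" by auto
    have "a ^ (2 * p) \<le> (f \<bullet> sampled_op \<tau> s \<omega> f) ^ (2 * p)" using f a by (intro power_mono) auto
    also have "\<dots> \<le> f \<bullet> (sampled_op \<tau> s \<omega> ^^ (2 * p)) f"
      by (rule moment_power_le[OF pd[OF order_refl] c f(1,2)])
    also have "\<dots> \<le> ?W \<omega>" by (rule moment_le_trace[OF E pd[OF order_refl] f(1,2)])
    finally show "?W \<omega> \<ge> a ^ (2 * p)" .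
  qed
  also have "\<dots> \<le> card E * exp (s * ((exp (real (2 * p) * R' * \<tau>) - 1) / R')) / a ^ (2 * p)"
    using a p expected_trace_step[OF pd c R' _ h order_refl] by (intro divide_right_mono) auto
  finally show ?thesis .
qed

text \<open>\<open>Q\<close> stands for a homogeneous strict comparison, so that both tails share
  the normalisation.\<close>

lemma unit_vector_reduction:
  assumes "\<exists>f\<in>span E. Q ((norm f)\<^sup>2) (\<Sum>i<s. (y (\<omega> i) \<bullet> f)\<^sup>2)"
    and "\<And>a b t. t > 0 \<Longrightarrow> Q (t * a) (t * b) \<Longrightarrow> Q a b" and "\<not> Q 0 0"
  shows "\<exists>f\<in>span E. norm f = 1 \<and> Q 1 (\<Sum>i<s. (y (\<omega> i) \<bullet> f)\<^sup>2)"
proof -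
  obtain f where f: "f \<in> span E" "Q ((norm f)\<^sup>2) (\<Sum>i<s. (y (\<omega> i) \<bullet> f)\<^sup>2)" using assms(1) by blast
  have "f \<noteq> 0" using f(2) assms(3) by auto
  define g where "g = (1 / norm f) *\<^sub>R f"
  have g: "g \<in> span E" "norm g = 1" using f(1) \<open>f \<noteq> 0\<close> by (auto simp: g_def span_scale)
  have fg: "f = norm f *\<^sub>R g" using \<open>f \<noteq> 0\<close> by (simp add: g_def)
  have "(\<Sum>i<s. (y (\<omega> i) \<bullet> f)\<^sup>2) = (norm f)\<^sup>2 * (\<Sum>i<s. (y (\<omega> i) \<bullet> g)\<^sup>2)"
    by (subst (1) fg) (simp add: power_mult_distrib sum_distrib_left)
  then have "Q 1 (\<Sum>i<s. (y (\<omega> i) \<bullet> g)\<^sup>2)"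
    using f(2) \<open>f \<noteq> 0\<close> assms(2)[of "(norm f)\<^sup>2" 1] by simp
  then show ?thesis using g by blast
qed

end

section \<open>Scalar comparison of Chernoff exponents\<close>

lemma Bennett_ge_Bernstein:
  fixes x :: real
  assumes "x \<ge> 0"
  shows "x\<^sup>2 / (2 + 2 * x / 3) \<le> (1 + x) * ln (1 + x) - x"
proof -
  \<comment> \<open>x^2 / (2 + 2 x / 3) is split into partial fractions to ease differentiation. F
    and its derivative vanish at 0, and the second derivative is nonnegative by 27 (1 + t) <= (3 +
    t)^3.\<close>
  define F where "F t = (1 + t) * ln (1 + t) - t - 3/2 * (t - 3 + 9 / (3 + t))" for t :: real
  define F' where "F' t = ln (1 + t) - 3/2 * (1 - 9 / (3 + t)\<^sup>2)" for t :: real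
  have dF: "(F has_real_derivative F' t) (at t)" if "t \<ge> 0" for t
  proof -
    have "(F has_real_derivative
        (ln (1 + t) + (1 + t) * (1 / (1 + t)) - 1 - 3/2 * (1 - 9 / ((3 + t) * (3 + t))))) (at t)"
      unfolding F_def using that by (auto intro!: derivative_eq_intros)
    then show ?thesis using that by (simp add: F'_def power2_eq_square)
  qed
  have dF': "(F' has_real_derivative (1 / (1 + t) - 27 / (3 + t) ^ 3)) (at t)" if "t \<ge> 0" for t
  proof -
    have "(F' has_real_derivative
        (1 / (1 + t) - 3/2 * (9 * (2 * (3 + t)) / ((3 + t)\<^sup>2)\<^sup>2))) (at t)"
      unfolding F'_def using that
      by ((auto intro!: derivative_eq_intros simp: power2_eq_square)[1])
         (simp add: divide_simps, simp add: algebra_simps)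
    also have "3/2 * (9 * (2 * (3 + t)) / ((3 + t)\<^sup>2)\<^sup>2) = 27 / (3 + t) ^ 3"
    proof -
      have "3/2 * (9 * (2 * u) / (u\<^sup>2)\<^sup>2) = 27 / u ^ 3" if "u > 0" for u :: real
        using that by (simp add: field_simps eval_nat_numeral)
      from this[of "3 + t"] show ?thesis using that by linarith
    qed
    finally show ?thesis .
  qed
  have nn: "1 / (1 + t) - 27 / (3 + t) ^ 3 \<ge> 0" if "t \<ge> 0" for t :: real
  proof -
    have "27 * (1 + t) \<le> (3 + t) ^ 3"
      using that by (simp add: eval_nat_numeral algebra_simps)
    then show ?thesis using that by (simp add: field_simps)
  qed
  have F'_nonneg: "F' 0 \<le> F' t" if "t \<ge> 0" for t
    using that dF' nn by (intro DERIV_nonneg_imp_nondecreasing[of 0 t F']) blast+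
  have "F' 0 = 0" by (simp add: F'_def)
  then have "F 0 \<le> F x"
    using assms dF F'_nonneg by (intro DERIV_nonneg_imp_nondecreasing[of 0 x F]) metis+
  then have "3/2 * (x - 3 + 9 / (3 + x)) \<le> (1 + x) * ln (1 + x) - x"
    by (simp add: F_def)
  also have "3/2 * (x - 3 + 9 / (3 + x)) = x\<^sup>2 / (2 + 2 * x / 3)"
    using assms by (simp add: field_simps power2_eq_square)
  finally show ?thesis .
qed

lemma exp_minus_le_quadratic:
  fixes x :: real
  assumes "x \<ge> 0"
  shows "exp (- x) \<le> 1 - x + x\<^sup>2 / 2"
proof -
  define G where "G t = 1 - t + t\<^sup>2 / 2 - exp (- t)" for t :: real
  have "G 0 \<le> G x"
  proof (rule DERIV_nonneg_imp_nondecreasing[OF assms])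
    fix t :: real assume "0 \<le> t"
    have "(G has_real_derivative (- 1 + t + exp (- t))) (at t)"
      unfolding G_def by (auto intro!: derivative_eq_intros)
    moreover have "- 1 + t + exp (- t) \<ge> 0" using exp_ge_add_one_self[of "- t"] by simp
    ultimately show "\<exists>y. (G has_real_derivative y) (at t) \<and> y \<ge> 0" by blast
  qed
  then show ?thesis by (simp add: G_def)
qed

lemma exp_limit_even: "(\<lambda>p. (1 + a / real (2 * p)) ^ (2 * p)) \<longlonglongrightarrow> exp (a::real)"
proof -
  have "filterlim (\<lambda>p::nat. 2 * p) at_top sequentially"
    by (rule filterlim_subseq) (simp add: strict_mono_def)
  from filterlim_compose[OF tendsto_exp_limit_sequentially[of a] this] show ?thesis .
qed

context tight_frame
begin

text \<open>The probability does not depend on p, while the trace bound holds for every p >= 1 with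
  step \<theta> / (2 p); as p grows, (1 + a / (2 p))^(2 p) tends to exp a.\<close>

lemma chernoff_upper_param:
  assumes x: "x \<ge> 0" and \<theta>: "\<theta> \<ge> 0"
  shows "measure_pmf.prob (iid_uniform s)
      {\<omega>. \<exists>f\<in>span E. (1 + x) * real s * (norm f)\<^sup>2 < (\<Sum>i<s. (y (\<omega> i) \<bullet> f)\<^sup>2)}
    \<le> card E * exp (s * ((exp (R * \<theta>) - 1) / R)) / exp (\<theta> * (1 + x) * s)"
    (is "?P \<le> _")
proof (rule LIMSEQ_le_const)
  let ?a = "\<theta> * (1 + x) * s"
  have a0: "?a \<ge> 0" using x \<theta> by simp
  show "(\<lambda>p. card E * exp (s * ((exp (R * \<theta>) - 1) / R)) / (1 + ?a / real (2 * p)) ^ (2 * p))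
      \<longlonglongrightarrow> card E * exp (s * ((exp (R * \<theta>) - 1) / R)) / exp ?a"
    by (intro tendsto_divide tendsto_const exp_limit_even) simp
  show "\<exists>N. \<forall>p\<ge>N. ?P \<le> card E * exp (s * ((exp (R * \<theta>) - 1) / R)) / (1 + ?a / real (2 * p)) ^ (2 * p)"
  proof (intro exI[of _ 1] allI impI)
    fix p :: nat assume p: "1 \<le> p"
    define \<tau> where "\<tau> = \<theta> / real (2 * p)"
    have \<tau>: "\<tau> \<ge> 0" using \<theta> by (simp add: \<tau>_def)
    have e: "real (2 * p) * R * \<tau> = R * \<theta>" using p by (simp add: \<tau>_def field_simps)
    let ?a' = "1 + \<tau> * (1 + x) * s"
    have pd: "posdef_on (span E) 1 (sampled_op \<tau> k \<omega>)" for k \<omega>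
      by (rule posdef_on_sampled_op_nonneg[OF \<tau>])
    have "?P \<le> measure_pmf.prob (iid_uniform s)
        {\<omega>. \<exists>f\<in>span E. norm f = 1 \<and> ?a' \<le> f \<bullet> sampled_op \<tau> s \<omega> f}"
    proof (rule measure_pmf.finite_measure_mono)
      show "{\<omega>. \<exists>f\<in>span E. (1 + x) * real s * (norm f)\<^sup>2 < (\<Sum>i<s. (y (\<omega> i) \<bullet> f)\<^sup>2)} \<subseteq>
        {\<omega>. \<exists>f\<in>span E. norm f = 1 \<and> ?a' \<le> f \<bullet> sampled_op \<tau> s \<omega> f}"
      proof safe
        fix \<omega> f assume f: "f \<in> span E" "(1 + x) * real s * (norm f)\<^sup>2 < (\<Sum>i<s. (y (\<omega> i) \<bullet> f)\<^sup>2)"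
        have "\<exists>f\<in>span E. norm f = 1 \<and> (1 + x) * real s * 1 < (\<Sum>i<s. (y (\<omega> i) \<bullet> f)\<^sup>2)"
        proof (rule unit_vector_reduction[where Q = "\<lambda>a b. (1 + x) * real s * a < b"])
          fix a b t :: real assume t: "t > 0" "(1 + x) * real s * (t * a) < t * b"
          then have "t * ((1 + x) * real s * a) < t * b" by (simp only: mult.left_commute[of t])
          then show "(1 + x) * real s * a < b" using t(1) by simp
        qed (use f in auto)
        then obtain g where g: "g \<in> span E" "norm g = 1" "(1 + x) * real s < (\<Sum>i<s. (y (\<omega> i) \<bullet> g)\<^sup>2)"
          by auto
        have "\<tau> * ((1 + x) * real s) \<le> \<tau> * (\<Sum>i<s. (y (\<omega> i) \<bullet> g)\<^sup>2)"
          using g \<tau> by (intro mult_left_mono) auto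
        then have "?a' \<le> g \<bullet> sampled_op \<tau> s \<omega> g" using g by (simp add: sampled_op_form mult.assoc)
        then show "\<exists>f\<in>span E. norm f = 1 \<and> ?a' \<le> f \<bullet> sampled_op \<tau> s \<omega> f" using g by blast
      qed
    qed simp
    also have "\<dots> \<le> card E * exp (s * ((exp (real (2 * p) * R * \<tau>) - 1) / R)) / ?a' ^ (2 * p)"
    proof (rule trace_tail[OF pd])
      fix k \<omega>
      have "trace_on E (sampled_op \<tau> k \<omega> ^^ (2 * p - 1)) \<le> trace_on E (sampled_op \<tau> k \<omega> ^^ Suc (2 * p - 1))"
        unfolding trace_on_def using moment_step(1)[OF pd _ span_base, where k = "2 * p - 1"]
        by (intro sum_mono) auto
      also have "Suc (2 * p - 1) = 2 * p" using p by simp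
      finally show "(exp (real (2 * p) * R * \<tau>) - 1) / R * trace_on E (sampled_op \<tau> k \<omega> ^^ (2 * p - 1))
        \<le> (exp (real (2 * p) * R * \<tau>) - 1) / R * trace_on E (sampled_op \<tau> k \<omega> ^^ (2 * p))"
        using R_pos \<theta> unfolding e by (intro mult_left_mono) auto
    qed (use R_pos p \<tau> x in \<open>auto intro!: add_pos_nonneg\<close>)
    also have "?a' = 1 + ?a / real (2 * p)" by (simp add: \<tau>_def)
    finally show "?P \<le> card E * exp (s * ((exp (R * \<theta>) - 1) / R)) / (1 + ?a / real (2 * p)) ^ (2 * p)"
      unfolding e .
  qed
qed

lemma chernoff_upper:
  assumes x: "x \<ge> 0"
  shows "measure_pmf.prob (iid_uniform s)
      {\<omega>. \<exists>f\<in>span E. (1 + x) * real s * (norm f)\<^sup>2 < (\<Sum>i<s. (y (\<omega> i) \<bullet> f)\<^sup>2)}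
    \<le> card E * exp (- (s / R * (x\<^sup>2 / (2 + 2 * x / 3))))"
proof -
  \<comment> \<open>The parameter ln (1 + x) / R minimises the exponent.\<close>
  have "measure_pmf.prob (iid_uniform s)
      {\<omega>. \<exists>f\<in>span E. (1 + x) * real s * (norm f)\<^sup>2 < (\<Sum>i<s. (y (\<omega> i) \<bullet> f)\<^sup>2)}
    \<le> card E * exp (s * ((exp (R * (ln (1 + x) / R)) - 1) / R)) / exp (ln (1 + x) / R * (1 + x) * s)"
    using x R_pos by (intro chernoff_upper_param) auto
  also have "\<dots> = card E * exp (s * ((exp (R * (ln (1 + x) / R)) - 1) / R) - ln (1 + x) / R * (1 + x) * s)"
    by (simp add: exp_diff)
  also have "s * ((exp (R * (ln (1 + x) / R)) - 1) / R) - ln (1 + x) / R * (1 + x) * s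
      = - (s / R * ((1 + x) * ln (1 + x) - x))"
    using x R_pos by (simp add: field_simps)
  also have "card E * exp (- (s / R * ((1 + x) * ln (1 + x) - x)))
      \<le> card E * exp (- (s / R * (x\<^sup>2 / (2 + 2 * x / 3))))"
    using mult_left_mono[OF Bennett_ge_Bernstein[OF x], of "s / R"] R_pos
    by (intro mult_left_mono) auto
  finally show ?thesis .
qed

text \<open>A negative step preserves positivity only if it is small: \<open>c p\<close> is the
  lower bound in the worst case that all draws align. The trace bound then runs with R / c p in
  place of R and holds for large p only, but \<open>c p\<close> tends to 1, so the limit is the same
  as with R.\<close>

lemma chernoff_lower_param:
  assumes x: "x \<le> 1" and \<theta>: "\<theta> \<ge> 0"
  shows "measure_pmf.prob (iid_uniform s)
      {\<omega>. \<exists>f\<in>span E. (\<Sum>i<s. (y (\<omega> i) \<bullet> f)\<^sup>2) < (1 - x) * real s * (norm f)\<^sup>2}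
    \<le> card E * exp (s * ((exp (- (R * \<theta>)) - 1) / R)) / exp (- (\<theta> * (1 - x) * s))"
    (is "?P \<le> _")
proof (rule LIMSEQ_le_const)
  let ?a = "- (\<theta> * (1 - x) * s)"
  define c where "c p = 1 - \<theta> / real (2 * p) * s * R" for p :: nat
  define R' where "R' p = R / c p" for p
  have inf: "(\<lambda>p. \<theta> / real (2 * p)) \<longlonglongrightarrow> 0"
  proof -
    have "(\<lambda>p. (\<theta> / 2) * inverse (real p)) \<longlonglongrightarrow> (\<theta> / 2) * 0"
      by (intro tendsto_mult tendsto_const LIMSEQ_inverse_real_of_nat[THEN LIMSEQ_imp_Suc])
    then show ?thesis by (simp add: field_simps)
  qed
  have c_lim: "c \<longlonglongrightarrow> 1"
  proof -
    have "(\<lambda>p. 1 - \<theta> / real (2 * p) * s * R) \<longlonglongrightarrow> 1 - 0 * real s * R"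
      by (intro tendsto_intros inf)
    then show ?thesis by (simp add: c_def[abs_def])
  qed
  have R'_lim: "R' \<longlonglongrightarrow> R"
    unfolding R'_def[abs_def] using tendsto_divide[OF tendsto_const c_lim, of R] by simp
  show "(\<lambda>p. card E * exp (s * ((exp (- (R' p * \<theta>)) - 1) / R' p)) / (1 + ?a / real (2 * p)) ^ (2 * p))
      \<longlonglongrightarrow> card E * exp (s * ((exp (- (R * \<theta>)) - 1) / R)) / exp ?a"
    using R_pos by (intro tendsto_intros exp_limit_even R'_lim) auto
  have "eventually (\<lambda>p. c p > 0) sequentially"
    using order_tendstoD(1)[OF c_lim, of 0] by simp
  moreover have "eventually (\<lambda>p::nat. p \<ge> 1) sequentially" by (rule eventually_ge_at_top)
  moreover have "eventually (\<lambda>p. 1 + ?a / real (2 * p) > 0) sequentially"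
  proof -
    have "(\<lambda>p. 1 - \<theta> / real (2 * p) * ((1 - x) * s)) \<longlonglongrightarrow> 1 - 0 * ((1 - x) * real s)"
      by (intro tendsto_intros inf)
    then have "eventually (\<lambda>p. 1 - \<theta> / real (2 * p) * ((1 - x) * s) > 0) sequentially"
      by (rule order_tendstoD) simp
    then show ?thesis by (rule eventually_mono) (simp add: mult.assoc)
  qed
  ultimately have "eventually (\<lambda>p. ?P \<le>
    card E * exp (s * ((exp (- (R' p * \<theta>)) - 1) / R' p)) / (1 + ?a / real (2 * p)) ^ (2 * p)) sequentially"
  proof eventually_elim
    case (elim p)
    note cp = elim(1) and p = elim(2)
    define \<tau> where "\<tau> = \<theta> / real (2 * p)"
    have \<tau>: "\<tau> \<ge> 0" using \<theta> by (simp add: \<tau>_def)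
    have e: "real (2 * p) * R' p * - \<tau> = - (R' p * \<theta>)" using p by (simp add: \<tau>_def field_simps)
    have R'p: "R' p > 0" "R \<le> c p * R' p" using cp R_pos by (auto simp: R'_def)
    let ?a' = "1 - \<tau> * (1 - x) * s"
    have a'_eq: "?a' = 1 + ?a / real (2 * p)" by (simp add: \<tau>_def)
    have pd: "posdef_on (span E) (c p) (sampled_op (- \<tau>) k \<omega>)" if "k \<le> s" for k \<omega>
      using posdef_on_sampled_op_neg[OF \<tau> that] by (simp add: c_def \<tau>_def)
    have "?P \<le> measure_pmf.prob (iid_uniform s)
        {\<omega>. \<exists>f\<in>span E. norm f = 1 \<and> ?a' \<le> f \<bullet> sampled_op (- \<tau>) s \<omega> f}"
    proof (rule measure_pmf.finite_measure_mono)
      show "{\<omega>. \<exists>f\<in>span E. (\<Sum>i<s. (y (\<omega> i) \<bullet> f)\<^sup>2) < (1 - x) * real s * (norm f)\<^sup>2} \<subseteq>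
        {\<omega>. \<exists>f\<in>span E. norm f = 1 \<and> ?a' \<le> f \<bullet> sampled_op (- \<tau>) s \<omega> f}"
      proof safe
        fix \<omega> f assume f: "f \<in> span E" "(\<Sum>i<s. (y (\<omega> i) \<bullet> f)\<^sup>2) < (1 - x) * real s * (norm f)\<^sup>2"
        have "\<exists>f\<in>span E. norm f = 1 \<and> (\<Sum>i<s. (y (\<omega> i) \<bullet> f)\<^sup>2) < (1 - x) * real s * 1"
        proof (rule unit_vector_reduction[where Q = "\<lambda>a b. b < (1 - x) * real s * a"])
          fix a b t :: real assume t: "t > 0" "t * b < (1 - x) * real s * (t * a)"
          then have "t * b < t * ((1 - x) * real s * a)" by (simp only: mult.left_commute[of t])
          then show "b < (1 - x) * real s * a" using t(1) by simp
        qed (use f in auto)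
        then obtain g where g: "g \<in> span E" "norm g = 1" "(\<Sum>i<s. (y (\<omega> i) \<bullet> g)\<^sup>2) < (1 - x) * real s"
          by auto
        have "\<tau> * (\<Sum>i<s. (y (\<omega> i) \<bullet> g)\<^sup>2) \<le> \<tau> * ((1 - x) * real s)"
          using g \<tau> by (intro mult_left_mono) auto
        then have "?a' \<le> g \<bullet> sampled_op (- \<tau>) s \<omega> g" using g by (simp add: sampled_op_form mult.assoc)
        then show "\<exists>f\<in>span E. norm f = 1 \<and> ?a' \<le> f \<bullet> sampled_op (- \<tau>) s \<omega> f" using g by blast
      qed
    qed simp
    also have "\<dots> \<le> card E * exp (s * ((exp (real (2 * p) * R' p * - \<tau>) - 1) / R' p)) / ?a' ^ (2 * p)"
    proof (rule trace_tail[OF pd])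
      fix k \<omega> assume k: "k \<le> s"
      have "trace_on E (sampled_op (- \<tau>) k \<omega> ^^ Suc (2 * p - 1)) \<le> trace_on E (sampled_op (- \<tau>) k \<omega> ^^ (2 * p - 1))"
        unfolding trace_on_def
      proof (intro sum_mono)
        fix b assume "b \<in> E"
        then show "b \<bullet> (sampled_op (- \<tau>) k \<omega> ^^ Suc (2 * p - 1)) b \<le> b \<bullet> (sampled_op (- \<tau>) k \<omega> ^^ (2 * p - 1)) b"
          using \<tau> by (intro moment_contract[OF pd[OF k] cp span_base])
            (auto simp: sampled_op_form intro!: mult_nonneg_nonneg sum_nonneg)
      qed
      also have "Suc (2 * p - 1) = 2 * p" using p by simp
      finally show "(exp (real (2 * p) * R' p * - \<tau>) - 1) / R' p * trace_on E (sampled_op (- \<tau>) k \<omega> ^^ (2 * p - 1))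
        \<le> (exp (real (2 * p) * R' p * - \<tau>) - 1) / R' p * trace_on E (sampled_op (- \<tau>) k \<omega> ^^ (2 * p))"
        using R'p \<theta> unfolding e by (intro mult_left_mono_neg) (auto simp: field_simps)
    qed (use cp R'p p elim(3) a'_eq in auto)
    finally show ?case unfolding e a'_eq .
  qed
  then show "\<exists>N. \<forall>p\<ge>N. ?P \<le>
      card E * exp (s * ((exp (- (R' p * \<theta>)) - 1) / R' p)) / (1 + ?a / real (2 * p)) ^ (2 * p)"
    by (simp add: eventually_sequentially)
qed

lemma chernoff_lower:
  assumes x: "0 \<le> x" "x \<le> 1"
  shows "measure_pmf.prob (iid_uniform s)
      {\<omega>. \<exists>f\<in>span E. (\<Sum>i<s. (y (\<omega> i) \<bullet> f)\<^sup>2) < (1 - x) * real s * (norm f)\<^sup>2}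
    \<le> card E * exp (- (s / R * (x\<^sup>2 / 2)))"
proof -
  \<comment> \<open>The parameter x / R replaces the optimal - ln (1 - x) / R, which is infinite at
    x = 1; the exponent remains at least x^2 / 2.\<close>
  have "measure_pmf.prob (iid_uniform s)
      {\<omega>. \<exists>f\<in>span E. (\<Sum>i<s. (y (\<omega> i) \<bullet> f)\<^sup>2) < (1 - x) * real s * (norm f)\<^sup>2}
    \<le> card E * exp (s * ((exp (- (R * (x / R))) - 1) / R)) / exp (- (x / R * (1 - x) * s))"
    using x R_pos by (intro chernoff_lower_param) auto
  also have "\<dots> = card E * exp (s * ((exp (- (R * (x / R))) - 1) / R) - - (x / R * (1 - x) * s))"
    by (simp only: exp_diff times_divide_eq_right)
  also have "s * ((exp (- (R * (x / R))) - 1) / R) - - (x / R * (1 - x) * s)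
      = - (s / R * (1 - exp (- x) - x * (1 - x)))"
    using x R_pos by (simp add: field_simps)
  also have "card E * exp (- (s / R * (1 - exp (- x) - x * (1 - x))))
      \<le> card E * exp (- (s / R * (x\<^sup>2 / 2)))"
  proof -
    have "x\<^sup>2 / 2 \<le> 1 - exp (- x) - x * (1 - x)"
      using exp_minus_le_quadratic[OF x(1)] by (simp add: algebra_simps power2_eq_square)
    from mult_left_mono[OF this, of "s / R"] show ?thesis
      using R_pos by (intro mult_left_mono) auto
  qed
  finally show ?thesis .
qed

end

section \<open>A Hoeffding inequality for vectors\<close>

text \<open>Only differences of \<open>z\<close> are bounded, so the interval for Hoeffding's lemma
  runs from the least to the greatest value and has length at most D.\<close>

lemma Hoeffding_average:
  fixes z :: "'n::finite \<Rightarrow> real"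
  assumes D: "\<And>j k. \<bar>z j - z k\<bar> \<le> D" and l: "l > 0"
  shows "(\<Sum>j\<in>UNIV. exp (l * z j)) / CARD('n) \<le> exp (l * ((\<Sum>j\<in>UNIV. z j) / CARD('n)) + l\<^sup>2 * D\<^sup>2 / 8)"
proof -
  let ?p = "pmf_of_set (UNIV :: 'n set)"
  let ?e = "(\<Sum>j\<in>UNIV. z j) / CARD('n)"
  have ex: "measure_pmf.expectation ?p z = ?e" by (simp add: integral_pmf_of_set)
  define a where "a = Min (range z)"
  define b where "b = Max (range z)"
  have "a \<in> range z" "b \<in> range z"
    unfolding a_def b_def by (intro Min_in Max_in; simp)+
  then obtain j k where "a = z j" "b = z k" by blast
  moreover have "a \<le> b"
    using Min_le[of "range z" "z undefined"] Max_ge[of "range z" "z undefined"] by (simp add: a_def b_def)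
  ultimately have ba: "0 \<le> b - a" "b - a \<le> D"
    using D[of k j] by auto
  interpret interval_bounded_random_variable "measure_pmf ?p" z a b
    by unfold_locales (auto simp: a_def b_def)
  have int: "integrable (measure_pmf ?p) F" for F :: "'n \<Rightarrow> real"
    by (rule integrable_measure_pmf_finite) simp
  have "ennreal (measure_pmf.expectation ?p (\<lambda>j. exp (l * (z j - ?e)))) =
      nn_integral (measure_pmf ?p) (\<lambda>j. exp (l * (z j - ?e)))"
    by (rule nn_integral_eq_integral[symmetric]) (auto intro: int)
  also have "\<dots> \<le> ennreal (exp (l\<^sup>2 * (b - a)\<^sup>2 / 8))"
    using Hoeffdings_lemma_nn_integral[OF l] by (simp add: ex)
  finally have "measure_pmf.expectation ?p (\<lambda>j. exp (l * (z j - ?e))) \<le> exp (l\<^sup>2 * (b - a)\<^sup>2 / 8)"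
    by (subst (asm) ennreal_le_iff) auto
  also have "\<dots> \<le> exp (l\<^sup>2 * D\<^sup>2 / 8)"
    using ba by (auto intro!: divide_right_mono mult_left_mono power_mono)
  finally have "(\<Sum>j\<in>UNIV. exp (l * z j)) / CARD('n) / exp (l * ?e) \<le> exp (l\<^sup>2 * D\<^sup>2 / 8)"
    by (simp add: integral_pmf_of_set right_diff_distrib exp_diff mult.commute flip: sum_divide_distrib)
  then show ?thesis
    by (simp add: exp_add pos_divide_le_eq mult.commute)
qed

text \<open>Method of bounded differences: averaging f over the last draw gives another 1-Lipschitz
  function with the same overall expectation, so the induction has to vary f.\<close>

lemma Lipschitz_exp_moment:
  fixes X :: "'n::finite \<Rightarrow> 'a::real_normed_vector" and f :: "'a \<Rightarrow> real"
  assumes D: "\<And>i j. norm (X i - X j) \<le> D" and l: "l > 0"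
    and f: "\<And>u v. \<bar>f u - f v\<bar> \<le> norm (u - v)"
  shows "measure_pmf.expectation (iid_uniform k) (\<lambda>\<omega>. exp (l * f (\<Sum>i<k. X (\<omega> i))))
    \<le> exp (l * measure_pmf.expectation (iid_uniform k) (\<lambda>\<omega>. f (\<Sum>i<k. X (\<omega> i))) + k * (l\<^sup>2 * D\<^sup>2 / 8))"
  using f
proof (induction k arbitrary: f)
  case 0
  then show ?case by (simp add: expectation_iid_uniform_0)
next
  case (Suc k)
  define g where "g u = (\<Sum>j\<in>UNIV. f (u + X j)) / CARD('n)" for u
  have g: "\<bar>g u - g v\<bar> \<le> norm (u - v)" for u v
  proof -
    have "\<bar>g u - g v\<bar> = \<bar>\<Sum>j\<in>UNIV. f (u + X j) - f (v + X j)\<bar> / CARD('n)"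
      unfolding g_def sum_subtractf by (simp flip: diff_divide_distrib)
    also have "\<dots> \<le> (\<Sum>j\<in>(UNIV::'n set). norm (u - v)) / CARD('n)"
    proof (intro divide_right_mono order_trans[OF sum_abs] sum_mono)
      fix j show "\<bar>f (u + X j) - f (v + X j)\<bar> \<le> norm (u - v)"
        using Suc.prems[of "u + X j" "v + X j"] by simp
    qed simp
    finally show ?thesis by simp
  qed
  have upd: "(\<Sum>i<Suc k. X ((fun_upd \<omega> k j) i)) = (\<Sum>i<k. X (\<omega> i)) + X j" for \<omega> j
    by simp
  have E: "measure_pmf.expectation (iid_uniform (Suc k)) (\<lambda>\<omega>. f (\<Sum>i<Suc k. X (\<omega> i))) =
      measure_pmf.expectation (iid_uniform k) (\<lambda>\<omega>. g (\<Sum>i<k. X (\<omega> i)))"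
    unfolding expectation_iid_uniform_Suc upd g_def ..
  have "measure_pmf.expectation (iid_uniform (Suc k)) (\<lambda>\<omega>. exp (l * f (\<Sum>i<Suc k. X (\<omega> i))))
      \<le> measure_pmf.expectation (iid_uniform k) (\<lambda>\<omega>. exp (l\<^sup>2 * D\<^sup>2 / 8) * exp (l * g (\<Sum>i<k. X (\<omega> i))))"
    unfolding expectation_iid_uniform_Suc upd
  proof (intro integral_mono integrable_iid_uniform)
    fix \<omega>
    let ?u = "\<Sum>i<k. X (\<omega> i)"
    have "(\<Sum>j\<in>UNIV. exp (l * f (?u + X j))) / CARD('n) \<le>
        exp (l * ((\<Sum>j\<in>UNIV. f (?u + X j)) / CARD('n)) + l\<^sup>2 * D\<^sup>2 / 8)"
    proof (rule Hoeffding_average[OF _ l])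
      fix i j show "\<bar>f (?u + X i) - f (?u + X j)\<bar> \<le> D"
        using Suc.prems[of "?u + X i" "?u + X j"] D[of i j] by simp
    qed
    then show "(\<Sum>j\<in>UNIV. exp (l * f (?u + X j))) / CARD('n) \<le> exp (l\<^sup>2 * D\<^sup>2 / 8) * exp (l * g ?u)"
      by (simp add: g_def exp_add mult.commute)
  qed
  also have "\<dots> \<le> exp (l\<^sup>2 * D\<^sup>2 / 8) *
      exp (l * measure_pmf.expectation (iid_uniform k) (\<lambda>\<omega>. g (\<Sum>i<k. X (\<omega> i))) + k * (l\<^sup>2 * D\<^sup>2 / 8))"
    using Suc.IH[of g, OF g] by simp
  also have "\<dots> = exp (l * measure_pmf.expectation (iid_uniform (Suc k)) (\<lambda>\<omega>. f (\<Sum>i<Suc k. X (\<omega> i)))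
      + Suc k * (l\<^sup>2 * D\<^sup>2 / 8))"
    unfolding E by (simp only: exp_add[symmetric]) (simp add: algebra_simps)
  finally show ?case .
qed

lemma expectation_norm_sq_sum:
  fixes X :: "'n::finite \<Rightarrow> 'a::real_inner"
  assumes "(\<Sum>j\<in>UNIV. X j) = 0"
  shows "measure_pmf.expectation (iid_uniform k) (\<lambda>\<omega>. (norm (\<Sum>i<k. X (\<omega> i)))\<^sup>2)
    = k * ((\<Sum>j\<in>UNIV. (norm (X j))\<^sup>2) / CARD('n))"
proof (induction k)
  case 0 then show ?case by (simp add: expectation_iid_uniform_0)
next
  case (Suc k)
  have upd: "(\<Sum>i<Suc k. X ((fun_upd \<omega> k j) i)) = (\<Sum>i<k. X (\<omega> i)) + X j" for \<omega> j
    by simp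
  have avg: "(\<Sum>j\<in>UNIV. (norm (u + X j))\<^sup>2) / CARD('n) = (norm u)\<^sup>2 + (\<Sum>j\<in>UNIV. (norm (X j))\<^sup>2) / CARD('n)" for u
  proof -
    have "(\<Sum>j\<in>UNIV. (norm (u + X j))\<^sup>2) = (\<Sum>j\<in>UNIV. (norm u)\<^sup>2 + 2 * (u \<bullet> X j) + (norm (X j))\<^sup>2)"
      by (simp add: power2_norm_eq_inner inner_add_left inner_add_right inner_commute algebra_simps)
    also have "\<dots> = CARD('n) * (norm u)\<^sup>2 + 2 * (u \<bullet> (\<Sum>j\<in>UNIV. X j)) + (\<Sum>j\<in>UNIV. (norm (X j))\<^sup>2)"
      by (simp add: sum.distrib inner_sum_right sum_distrib_left)
    finally show ?thesis using assms by (simp add: add_divide_distrib)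
  qed
  show ?case
    unfolding expectation_iid_uniform_Suc upd avg using Suc by (simp add: distrib_right add_divide_distrib)
qed

text \<open>In 1 + \<tau> the 1 pays for the expected norm, through the second moment, and \<tau>
  for the fluctuation of the norm as a 1-Lipschitz function. No dimension enters.\<close>

lemma vector_Hoeffding:
  fixes b :: "'n::finite \<Rightarrow> 'a::real_inner"
  assumes B: "\<And>j. norm (b j) \<le> B" and s: "s > 0" and \<tau>: "\<tau> > 0"
  shows "measure_pmf.prob (iid_uniform s)
     {\<omega>. B / sqrt s * (1 + \<tau>) < norm ((1 / real s) *\<^sub>R (\<Sum>i<s. b (\<omega> i)) - (1 / real CARD('n)) *\<^sub>R (\<Sum>j\<in>UNIV. b j))}
    \<le> exp (- \<tau>\<^sup>2 / 2)" (is "measure_pmf.prob _ ?S \<le> _")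
proof (cases "B > 0")
  case False
  then have "b j = 0" for j using B[of j] by (metis norm_le_zero_iff not_less order_trans)
  moreover have "B = 0" using False B[of undefined] by (metis norm_ge_zero not_less order_antisym order_trans)
  ultimately have "?S = {}" by simp
  then show ?thesis by simp
next
  case True
  define \<mu> where "\<mu> = (1 / real CARD('n)) *\<^sub>R (\<Sum>j\<in>UNIV. b j)"
  define X where "X j = b j - \<mu>" for j
  define c where "c = sqrt s * B"
  have c: "c > 0" using s True by (simp add: c_def)
  have X0: "(\<Sum>j\<in>UNIV. X j) = 0"
    by (simp add: X_def sum_subtractf \<mu>_def scaleR_right.sum sum_constant_scaleR)
  have XD: "norm (X i - X j) \<le> 2 * B" for i j
    using norm_triangle_ineq4[of "b i" "b j"] B[of i] B[of j] by (simp add: X_def)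
  have var: "(\<Sum>j\<in>UNIV. (norm (X j))\<^sup>2) / CARD('n) \<le> B\<^sup>2"
  proof -
    have "(\<Sum>j\<in>UNIV. (norm (X j))\<^sup>2) = (\<Sum>j\<in>UNIV. (norm (b j))\<^sup>2 - 2 * (\<mu> \<bullet> X j) - (norm \<mu>)\<^sup>2)"
      by (simp add: X_def power2_norm_eq_inner inner_diff_left inner_diff_right inner_commute algebra_simps)
    also have "\<dots> = (\<Sum>j\<in>UNIV. (norm (b j))\<^sup>2) - 2 * (\<mu> \<bullet> (\<Sum>j\<in>UNIV. X j)) - CARD('n) * (norm \<mu>)\<^sup>2"
      by (simp add: sum_subtractf inner_sum_right sum_distrib_left)
    also have "\<dots> \<le> (\<Sum>j\<in>(UNIV::'n set). B\<^sup>2)"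
    proof -
      have "(\<Sum>j\<in>UNIV. (norm (b j))\<^sup>2) \<le> (\<Sum>j\<in>(UNIV::'n set). B\<^sup>2)"
        using B by (intro sum_mono power_mono) auto
      moreover have "0 \<le> CARD('n) * (norm \<mu>)\<^sup>2" by simp
      ultimately show ?thesis unfolding X0 inner_zero_right by linarith
    qed
    finally show ?thesis by (simp add: field_simps)
  qed
  define Z where "Z \<omega> = norm (\<Sum>i<s. X (\<omega> i))" for \<omega>
  have EZ: "measure_pmf.expectation (iid_uniform s) Z \<le> c"
  proof -
    \<comment> \<open>The pointwise bound Z <= (Z^2 / c + c) / 2 takes the place of Jensen's
      inequality.\<close>
    have "measure_pmf.expectation (iid_uniform s) Z \<le> measure_pmf.expectation (iid_uniform s) (\<lambda>\<omega>. ((Z \<omega>)\<^sup>2 / c + c) / 2)"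
    proof (intro integral_mono integrable_iid_uniform)
      fix \<omega>
      have "0 \<le> (Z \<omega> - c)\<^sup>2" by simp
      then show "Z \<omega> \<le> ((Z \<omega>)\<^sup>2 / c + c) / 2"
        using c by (simp add: field_simps power2_eq_square)
    qed
    also have "\<dots> = (s * ((\<Sum>j\<in>UNIV. (norm (X j))\<^sup>2) / CARD('n)) / c + c) / 2"
      using expectation_norm_sq_sum[OF X0, of s] by (simp add: Z_def)
    also have "\<dots> \<le> (s * B\<^sup>2 / c + c) / 2"
      using var c by (intro divide_right_mono add_right_mono mult_left_mono) auto
    also have "s * B\<^sup>2 / c = c"
      using c s by (simp add: c_def field_simps power2_eq_square)
    finally show ?thesis by simp
  qed
  \<comment> \<open>The exponent becomes (l c)^2 / 2 - l c \<tau>, which is minimal at l c =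
    \<tau>.\<close>
  define l where "l = \<tau> / c"
  have l: "l > 0" using \<tau> c by (simp add: l_def)
  have "measure_pmf.prob (iid_uniform s) ?S \<le>
      measure_pmf.expectation (iid_uniform s) (\<lambda>\<omega>. exp (l * Z \<omega>)) / exp (l * (c * (1 + \<tau>)))"
  proof (rule iid_uniform_Markov)
    fix \<omega> assume "\<omega> \<in> ?S"
    then have "B / sqrt s * (1 + \<tau>) < norm ((1 / real s) *\<^sub>R (\<Sum>i<s. b (\<omega> i)) - \<mu>)" by (simp add: \<mu>_def)
    also have "(1 / real s) *\<^sub>R (\<Sum>i<s. b (\<omega> i)) - \<mu> = (1 / real s) *\<^sub>R (\<Sum>i<s. X (\<omega> i))"
      using s by (simp add: X_def sum_subtractf scaleR_diff_right sum_constant_scaleR)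
    also have "norm \<dots> = Z \<omega> / s" by (simp add: Z_def)
    finally have "s * (B / sqrt s * (1 + \<tau>)) < Z \<omega>" using s by (simp add: field_simps)
    moreover have "s * (B / sqrt s * (1 + \<tau>)) = c * (1 + \<tau>)"
      using s real_sqrt_mult_self[of s] by (simp add: c_def field_simps)
    ultimately have "c * (1 + \<tau>) \<le> Z \<omega>" by simp
    then show "exp (l * (c * (1 + \<tau>))) \<le> exp (l * Z \<omega>)" using l by simp
  qed auto
  also have "\<dots> \<le> exp (l * measure_pmf.expectation (iid_uniform s) Z + s * (l\<^sup>2 * (2 * B)\<^sup>2 / 8)) / exp (l * (c * (1 + \<tau>)))"
    using Lipschitz_exp_moment[of X "2 * B" l norm s, OF XD l] norm_triangle_ineq3
    by (intro divide_right_mono) (auto simp: Z_def[abs_def])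
  also have "\<dots> \<le> exp (l * c + s * (l\<^sup>2 * (2 * B)\<^sup>2 / 8)) / exp (l * (c * (1 + \<tau>)))"
    using EZ l by (intro divide_right_mono) auto
  also have "\<dots> = exp (l * c + s * (l\<^sup>2 * (2 * B)\<^sup>2 / 8) - l * (c * (1 + \<tau>)))" by (simp add: exp_diff)
  also have "l * c + s * (l\<^sup>2 * (2 * B)\<^sup>2 / 8) - l * (c * (1 + \<tau>)) = - \<tau>\<^sup>2 / 2"
  proof -
    have "s * B\<^sup>2 = c\<^sup>2" by (simp add: c_def power_mult_distrib)
    then have "s * (l\<^sup>2 * (2 * B)\<^sup>2 / 8) = (l * c)\<^sup>2 / 2" by (simp add: power_mult_distrib algebra_simps)
    moreover have lc: "l * c = \<tau>" using c by (simp add: l_def)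
    moreover have "l * (c * (1 + \<tau>)) = \<tau> * (1 + \<tau>)" by (simp add: lc flip: mult.assoc)
    ultimately show ?thesis by (simp only:) (simp add: algebra_simps power2_eq_square)
  qed
  finally show ?thesis .
qed

section \<open>Marginal distribution of one worker\<close>

lemma iid_uniform_eq_worker_marginal:
  assumes i: "i < m"
  shows "(iid_uniform s :: (nat \<Rightarrow> 'n::finite) pmf) =
    map_pmf (\<lambda>\<omega> k. if k < s then \<omega> (i, k) else undefined) (sample_pmf m s)"
proof -
  let ?I = "{..<m} \<times> {..<s}"
  have "PiE_dflt ?I undefined (\<lambda>_. UNIV :: 'n set) = PiE ?I (\<lambda>_. UNIV)"
    by (auto simp: PiE_dflt_def PiE_def extensional_def)
  then have sp: "(sample_pmf m s :: (nat \<times> nat \<Rightarrow> 'n) pmf) = Pi_pmf ?I undefined (\<lambda>_. pmf_of_set UNIV)"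
    by (subst Pi_pmf_of_set) (auto simp: sample_pmf_def)
  have "(iid_uniform s :: (nat \<Rightarrow> 'n) pmf) =
      map_pmf (\<lambda>g. g \<circ> Pair i) (Pi_pmf ({i} \<times> {..<s}) undefined (\<lambda>_. pmf_of_set UNIV))"
    unfolding iid_uniform_def by (rule Pi_pmf_bij_betw) (auto simp: bij_betw_def inj_on_def)
  also have "Pi_pmf ({i} \<times> {..<s}) undefined (\<lambda>_. pmf_of_set (UNIV :: 'n set)) =
      map_pmf (\<lambda>f x. if x \<in> {i} \<times> {..<s} then f x else undefined) (sample_pmf m s)"
    unfolding sp using i by (intro Pi_pmf_subset) auto
  finally show ?thesis
    by (simp add: pmf.map_comp o_def)
qed

text \<open>\<open>P\<close> has to ignore positions from s on, because the marginal puts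
  \<open>undefined\<close> there.\<close>

lemma prob_worker:
  fixes P :: "(nat \<Rightarrow> 'n::finite) \<Rightarrow> bool"
  assumes i: "i < m" and P: "\<And>\<omega> \<omega>'. (\<And>k. k < s \<Longrightarrow> \<omega> k = \<omega>' k) \<Longrightarrow> P \<omega> \<longleftrightarrow> P \<omega>'"
  shows "measure_pmf.prob (sample_pmf m s) {\<omega>. P (\<lambda>k. \<omega> (i, k))} = measure_pmf.prob (iid_uniform s) {\<omega>. P \<omega>}"
proof -
  have "P (\<lambda>k. if k < s then \<omega> (i, k) else undefined) \<longleftrightarrow> P (\<lambda>k. \<omega> (i, k))" for \<omega>
    by (rule P) simp
  then show ?thesis
    unfolding iid_uniform_eq_worker_marginal[OF i] by (simp add: vimage_def)
qed

section \<open>Spectral perturbation bounds\<close>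

text \<open>For a selfadjoint operator the quadratic form controls the bilinear one; here this is
  used relative to the inner product of H. After scaling both vectors to H-norm 1 it is polarization
  followed by the parallelogram law.\<close>

lemma selfadj_form_bound:
  fixes S H :: "'a::euclidean_space \<Rightarrow> 'a"
  assumes S: "selfadj S" and H: "selfadj H" and c: "c > 0" "\<And>v. c * (norm v)\<^sup>2 \<le> v \<bullet> H v"
    and M: "\<And>v. \<bar>v \<bullet> S v\<bar> \<le> M * (v \<bullet> H v)"
  shows "u \<bullet> S v \<le> M * (sqrt (u \<bullet> H u) * sqrt (v \<bullet> H v))"
proof (cases "u = 0 \<or> v = 0")
  case True
  moreover have "S 0 = 0" using S by (auto simp: selfadj_def linear_0)
  ultimately show ?thesis by auto
next
  case False
  have lS: "linear S" and lH: "linear H" using S H by (auto simp: selfadj_def)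
  have sS: "v \<bullet> S u = u \<bullet> S v" and sH: "v \<bullet> H u = u \<bullet> H v" for u v
    using S H by (metis inner_commute selfadj_def)+
  have pos: "w \<bullet> H w > 0" if "w \<noteq> 0" for w
  proof -
    have "0 < c * (norm w)\<^sup>2" using c(1) that by simp
    then show ?thesis using c(2)[of w] by linarith
  qed
  have polar: "4 * (a \<bullet> S b) \<le> M * (2 * (a \<bullet> H a) + 2 * (b \<bullet> H b))" for a b
  proof -
    have "4 * (a \<bullet> S b) = (a + b) \<bullet> S (a + b) - (a - b) \<bullet> S (a - b)"
      using sS[of b a] by (simp add: linear_add[OF lS] linear_diff[OF lS] inner_add_left inner_add_right
          inner_diff_left inner_diff_right)
    also have "\<dots> \<le> M * ((a + b) \<bullet> H (a + b)) + M * ((a - b) \<bullet> H (a - b))"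
      using M[of "a + b"] M[of "a - b"] by linarith
    also have "\<dots> = M * (2 * (a \<bullet> H a) + 2 * (b \<bullet> H b))"
      using sH[of b a] by (simp add: linear_add[OF lH] linear_diff[OF lH] inner_add_left inner_add_right
          inner_diff_left inner_diff_right algebra_simps)
    finally show ?thesis .
  qed
  define p where "p = sqrt (u \<bullet> H u)"
  define q where "q = sqrt (v \<bullet> H v)"
  have pq: "p > 0" "q > 0" "p\<^sup>2 = u \<bullet> H u" "q\<^sup>2 = v \<bullet> H v"
    using pos[of u] pos[of v] False by (auto simp: p_def q_def)
  have "4 * (((1 / p) *\<^sub>R u) \<bullet> S ((1 / q) *\<^sub>R v)) \<le> M * (2 * (((1 / p) *\<^sub>R u) \<bullet> H ((1 / p) *\<^sub>R u)) +
      2 * (((1 / q) *\<^sub>R v) \<bullet> H ((1 / q) *\<^sub>R v)))" by (rule polar)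
  also have "((1 / p) *\<^sub>R u) \<bullet> H ((1 / p) *\<^sub>R u) = 1"
    using pq by (simp add: linear_cmul[OF lH] flip: pq(3)) (simp add: power2_eq_square)
  also have "((1 / q) *\<^sub>R v) \<bullet> H ((1 / q) *\<^sub>R v) = 1"
    using pq by (simp add: linear_cmul[OF lH] flip: pq(4)) (simp add: power2_eq_square)
  finally have "4 * (u \<bullet> S v) / (q * p) \<le> M * 4" by (simp add: linear_cmul[OF lS])
  then have "u \<bullet> S v \<le> M * (p * q)" using pq by (simp add: pos_divide_le_eq algebra_simps)
  then show ?thesis by (simp add: p_def q_def)
qed

text \<open>Bounds the solution in the H-norm without inverting H: the equation is tested against u
  itself.\<close>

lemma selfadj_form_solution_bound:
  fixes S H :: "'a::euclidean_space \<Rightarrow> 'a"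
  assumes S: "selfadj S" and H: "selfadj H" and c: "c > 0" "\<And>v. c * (norm v)\<^sup>2 \<le> v \<bullet> H v"
    and M: "\<And>v. \<bar>v \<bullet> S v\<bar> \<le> M * (v \<bullet> H v)" and eq: "H u = S v"
  shows "sqrt (u \<bullet> H u) \<le> M * sqrt (v \<bullet> H v)"
proof (cases "u \<bullet> H u > 0")
  case True
  have "sqrt (u \<bullet> H u) * sqrt (u \<bullet> H u) = u \<bullet> S v" using True eq by simp
  also have "\<dots> \<le> M * (sqrt (u \<bullet> H u) * sqrt (v \<bullet> H v))"
    by (rule selfadj_form_bound[OF S H c M])
  finally have "sqrt (u \<bullet> H u) * sqrt (u \<bullet> H u) \<le> sqrt (u \<bullet> H u) * (M * sqrt (v \<bullet> H v))"
    by (simp add: mult.left_commute)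
  then show ?thesis by (rule mult_left_le_imp_le) (use True in simp)
next
  case False
  have "0 \<le> c * (norm w)\<^sup>2" for w using c(1) by simp
  then have nn: "0 \<le> w \<bullet> H w" for w using c(2)[of w] by (meson order_trans)
  have "0 \<le> M * (v \<bullet> H v)" using M[of v] by linarith
  then have "0 \<le> M * sqrt (v \<bullet> H v)"
    using nn[of v] by (cases "v \<bullet> H v = 0") (auto simp: zero_le_mult_iff)
  moreover have "u \<bullet> H u = 0" using False nn[of u] by simp
  ultimately show ?thesis by simp
qed

lemma norm_le_form:
  assumes c: "c > 0" "c * (norm v)\<^sup>2 \<le> v \<bullet> H v"
  shows "norm v \<le> sqrt (v \<bullet> H v) / sqrt c"
proof -
  have "sqrt (c * (norm v)\<^sup>2) \<le> sqrt (v \<bullet> H v)" using c by (intro real_sqrt_le_mono)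
  then show ?thesis using c(1) by (simp add: real_sqrt_mult field_simps)
qed

text \<open>The operator \<open>H Gi H - H\<close> is selfadjoint, which gives a sharper constant than bounding
  \<open>Gi\<close> and \<open>H - G\<close> separately.\<close>

lemma relative_inverse_bound:
  fixes H G Gi :: "'a::euclidean_space \<Rightarrow> 'a"
  assumes H: "selfadj H" and c: "c > 0" "\<And>v. c * (norm v)\<^sup>2 \<le> v \<bullet> H v"
    and G: "selfadj G" and Gi: "linear Gi" "\<And>v. G (Gi v) = v"
    and a: "0 \<le> a" "a < 1" "\<And>v. (1 - a) * (v \<bullet> H v) \<le> v \<bullet> G v"
    and a': "0 \<le> a'" "\<And>v. v \<bullet> G v \<le> (1 + a') * (v \<bullet> H v)"
    and z: "a / (1 - a) \<le> z" "a' / (1 + a') \<le> z"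
  shows "sqrt ((Gi (H p) - p) \<bullet> H (Gi (H p) - p)) \<le> z * sqrt (p \<bullet> H p)"
proof (rule selfadj_form_solution_bound[OF _ H c, where S = "\<lambda>v. H (Gi (H v)) - H v"])
  have lH: "linear H" using H by (simp add: selfadj_def)
  have sH: "H u \<bullet> v = u \<bullet> H v" and sG: "G u \<bullet> v = u \<bullet> G v" for u v
    using H G by (auto simp: selfadj_def)
  have sGi: "Gi u \<bullet> v = u \<bullet> Gi v" for u v
    by (metis Gi(2) sG)
  show "selfadj (\<lambda>v. H (Gi (H v)) - H v)"
    unfolding selfadj_def
  proof (intro conjI allI)
    show "linear (\<lambda>v. H (Gi (H v)) - H v)"
      using linear_compose[OF linear_compose[OF lH Gi(1)] lH] lH
      by (intro linear_compose_sub) (auto simp: o_def)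
    show "(H (Gi (H u)) - H u) \<bullet> v = u \<bullet> (H (Gi (H v)) - H v)" for u v
      by (simp add: inner_diff_left inner_diff_right sH sGi)
  qed
  show "H (Gi (H p) - p) = H (Gi (H p)) - H p" by (simp add: linear_diff[OF lH])
  fix v
  define t where "t = Gi (H v)"
  have nnH: "0 \<le> w \<bullet> H w" for w
  proof -
    have "0 \<le> c * (norm w)\<^sup>2" using c(1) by simp
    then show ?thesis using c(2)[of w] by linarith
  qed
  have nnG: "0 \<le> w \<bullet> G w" for w
    using a nnH[of w] by (meson a(3) diff_ge_0_iff_ge less_imp_le mult_nonneg_nonneg order_trans)
  have tt: "v \<bullet> H t = t \<bullet> G t" using sH[of v t] by (simp add: t_def Gi(2) inner_commute)
  \<comment> \<open>\<open>up\<close> and \<open>lo\<close> express that inversion reverses the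
    order of positive operators, evaluated at t = G^-1 H v. The first is Cauchy-Schwarz for the form
    of H, the second for the form of G.\<close>
  have up: "(1 - a) * (t \<bullet> G t) \<le> v \<bullet> H v"
  proof (cases "t \<bullet> G t = 0")
    case True then show ?thesis using nnH by simp
  next
    case False
    then have pt: "t \<bullet> G t > 0" using nnG[of t] by simp
    have "(t \<bullet> G t)\<^sup>2 \<le> (v \<bullet> H v) * (t \<bullet> H t)"
      using form_Cauchy_Schwarz[OF H subspace_UNIV nnH, of v t] tt by simp
    then have "(1 - a) * (t \<bullet> G t)\<^sup>2 \<le> (v \<bullet> H v) * ((1 - a) * (t \<bullet> H t))"
      using a(2) by (metis diff_ge_0_iff_ge less_imp_le mult.left_commute mult_left_mono)
    also have "\<dots> \<le> (v \<bullet> H v) * (t \<bullet> G t)" by (intro mult_left_mono a(3) nnH)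
    finally have "((1 - a) * (t \<bullet> G t)) * (t \<bullet> G t) \<le> (v \<bullet> H v) * (t \<bullet> G t)"
      by (simp add: power2_eq_square mult.assoc)
    then show ?thesis using pt by simp
  qed
  have lo: "v \<bullet> H v \<le> (1 + a') * (t \<bullet> G t)"
  proof (cases "v \<bullet> H v = 0")
    case True then show ?thesis using nnG a'(1) by simp
  next
    case False
    then have pv: "v \<bullet> H v > 0" using nnH[of v] by simp
    have "v \<bullet> G t = v \<bullet> H v" by (simp add: t_def Gi(2))
    then have "(v \<bullet> H v)\<^sup>2 \<le> (v \<bullet> G v) * (t \<bullet> G t)"
      using form_Cauchy_Schwarz[OF G subspace_UNIV nnG, of v t] by simp
    also have "\<dots> \<le> ((1 + a') * (v \<bullet> H v)) * (t \<bullet> G t)" by (intro mult_right_mono a'(2) nnG)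
    finally have "(v \<bullet> H v) * (v \<bullet> H v) \<le> (v \<bullet> H v) * ((1 + a') * (t \<bullet> G t))"
      by (simp add: power2_eq_square mult.assoc mult.left_commute)
    then show ?thesis using pv by simp
  qed
  have "t \<bullet> G t - v \<bullet> H v \<le> a / (1 - a) * (v \<bullet> H v)"
    using up a(2) by (simp add: field_simps)
  also have "\<dots> \<le> z * (v \<bullet> H v)" by (intro mult_right_mono z nnH)
  finally have 1: "t \<bullet> G t - v \<bullet> H v \<le> z * (v \<bullet> H v)" .
  have "v \<bullet> H v - t \<bullet> G t \<le> a' / (1 + a') * (v \<bullet> H v)"
    using lo a'(1) by (simp add: field_simps)
  also have "\<dots> \<le> z * (v \<bullet> H v)" by (intro mult_right_mono z nnH)
  finally have "v \<bullet> H v - t \<bullet> G t \<le> z * (v \<bullet> H v)" .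
  with 1 show "\<bar>v \<bullet> (H (Gi (H v)) - H v)\<bar> \<le> z * (v \<bullet> H v)"
    using tt by (simp add: inner_diff_right t_def)
qed

text \<open>The first bound measures H q = (H - (1 - \<theta>) Hb) \<Delta> in the H-norm and pays
  the factor sqrt (C / c) on return to the Euclidean norm. For the others r = \<Delta> - p solves H
  r = (H - Hb) \<Delta>, whose right side is bounded directly in the Euclidean norm, so b enters
  them without that factor.\<close>

lemma Newton_direction_bounds:
  fixes H Hb :: "'a::euclidean_space \<Rightarrow> 'a"
  assumes H: "selfadj H" and Hb: "selfadj Hb"
    and c: "c > 0" "\<And>v. c * (norm v)\<^sup>2 \<le> v \<bullet> H v" and C: "\<And>v. v \<bullet> H v \<le> C * (norm v)\<^sup>2"
    and \<nu>: "\<nu> \<ge> 0" and b: "b \<ge> 0"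
    and up: "\<And>v. v \<bullet> H v - v \<bullet> Hb v \<le> \<nu> / 2 * (v \<bullet> H v) + b / 8 * c * (norm v)\<^sup>2"
    and ab: "\<And>v. \<bar>v \<bullet> H v - v \<bullet> Hb v\<bar> \<le> b / 2 * c * (norm v)\<^sup>2"
    and p: "H p = Hb \<Delta>" and \<theta>: "0 \<le> \<theta>" "\<theta> \<le> 1"
  shows "norm (\<Delta> - (1 - \<theta>) *\<^sub>R p) \<le>
      sqrt (C / c) * max ((1 - \<theta>) * b / 2 - \<theta>) (\<theta> + (1 - \<theta>) * (\<nu> / 2 + b / 8)) * norm \<Delta>"
    and "norm p \<le> (1 + b / 2) * norm \<Delta>"
    and "sqrt (p \<bullet> H p) / sqrt c \<le> (sqrt (C / c) + b / 2) * norm \<Delta>"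
proof -
  have lH: "linear H" and lHb: "linear Hb" using H Hb by (auto simp: selfadj_def)
  have nnH: "0 \<le> w \<bullet> H w" for w
  proof -
    have "0 \<le> c * (norm w)\<^sup>2" using c(1) by simp
    then show ?thesis using c(2)[of w] by linarith
  qed
  have \<Delta>H: "sqrt (\<Delta> \<bullet> H \<Delta>) / sqrt c \<le> sqrt (C / c) * norm \<Delta>"
    using real_sqrt_le_mono[OF C[of \<Delta>]] c(1)
    by (simp add: real_sqrt_mult real_sqrt_divide field_simps)
  let ?M = "max ((1 - \<theta>) * b / 2 - \<theta>) (\<theta> + (1 - \<theta>) * (\<nu> / 2 + b / 8))"
  define S where "S v = H v - (1 - \<theta>) *\<^sub>R Hb v" for v
  have saS: "selfadj S"
    using H Hb unfolding S_def[abs_def] selfadj_def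
    by (auto intro!: linearI simp: linear_add linear_cmul inner_diff_left inner_diff_right algebra_simps)
  have cb: "k * c * (norm v)\<^sup>2 \<le> k * (v \<bullet> H v)" if "k \<ge> 0" for k v
    using mult_left_mono[OF c(2) that] by (simp add: mult.assoc)
  have SM: "\<bar>v \<bullet> S v\<bar> \<le> ?M * (v \<bullet> H v)" for v
  proof -
    have e: "v \<bullet> S v = \<theta> * (v \<bullet> H v) + (1 - \<theta>) * (v \<bullet> H v - v \<bullet> Hb v)"
      by (simp add: S_def inner_diff_right algebra_simps)
    have "v \<bullet> H v - v \<bullet> Hb v \<le> (\<nu> / 2 + b / 8) * (v \<bullet> H v)"
      using up[of v] cb[of "b / 8" v] b by (simp add: algebra_simps)
    then have "v \<bullet> S v \<le> (\<theta> + (1 - \<theta>) * (\<nu> / 2 + b / 8)) * (v \<bullet> H v)"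
      unfolding e using mult_left_mono[of _ _ "1 - \<theta>"] \<theta> by (fastforce simp: distrib_right mult.assoc)
    also have "\<dots> \<le> ?M * (v \<bullet> H v)" by (intro mult_right_mono nnH) simp
    finally have 1: "v \<bullet> S v \<le> ?M * (v \<bullet> H v)" .
    have "v \<bullet> Hb v - v \<bullet> H v \<le> b / 2 * (v \<bullet> H v)"
      using ab[of v] cb[of "b / 2" v] b by linarith
    then have "(1 - \<theta>) * (v \<bullet> Hb v - v \<bullet> H v) \<le> (1 - \<theta>) * (b / 2 * (v \<bullet> H v))"
      using \<theta> by (intro mult_left_mono) auto
    then have "- (v \<bullet> S v) \<le> ((1 - \<theta>) * b / 2 - \<theta>) * (v \<bullet> H v)"
      unfolding e by (simp add: algebra_simps)
    also have "\<dots> \<le> ?M * (v \<bullet> H v)" by (intro mult_right_mono nnH) simp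
    finally show ?thesis using 1 by linarith
  qed
  define q where "q = \<Delta> - (1 - \<theta>) *\<^sub>R p"
  have "H q = S \<Delta>" by (simp add: q_def S_def linear_diff[OF lH] linear_cmul[OF lH] p)
  then have "sqrt (q \<bullet> H q) \<le> ?M * sqrt (\<Delta> \<bullet> H \<Delta>)"
    by (rule selfadj_form_solution_bound[OF saS H c SM])
  then have "norm q \<le> ?M * sqrt (\<Delta> \<bullet> H \<Delta>) / sqrt c"
    using norm_le_form[of c q H, OF c(1) c(2)] c(1) by (meson divide_right_mono order_trans real_sqrt_ge_zero less_imp_le)
  also have "\<dots> = ?M * (sqrt (\<Delta> \<bullet> H \<Delta>) / sqrt c)" by simp
  also have "\<dots> \<le> ?M * (sqrt (C / c) * norm \<Delta>)"
  proof (intro mult_left_mono \<Delta>H)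
    have "0 \<le> \<theta> + (1 - \<theta>) * (\<nu> / 2 + b / 8)" using \<theta> \<nu> b by simp
    then show "0 \<le> ?M" by linarith
  qed
  finally show "norm (\<Delta> - (1 - \<theta>) *\<^sub>R p) \<le> sqrt (C / c) * ?M * norm \<Delta>"
    by (simp add: q_def mult.commute mult.left_commute)
  define r where "r = \<Delta> - p"
  define D where "D v = H v - Hb v" for v
  have saD: "selfadj D"
    using H Hb unfolding D_def[abs_def] selfadj_def
    by (auto intro!: linearI simp: linear_add linear_cmul inner_diff_left inner_diff_right algebra_simps)
  have id: "selfadj (\<lambda>v::'a. v)" by (simp add: selfadj_def linear_ident)
  have "r \<bullet> D \<Delta> \<le> b / 2 * c * (sqrt (r \<bullet> r) * sqrt (\<Delta> \<bullet> \<Delta>))"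
    by (rule selfadj_form_bound[OF saD id, of 1])
       (use ab in \<open>auto simp: D_def inner_diff_right dot_square_norm\<close>)
  moreover have "H r = D \<Delta>" by (simp add: r_def D_def linear_diff[OF lH] p)
  ultimately have rr: "r \<bullet> H r \<le> b / 2 * c * (norm r * norm \<Delta>)"
    by (simp add: norm_eq_sqrt_inner)
  have nr: "norm r \<le> b / 2 * norm \<Delta>"
  proof (cases "r = 0")
    case True then show ?thesis using b by simp
  next
    case False
    have "c * (norm r)\<^sup>2 = (c * norm r) * norm r"
      "b / 2 * c * (norm r * norm \<Delta>) = (c * norm r) * (b / 2 * norm \<Delta>)"
      by (auto simp: power2_eq_square)
    then have "(c * norm r) * norm r \<le> (c * norm r) * (b / 2 * norm \<Delta>)"
      using c(2)[of r] rr by linarith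
    then show ?thesis by (rule mult_left_le_imp_le) (use c(1) False in simp)
  qed
  have pr: "p = \<Delta> - r" by (simp add: r_def)
  show "norm p \<le> (1 + b / 2) * norm \<Delta>"
    using norm_triangle_ineq4[of \<Delta> r] nr unfolding pr by (simp add: distrib_right)
  have "r \<bullet> H r \<le> c * (b / 2 * norm \<Delta>)\<^sup>2"
  proof -
    have "b / 2 * c * (norm r * norm \<Delta>) \<le> b / 2 * c * ((b / 2 * norm \<Delta>) * norm \<Delta>)"
      using b c(1) nr by (intro mult_left_mono mult_right_mono) auto
    then show ?thesis using rr by (simp add: power2_eq_square algebra_simps)
  qed
  then have "sqrt (r \<bullet> H r) \<le> sqrt c * (b / 2 * norm \<Delta>)"
    using real_sqrt_le_mono[of "r \<bullet> H r" "c * (b / 2 * norm \<Delta>)\<^sup>2"] b by (simp add: real_sqrt_mult)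
  then have rH: "sqrt (r \<bullet> H r) / sqrt c \<le> b / 2 * norm \<Delta>"
    using c(1) by (simp add: field_simps)
  have "sqrt (p \<bullet> H p) \<le> sqrt (\<Delta> \<bullet> H \<Delta>) + sqrt (r \<bullet> H r)"
  proof -
    let ?x = "sqrt (\<Delta> \<bullet> H \<Delta>)" and ?y = "sqrt (r \<bullet> H r)"
    have "\<bar>\<Delta> \<bullet> H r\<bar> \<le> ?x * ?y"
      using form_Cauchy_Schwarz[OF H subspace_UNIV nnH, of \<Delta> r] nnH
      by (metis UNIV_I real_sqrt_abs real_sqrt_le_mono real_sqrt_mult)
    moreover have "r \<bullet> H \<Delta> = \<Delta> \<bullet> H r" using H by (metis inner_commute selfadj_def)
    then have "p \<bullet> H p = \<Delta> \<bullet> H \<Delta> - 2 * (\<Delta> \<bullet> H r) + r \<bullet> H r"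
      unfolding pr by (simp add: linear_diff[OF lH] inner_diff_left inner_diff_right)
    moreover have "(?x + ?y)\<^sup>2 = \<Delta> \<bullet> H \<Delta> + 2 * (?x * ?y) + r \<bullet> H r"
      using nnH by (simp add: power2_sum)
    ultimately have "p \<bullet> H p \<le> (?x + ?y)\<^sup>2" by linarith
    then show ?thesis using nnH by (intro real_le_lsqrt) auto
  qed
  then have "sqrt (p \<bullet> H p) / sqrt c \<le> sqrt (\<Delta> \<bullet> H \<Delta>) / sqrt c + sqrt (r \<bullet> H r) / sqrt c"
    using c(1) by (simp add: divide_right_mono flip: add_divide_distrib)
  then show "sqrt (p \<bullet> H p) / sqrt c \<le> (sqrt (C / c) + b / 2) * norm \<Delta>"
    unfolding distrib_right using \<Delta>H rH by linarith
qed

text \<open>\<open>\<theta>\<close> only bounds the Byzantine fraction t among the retained vectors.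
  Passing from (1 - t) p to (1 - \<theta>) p costs (\<theta> - t) norm p, the Byzantine part t (norm
  p + e) and the honest part (1 - t) e; t drops out of the sum.\<close>

lemma trimmed_mean_error:
  fixes r :: "'i \<Rightarrow> 'a::real_normed_vector"
  assumes U: "finite U" "U \<noteq> {}"
    and good: "\<And>i. i \<in> U - Z \<Longrightarrow> norm (r i - p) \<le> e"
    and bad: "\<And>i. i \<in> U \<inter> Z \<Longrightarrow> norm (r i) \<le> norm p + e"
    and \<theta>: "real (card (U \<inter> Z)) \<le> \<theta> * real (card U)"
  shows "norm (\<Delta> - (1 / real (card U)) *\<^sub>R (\<Sum>i\<in>U. r i)) \<le> norm (\<Delta> - (1 - \<theta>) *\<^sub>R p) + \<theta> * norm p + e"
proof -
  define q where "q = real (card U)"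
  have q: "q > 0" using U by (simp add: q_def card_gt_0_iff)
  define t where "t = real (card (U \<inter> Z)) / q"
  have t: "t \<le> \<theta>" using \<theta> q by (simp add: t_def q_def field_simps)
  have cU: "real (card (U - Z)) = q - real (card (U \<inter> Z))"
    using card_Diff_subset_Int[of U Z] U card_mono[of U "U \<inter> Z"] by (simp add: q_def of_nat_diff)
  have t1: "real (card (U - Z)) / q = 1 - t" unfolding cU t_def using q by (simp add: diff_divide_distrib)
  have split: "(\<Sum>i\<in>U. r i) = (\<Sum>i\<in>U - Z. r i - p) + real (card (U - Z)) *\<^sub>R p + (\<Sum>i\<in>U \<inter> Z. r i)"
    using sum.Int_Diff[OF U(1), of r Z] by (simp add: sum_subtractf sum_constant_scaleR)
  have "\<Delta> - (1 / q) *\<^sub>R (\<Sum>i\<in>U. r i) =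
      (\<Delta> - (1 - \<theta>) *\<^sub>R p) - (\<theta> - t) *\<^sub>R p - (1 / q) *\<^sub>R (\<Sum>i\<in>U - Z. r i - p) - (1 / q) *\<^sub>R (\<Sum>i\<in>U \<inter> Z. r i)"
  proof -
    have "t *\<^sub>R p + (real (card (U - Z)) / q) *\<^sub>R p = p"
      unfolding t1 by (simp flip: scaleR_add_left)
    then show ?thesis unfolding split by (simp add: scaleR_add_right algebra_simps)
  qed
  also have "norm \<dots> \<le> norm (\<Delta> - (1 - \<theta>) *\<^sub>R p) + (\<theta> - t) * norm p
      + (1 / q) * norm (\<Sum>i\<in>U - Z. r i - p) + (1 / q) * norm (\<Sum>i\<in>U \<inter> Z. r i)"
  proof -
    have tri: "norm (A - B - C - D) \<le> norm A + norm B + norm C + norm D" for A B C D :: 'a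
      using norm_triangle_ineq4[of "A - B - C" D] norm_triangle_ineq4[of "A - B" C]
        norm_triangle_ineq4[of A B] by linarith
    show ?thesis using t q by (intro order_trans[OF tri]) simp
  qed
  also have "(1 / q) * norm (\<Sum>i\<in>U - Z. r i - p) \<le> (1 / q) * (real (card (U - Z)) * e)"
    using good q by (intro mult_left_mono sum_norm_bound) auto
  also have "(1 / q) * (real (card (U - Z)) * e) = (1 - t) * e" by (simp flip: t1)
  also have "(1 / q) * norm (\<Sum>i\<in>U \<inter> Z. r i) \<le> (1 / q) * (real (card (U \<inter> Z)) * (norm p + e))"
    using bad q by (intro mult_left_mono sum_norm_bound) auto
  also have "(1 / q) * (real (card (U \<inter> Z)) * (norm p + e)) = t * (norm p + e)" by (simp add: t_def)
  finally show ?thesis by (simp add: q_def algebra_simps)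
qed

section \<open>Scalar estimates\<close>

text \<open>Z / (1 - Z) is increasing, which leaves the case Z = 2 S, and there 1 - 2 S <= (1 -
  S)^2.\<close>

lemma sqrt_odds_lower_bound:
  fixes S Z :: real
  assumes "0 \<le> S" "2 * S \<le> Z" "Z < 1"
  shows "sqrt (2 * S) \<le> (1 - S) * sqrt (Z / (1 - Z))"
proof -
  have S: "2 * S < 1" using assms by simp
  have "2 * S \<le> (1 - S)\<^sup>2 * (2 * S / (1 - 2 * S))"
  proof -
    have "1 - 2 * S \<le> (1 - S)\<^sup>2" by (simp add: power2_eq_square algebra_simps)
    then have "(1 - 2 * S) * (2 * S / (1 - 2 * S)) \<le> (1 - S)\<^sup>2 * (2 * S / (1 - 2 * S))"
      using S assms(1) by (intro mult_right_mono) auto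
    then show ?thesis using S by simp
  qed
  also have "\<dots> \<le> (1 - S)\<^sup>2 * (Z / (1 - Z))"
    using assms by (intro mult_left_mono frac_le) auto
  finally have "sqrt (2 * S) \<le> sqrt ((1 - S)\<^sup>2 * (Z / (1 - Z)))" by (rule real_sqrt_le_mono)
  also have "\<dots> = (1 - S) * sqrt (Z / (1 - Z))" unfolding real_sqrt_mult using S by simp
  finally show ?thesis .
qed

text \<open>The discriminant criterion, which certifies the numerical quadratics of the contraction
  estimate.\<close>

lemma nonneg_quadratic:
  fixes a b c x :: real
  assumes "a > 0" "b\<^sup>2 \<le> 4 * a * c"
  shows "0 \<le> a * x\<^sup>2 + b * x + c"
proof -
  have "0 \<le> (2 * a * x + b)\<^sup>2" by simp
  also have "\<dots> = 4 * a * (a * x\<^sup>2 + b * x + c) + (b\<^sup>2 - 4 * a * c)"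
    by (simp add: power2_eq_square algebra_simps)
  finally have "0 \<le> 4 * a * (a * x\<^sup>2 + b * x + c)" using assms(2) by linarith
  then show ?thesis using assms(1) by (simp add: zero_le_mult_iff)
qed

text \<open>71/100 lies just above 1 / sqrt 2, the bound that Z < 1 puts on \<open>\<nu>\<close>; up
  to there the remainder 5/4 (1 - \<nu>) - \<nu>^3 is still nonnegative.\<close>

lemma inverse_sqrt_quadratic_bound:
  fixes K \<nu> :: real
  assumes K: "K \<ge> 0" "K\<^sup>2 * (1 - \<nu>) \<le> 1" and \<nu>: "0 \<le> \<nu>" "\<nu> \<le> 71/100"
  shows "K \<le> 1 + \<nu> / 2 + \<nu>\<^sup>2"
proof (rule power2_le_imp_le)
  have "\<nu> ^ 3 \<le> (71/100) ^ 3" using \<nu> by (intro power_mono) auto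
  then have "\<nu> ^ 3 \<le> 5/4 * (1 - \<nu>)" using \<nu> by (simp add: eval_nat_numeral)
  then have "0 \<le> \<nu>\<^sup>2 * (5/4 * (1 - \<nu>) - \<nu> ^ 3)" by (intro mult_nonneg_nonneg) auto
  moreover have "(1 + \<nu> / 2 + \<nu>\<^sup>2)\<^sup>2 * (1 - \<nu>) = 1 + \<nu>\<^sup>2 * (5/4 * (1 - \<nu>) - \<nu> ^ 3)"
    by (simp add: eval_nat_numeral field_simps)
  ultimately have "1 \<le> (1 + \<nu> / 2 + \<nu>\<^sup>2)\<^sup>2 * (1 - \<nu>)" by linarith
  then have "K\<^sup>2 * (1 - \<nu>) \<le> (1 + \<nu> / 2 + \<nu>\<^sup>2)\<^sup>2 * (1 - \<nu>)" using K(2) by linarith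
  then show "K\<^sup>2 \<le> (1 + \<nu> / 2 + \<nu>\<^sup>2)\<^sup>2" by (rule mult_right_le_imp_le) (use \<nu> in simp)
qed (use \<nu> in simp)

text \<open>The two arguments of the maximum on the left bound the spectrum of \<open>I - (1 - \<theta>) H\<inverse> Hb\<close>
  from below and from above. Both cases reduce to quadratic inequalities through
  \<open>sqrt (1 - 2 S) \<le> 1 - S\<close> for \<open>S = y\<^sup>2 + T\<^sup>2\<close>.\<close>

lemma contraction_bound:
  fixes \<eta> \<nu> K \<theta> z Z b :: real
  assumes \<eta>: "0 < \<eta>" "\<eta> < 1" and \<nu>: "\<nu> \<ge> 0" and K: "K \<ge> 1" "K\<^sup>2 * (1 - \<nu>) \<le> 1"
    and \<theta>: "0 \<le> \<theta>" and z: "0 \<le> z" "z \<le> 27/20 * (\<eta> * \<nu>)"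
    and Z: "2 * (\<nu> / (1 - \<eta>))\<^sup>2 + 2 * (2 * K * \<theta>)\<^sup>2 \<le> Z" "Z < 1" and b: "b \<ge> 0"
  shows "K * max ((1 - \<theta>) * b / 2 - \<theta>) (\<theta> + (1 - \<theta>) * (\<nu> / 2 + b / 8)) + \<theta> * (1 + b / 2) + z * (K + b / 2)
     \<le> max (K * sqrt (Z / (1 - Z))) b"
proof -
  define y where "y = \<nu> / (1 - \<eta>)"
  define T where "T = 2 * K * \<theta>"
  define \<gamma> where "\<gamma> = sqrt (Z / (1 - Z))"
  define W where "W = max (K * \<gamma>) b"
  have \<nu>y: "\<nu> = (1 - \<eta>) * y" using \<eta> by (simp add: y_def)
  have y0: "y \<ge> 0" using \<nu> \<eta> by (simp add: y_def)
  have T0: "T \<ge> 0" using K \<theta> by (simp add: T_def)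
  have ZyT: "2 * y\<^sup>2 + 2 * T\<^sup>2 \<le> Z" using Z(1) by (simp add: y_def T_def)
  have "0 \<le> T\<^sup>2" "0 \<le> y\<^sup>2" by auto
  have Zy: "2 * y\<^sup>2 \<le> Z" using ZyT \<open>0 \<le> T\<^sup>2\<close> by linarith
  have y1: "y \<le> 71/100"
  proof (rule power2_le_imp_le)
    show "y\<^sup>2 \<le> (71/100)\<^sup>2" using Zy Z(2) by (simp add: power2_eq_square)
  qed simp
  have \<nu>le: "\<nu> \<le> y" unfolding \<nu>y using \<eta> y0 by (simp add: mult_left_le_one_le)
  have Kle: "K \<le> 1 + \<nu> / 2 + \<nu>\<^sup>2"
    using K \<nu> \<nu>le y1 by (intro inverse_sqrt_quadratic_bound) auto
  have Z0: "0 \<le> Z" using Zy \<open>0 \<le> y\<^sup>2\<close> by linarith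
  have \<gamma>0: "\<gamma> \<ge> 0" using Z0 Z(2) by (simp add: \<gamma>_def)
  have W: "K * \<gamma> \<le> W" "b \<le> W" "0 \<le> W" using b by (auto simp: W_def)
  have zy: "z \<le> 27/20 * (\<eta> * (1 - \<eta>) * y)" using z(2) by (simp add: \<nu>y mult.assoc)
  \<comment> \<open>W dominates both K \<gamma> and b, so two terms with coefficients c and B fit
    under W as soon as c + B <= 1. This yields the maximum instead of a sum; each case below has to
    find its c and B.\<close>
  have combine: "K * A + b * B \<le> W" if "A \<le> c * \<gamma>" "0 \<le> c" "0 \<le> B" "c + B \<le> 1" for A B c
  proof -
    have "K * A \<le> K * (c * \<gamma>)" using that(1) K by (intro mult_left_mono) auto
    also have "\<dots> = c * (K * \<gamma>)" by simp
    also have "\<dots> \<le> c * W" using W that by (intro mult_left_mono) auto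
    finally have "K * A + b * B \<le> c * W + W * B"
      using mult_right_mono[OF W(2) that(3)] by linarith
    also have "\<dots> = (c + B) * W" by (simp add: algebra_simps)
    also have "\<dots> \<le> 1 * W" using that W(3) by (intro mult_right_mono) auto
    finally show ?thesis by simp
  qed
  have sq2: "141/100 \<le> sqrt 2" by (rule real_le_rsqrt) (simp add: power2_eq_square)

  have c1: "K * ((1 - \<theta>) * b / 2 - \<theta>) + \<theta> * (1 + b / 2) + z * (K + b / 2) \<le> W"
  proof -
    \<comment> \<open>96/100 exceeds 27/20 * 100/141, where 141/100 stands for sqrt 2.\<close>
    define c where "c = 96/100 * (\<eta> * (1 - \<eta>)) * (1 - y\<^sup>2)"
    have y21: "0 \<le> 1 - y\<^sup>2" using Zy Z(2) by linarith
    have "sqrt 2 * y \<le> (1 - y\<^sup>2) * \<gamma>"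
      using sqrt_odds_lower_bound[of "y\<^sup>2" Z] Zy Z(2) y0 by (simp add: \<gamma>_def real_sqrt_mult)
    moreover have "141/100 * y \<le> sqrt 2 * y" using sq2 y0 by (intro mult_right_mono)
    ultimately have yg: "y \<le> 100/141 * ((1 - y\<^sup>2) * \<gamma>)" by linarith
    have "z \<le> (27/20 * (\<eta> * (1 - \<eta>))) * y" using zy by (simp add: mult.assoc)
    also have "\<dots> \<le> (27/20 * (\<eta> * (1 - \<eta>))) * (100/141 * ((1 - y\<^sup>2) * \<gamma>))"
      using yg \<eta> by (intro mult_left_mono) auto
    also have "\<dots> = (27/20 * (100/141)) * (\<eta> * (1 - \<eta>) * ((1 - y\<^sup>2) * \<gamma>))" by simp
    also have "\<dots> \<le> 96/100 * (\<eta> * (1 - \<eta>) * ((1 - y\<^sup>2) * \<gamma>))"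
      using \<eta> y21 \<gamma>0 by (intro mult_right_mono mult_nonneg_nonneg) auto
    finally have zc: "z \<le> c * \<gamma>" by (simp add: c_def mult.assoc)
    have cB: "c + (K / 2 + z / 2) \<le> 1"
    proof -
      \<comment> \<open>Replacing y^2 by its chord on [0, 71/100] from above and by its tangent at
        7/10 from below makes the bound affine in y. It then only needs checking at y = 0 and y =
        71/100, where it is a quadratic in \<open>\<eta>\<close>; 100/71 y is the interpolation
        weight.\<close>
      have y2: "y\<^sup>2 \<le> 71/100 * y" using mult_right_mono[OF y1 y0] by (simp add: power2_eq_square)
      have y2': "2 * (7/10) * y - (7/10)\<^sup>2 \<le> y\<^sup>2"
        using zero_le_power2[of "y - 7/10"] by (simp add: power2_eq_square algebra_simps)
      define br where "br = y / 4 + y\<^sup>2 / 2 + \<eta> * (96/100 + 675/1000 * y - 146/100 * y\<^sup>2)"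
      have e: "c + (1/2 + \<nu> / 4 + \<nu>\<^sup>2 / 2 + 675/1000 * (\<eta> * (1 - \<eta>) * y)) = 1/2 + (1 - \<eta>) * br"
        unfolding c_def \<nu>y br_def by (simp add: power2_eq_square field_simps)
      have "br \<le> y / 4 + 71/200 * y + \<eta> * (96/100 + 675/1000 * y - 146/100 * (2 * (7/10) * y - (7/10)\<^sup>2))"
        unfolding br_def using y2 y2' \<eta> by (intro add_mono mult_left_mono) auto
      also have "\<dots> = (1 - 100/71 * y) * (\<eta> * (16754/10000)) + (100/71 * y) * (71/100 * (605/1000) + \<eta> * (16754/10000 - 71/100 * (1369/1000)))"
        by (simp add: power2_eq_square field_simps)
      finally have "(1 - \<eta>) * br \<le> (1 - \<eta>) * ((1 - 100/71 * y) * (\<eta> * (16754/10000)) + (100/71 * y) * (71/100 * (605/1000) + \<eta> * (16754/10000 - 71/100 * (1369/1000))))"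
        using \<eta> by (intro mult_left_mono) auto
      also have "\<dots> = (1 - 100/71 * y) * ((1 - \<eta>) * (\<eta> * (16754/10000)))
          + (100/71 * y) * ((1 - \<eta>) * (71/100 * (605/1000) + \<eta> * (16754/10000 - 71/100 * (1369/1000))))"
      proof -
        have "a * (b * c + d * e) = b * (a * c) + d * (a * e)" for a b c d e :: real
          by (simp add: algebra_simps)
        then show ?thesis .
      qed
      also have "\<dots> \<le> (1 - 100/71 * y) * (1/2) + (100/71 * y) * (1/2)"
      proof (intro add_mono mult_left_mono)
        have "0 \<le> 16754/10000 * \<eta>\<^sup>2 + (- 16754/10000) * \<eta> + 1/2"
          by (rule nonneg_quadratic) (auto simp: power2_eq_square)
        then show "(1 - \<eta>) * (\<eta> * (16754/10000)) \<le> 1/2" by (simp add: power2_eq_square field_simps)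
        have "0 \<le> 70341/100000 * \<eta>\<^sup>2 + (- 27386/100000) * \<eta> + 7045/100000"
          by (rule nonneg_quadratic) (auto simp: power2_eq_square)
        then show "(1 - \<eta>) * (71/100 * (605/1000) + \<eta> * (16754/10000 - 71/100 * (1369/1000))) \<le> 1/2"
          using \<eta> by (simp add: power2_eq_square field_simps)
      qed (use y0 y1 in auto)
      finally have "(1 - \<eta>) * br \<le> 1/2" by (simp add: algebra_simps)
      then show ?thesis using e Kle zy by linarith
    qed
    have "K * z + b * (K / 2 + z / 2) \<le> W"
      using zc cB K z(1) \<eta> y21 by (intro combine[of z c]) (auto simp: c_def)
    \<comment> \<open>The shrinkage contributes - K \<theta> (1 + b / 2), which cancels the term
      \<theta> (1 + b / 2) because K >= 1.\<close>
    moreover have "\<theta> * (1 + b / 2) \<le> K * (\<theta> * (1 + b / 2))"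
      using mult_right_mono[OF K(1), of "\<theta> * (1 + b / 2)"] \<theta> b by simp
    ultimately show ?thesis by (simp add: field_simps)
  qed

  have c2: "K * (\<theta> + (1 - \<theta>) * (\<nu> / 2 + b / 8)) + \<theta> * (1 + b / 2) + z * (K + b / 2) \<le> W"
  proof -
    define S where "S = y\<^sup>2 + T\<^sup>2"
    have S0: "0 \<le> S" by (simp add: S_def)
    have S1: "0 \<le> 1 - S" using ZyT Z(2) S0 unfolding S_def by linarith
    have sg: "sqrt (2 * S) \<le> (1 - S) * \<gamma>"
      unfolding \<gamma>_def using ZyT Z(2) S0 by (intro sqrt_odds_lower_bound) (auto simp: S_def)
    have nz: "\<nu> / 2 + z \<le> 64/100 * y"
    proof -
      have "0 \<le> 27/20 * \<eta>\<^sup>2 + (- 17/20) * \<eta> + 14/100"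
        by (rule nonneg_quadratic) (auto simp: power2_eq_square)
      then have "(1 - \<eta>) * (1/2 + 27/20 * \<eta>) \<le> 64/100" by (simp add: power2_eq_square field_simps)
      from mult_right_mono[OF this y0] show ?thesis
        using zy unfolding \<nu>y by (simp add: field_simps)
    qed
    \<comment> \<open>Cauchy-Schwarz for (T, y) against (1, 64/100); 84/100 slightly exceeds sqrt
      ((1 + (64/100)^2) / 2).\<close>
    have "T + 64/100 * y \<le> 84/100 * sqrt (2 * S)"
    proof -
      have "(T + 64/100 * y)\<^sup>2 \<le> (1 + (64/100)\<^sup>2) * S"
        using zero_le_power2[of "64/100 * T - y"] by (simp add: S_def power2_eq_square field_simps)
      also have "\<dots> \<le> (84/100)\<^sup>2 * 2 * S"
        using S0 by (intro mult_right_mono) (auto simp: power2_eq_square)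
      also have "\<dots> = (84/100 * sqrt (2 * S))\<^sup>2" unfolding power_mult_distrib using S0 by simp
      finally show ?thesis by (rule power2_le_imp_le) (use S0 in simp)
    qed
    also have "\<dots> \<le> 84/100 * ((1 - S) * \<gamma>)" using sg by simp
    finally have A: "T + (\<nu> / 2 + z) \<le> (84/100 * (1 - S)) * \<gamma>"
      unfolding mult.assoc using nz by linarith
    \<comment> \<open>The constants 84/100 and 1/8 leave 35/1000. The linear terms in T and y are
      absorbed by the negative multiples of T^2 and y^2 inside - S, with an allowance of 15/1000
      each.\<close>
    have B: "84/100 * (1 - S) + (K / 8 + 3/16 * T + z / 2) \<le> 1"
    proof -
      have "0 \<le> 675/1000 * \<eta>\<^sup>2 + (- 6125/10000) * \<eta> + 1425/10000"
        by (rule nonneg_quadratic) (auto simp: power2_eq_square)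
      then have "(1 - \<eta>) * (1/16 + 675/1000 * \<eta>) \<le> 205/1000" by (simp add: power2_eq_square field_simps)
      from mult_right_mono[OF this y0] have 1: "\<nu> / 16 + z / 2 \<le> 205/1000 * y"
        using zy unfolding \<nu>y by (simp add: field_simps)
      have 2: "\<nu>\<^sup>2 \<le> y\<^sup>2" using \<nu> \<nu>le by (intro power_mono)
      have 3: "0 \<le> 84/100 * T\<^sup>2 + (- 3/16) * T + 15/1000"
        by (rule nonneg_quadratic) (auto simp: power2_eq_square)
      have 4: "0 \<le> 715/1000 * y\<^sup>2 + (- 205/1000) * y + 15/1000"
        by (rule nonneg_quadratic) (auto simp: power2_eq_square)
      show ?thesis using 1 2 3 4 Kle unfolding S_def by (simp add: field_simps)
    qed
    have "K * (T + (\<nu> / 2 + z)) + b * (K / 8 + 3/16 * T + z / 2) \<le> W"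
      using A B S1 K T0 z(1) by (intro combine) auto
    moreover have "K * (\<theta> + (1 - \<theta>) * (\<nu> / 2 + b / 8)) + \<theta> * (1 + b / 2) + z * (K + b / 2)
        \<le> K * (T + (\<nu> / 2 + z)) + b * (K / 8 + 3/16 * T + z / 2)"
    proof -
      have \<theta>K: "\<theta> \<le> K * \<theta>" using mult_right_mono[OF K(1) \<theta>] by simp
      have "K * \<theta> + \<theta> \<le> T" using \<theta>K by (simp add: T_def)
      also have "T \<le> K * T" using mult_right_mono[OF K(1) T0] by simp
      finally have 1: "K * \<theta> + \<theta> \<le> K * T" .
      have "\<theta> * b \<le> K * \<theta> * b" using \<theta>K b by (rule mult_right_mono)
      \<comment> \<open>\<theta> <= K \<theta> leaves at most (1/2 - 1/8) K \<theta> b, and K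
        \<theta> = T / 2.\<close>
      then have 2: "- (K * \<theta> * b / 8) + \<theta> * b / 2 \<le> 3/16 * T * b"
        using mult_nonneg_nonneg[OF \<theta> b] by (simp add: T_def)
      have 3: "0 \<le> K * \<theta> * \<nu>" using K \<theta> \<nu> by simp
      show ?thesis using 1 2 3 by (simp add: field_simps)
    qed
    ultimately show ?thesis by linarith
  qed
  show ?thesis
    using c1 c2 by (cases "(1 - \<theta>) * b / 2 - \<theta> \<le> \<theta> + (1 - \<theta>) * (\<nu> / 2 + b / 8)")
      (auto simp: max_def W_def \<gamma>_def)
qed

section \<open>Regularized empirical risk\<close>

text \<open>Common shape of the full, the sampled and the averaged Hessian and of A^T A, so that
  selfadjointness and the quadratic form are computed once.\<close>

definition gram_op :: "'i set \<Rightarrow> ('i \<Rightarrow> real) \<Rightarrow> ('i \<Rightarrow> 'a) \<Rightarrow> real \<Rightarrow> 'a::euclidean_space \<Rightarrow> 'a" where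
  "gram_op I c a lam v = (\<Sum>i\<in>I. (c i * (a i \<bullet> v)) *\<^sub>R a i) + lam *\<^sub>R v"

lemma selfadj_gram_op: "selfadj (gram_op I c a lam)"
  unfolding selfadj_def
proof (intro conjI allI)
  show "linear (gram_op I c a lam)"
    by (rule linearI)
       (simp_all add: gram_op_def inner_add_right distrib_left scaleR_add_left sum.distrib
          scaleR_add_right scaleR_right.sum mult.left_commute mult.commute)
  show "gram_op I c a lam u \<bullet> v = u \<bullet> gram_op I c a lam v" for u v
    by (simp add: gram_op_def inner_add_left inner_add_right inner_sum_left inner_sum_right
        inner_commute mult.commute mult.left_commute)
qed

lemma gram_op_form: "v \<bullet> gram_op I c a lam v = (\<Sum>i\<in>I. c i * (a i \<bullet> v)\<^sup>2) + lam * (norm v)\<^sup>2"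
  by (simp add: gram_op_def inner_add_right inner_sum_right dot_square_norm power2_eq_square
      inner_commute mult.assoc)

lemma outer_mult_vec: "outer x *v v = (x \<bullet> v) *\<^sub>R x"
  by (simp add: vec_eq_iff outer_def matrix_vector_mult_def inner_vec_def sum_distrib_left
      sum_distrib_right mult.commute mult.left_commute)

lemma sum_matrix_vector_mult: "(\<Sum>i\<in>I. M i) *v v = (\<Sum>i\<in>I. M i *v (v :: real^'d))"
  by (induction I rule: infinite_finite_induct) (simp_all add: matrix_vector_mult_add_rdistrib)

lemma hess_mult_vec:
  "hess l2 x lam w *v v = gram_op UNIV (\<lambda>j. l2 j (w \<bullet> x j) / CARD('n)) x lam (v :: real^'d)"
  for x :: "'n::finite \<Rightarrow> real^'d"
  by (simp add: hess_def gram_op_def matrix_vector_mult_add_rdistrib scaleR_matrix_vector_assoc[symmetric]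
      sum_matrix_vector_mult outer_mult_vec scaleR_right.sum)

lemma loc_hess_mult_vec:
  "loc_hess l2 x lam s S w *v v = gram_op {..<s} (\<lambda>k. l2 (S k) (w \<bullet> x (S k)) / s) (\<lambda>k. x (S k)) lam (v :: real^'d)"
  by (simp add: loc_hess_def gram_op_def matrix_vector_mult_add_rdistrib scaleR_matrix_vector_assoc[symmetric]
      sum_matrix_vector_mult outer_mult_vec scaleR_right.sum)

section \<open>Extreme singular values and the weight of the data term\<close>

text \<open>\<open>sigma_min\<close> is an infimum of norms, not of the quadratic form. Compactness
  gives a minimiser v0 of the Rayleigh quotient; it is an eigenvector, and there the two quantities
  coincide.\<close>

lemma sigma_min_le_form:
  fixes M :: "real^'d^'d"
  assumes sa: "selfadj ((*v) M)" and psd: "\<And>v. 0 \<le> v \<bullet> (M *v v)"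
  shows "sigma_min M * (norm v)\<^sup>2 \<le> v \<bullet> (M *v v)"
proof -
  have lin: "linear ((*v) M)" using sa by (simp add: selfadj_def)
  have "continuous_on (sphere 0 1) (\<lambda>v. v \<bullet> (M *v v))"
    by (intro continuous_on_inner continuous_on_id linear_continuous_on linear_linear[THEN iffD2] lin
        linear_conv_bounded_linear[THEN iffD1])
  moreover have "(sphere 0 1 :: (real^'d) set) \<noteq> {}" by simp
  ultimately obtain v0 where v0: "norm v0 = 1" "\<And>v. norm v = 1 \<Longrightarrow> v0 \<bullet> (M *v v0) \<le> v \<bullet> (M *v v)"
    using continuous_attains_inf[of "sphere 0 1 :: (real^'d) set" "\<lambda>v. v \<bullet> (M *v v)"] by auto
  define \<mu> where "\<mu> = v0 \<bullet> (M *v v0)"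
  have \<mu>: "\<mu> * (norm v)\<^sup>2 \<le> v \<bullet> (M *v v)" for v
  proof (cases "v = 0")
    case False
    define u where "u = (1 / norm v) *\<^sub>R v"
    have u: "norm u = 1" "v = norm v *\<^sub>R u" using False by (auto simp: u_def)
    have "v \<bullet> (M *v v) = (norm v)\<^sup>2 * (u \<bullet> (M *v u))"
      by (subst (1 2) u(2)) (simp add: linear_cmul[OF lin] power2_eq_square)
    moreover have "(norm v)\<^sup>2 * \<mu> \<le> (norm v)\<^sup>2 * (u \<bullet> (M *v u))"
      unfolding \<mu>_def by (intro mult_left_mono v0(2) u) auto
    ultimately show ?thesis by (simp add: mult.commute)
  qed simp
  define N where "N v = M *v v - \<mu> *\<^sub>R v" for v
  have saN: "selfadj N"
    using sa unfolding N_def[abs_def] selfadj_def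
    by (auto intro!: linearI simp: linear_add linear_cmul inner_diff_left inner_diff_right algebra_simps)
  have N0: "v0 \<bullet> N v0 = 0" using v0(1) by (simp add: N_def inner_diff_right \<mu>_def dot_square_norm)
  \<comment> \<open>v0 is a null vector of the positive semidefinite form of N, so Cauchy-Schwarz
    forces N v0 = 0.\<close>
  have "(N v0 \<bullet> N v0)\<^sup>2 \<le> (N v0 \<bullet> N (N v0)) * (v0 \<bullet> N v0)"
    by (rule form_Cauchy_Schwarz[OF saN subspace_UNIV])
       (use \<mu> in \<open>auto simp: N_def inner_diff_right dot_square_norm\<close>)
  then have "N v0 = 0" by (simp add: N0)
  then have "norm (M *v v0) = \<bar>\<mu>\<bar>" using v0(1) by (simp add: N_def)
  also have "\<dots> = \<mu>" using psd[of v0] by (simp add: \<mu>_def)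
  finally have "sigma_min M \<le> \<mu>"
    unfolding sigma_min_def using v0(1) by (intro cInf_lower bdd_belowI[of _ 0]) auto
  then show ?thesis using \<mu>[of v] mult_right_mono[of "sigma_min M" \<mu> "(norm v)\<^sup>2"] by simp
qed

lemma sigma_min_ge:
  fixes M :: "real^'d^'d"
  assumes "\<And>v. c * (norm v)\<^sup>2 \<le> v \<bullet> (M *v v)"
  shows "c \<le> sigma_min M"
  unfolding sigma_min_def
proof (rule cInf_greatest)
  obtain u :: "real^'d" where "norm u = 1" using norm_axis_1 by blast
  then show "{norm (M *v v) |v. norm v = 1} \<noteq> {}" by blast
  fix t assume "t \<in> {norm (M *v v) |v. norm v = 1}"
  then obtain v where v: "norm v = 1" "t = norm (M *v v)" by blast
  then show "c \<le> t" using assms[of v] norm_cauchy_schwarz[of v "M *v v"] by simp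
qed

lemma norm_le_sigma_max: "norm (M *v v) \<le> sigma_max M * norm (v :: real^'d)"
  unfolding sigma_max_def by (intro onorm matrix_vector_mul_bounded_linear)

lemma form_le_sigma_max: "v \<bullet> (M *v v) \<le> sigma_max M * (norm (v :: real^'d))\<^sup>2"
proof -
  have "v \<bullet> (M *v v) \<le> norm v * norm (M *v v)" by (rule norm_cauchy_schwarz)
  also have "\<dots> \<le> norm v * (sigma_max M * norm v)" by (intro mult_left_mono norm_le_sigma_max) auto
  finally show ?thesis by (simp add: power2_eq_square mult.commute mult.left_commute)
qed

lemma sigma_max_nonneg: "0 \<le> sigma_max M"
  unfolding sigma_max_def by (intro onorm_pos_le matrix_vector_mul_bounded_linear)

lemma Amat_nth: "(Amat l2 x w *v v) $ j = sqrt (l2 j (w \<bullet> x j)) * (x j \<bullet> v)"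
  by (simp add: Amat_def matrix_vector_mult_def inner_vec_def sum_distrib_left mult.assoc)

lemma Amat_gram_form:
  fixes x :: "'n::finite \<Rightarrow> real^'d"
  assumes "\<And>j. 0 \<le> l2 j (w \<bullet> x j)"
  shows "(norm (Amat l2 x w *v v))\<^sup>2 = (\<Sum>j\<in>UNIV. l2 j (w \<bullet> x j) * (x j \<bullet> v)\<^sup>2)"
proof -
  have "(norm (Amat l2 x w *v v))\<^sup>2 = (\<Sum>j\<in>UNIV. ((Amat l2 x w *v v) $ j)\<^sup>2)"
    unfolding power2_norm_eq_inner inner_vec_def[of "Amat l2 x w *v v"] by (simp add: power2_eq_square)
  then show ?thesis using assms by (simp add: Amat_nth power_mult_distrib)
qed

lemma gram_matrix_mult_vec:
  fixes x :: "'n::finite \<Rightarrow> real^'d"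
  assumes "\<And>j. 0 \<le> l2 j (w \<bullet> x j)"
  shows "(transpose (Amat l2 x w) ** Amat l2 x w) *v v = gram_op UNIV (\<lambda>j. l2 j (w \<bullet> x j)) x 0 v"
proof -
  have "(transpose (Amat l2 x w) ** Amat l2 x w) *v v = transpose (Amat l2 x w) *v (Amat l2 x w *v v)"
    by (simp add: matrix_vector_mul_assoc)
  also have "\<dots> = (\<Sum>j\<in>UNIV. ((Amat l2 x w *v v) $ j) *\<^sub>R (sqrt (l2 j (w \<bullet> x j)) *\<^sub>R x j))"
  proof -
    have "transpose A *v u = (\<Sum>j\<in>UNIV. u $ j *\<^sub>R A $ j)" for A :: "real^'d^'n" and u
      by (simp add: vec_eq_iff matrix_vector_mult_def transpose_def sum_component mult.commute)
    then show ?thesis by (simp add: Amat_def)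
  qed
  also have "\<dots> = gram_op UNIV (\<lambda>j. l2 j (w \<bullet> x j)) x 0 v"
    unfolding gram_op_def Amat_nth using assms
    by (simp add: mult.commute mult.left_commute flip: mult.assoc)
  finally show ?thesis .
qed

text \<open>\<open>\<nu>\<close> = \<sigma> / (\<sigma> + lam) bounds the share of the data term in
  v . H v, since t / (t + lam) increases in t. The last claim links \<open>\<nu>\<close> to
  conditioning: together with lam <= sigma_min it gives \<kappa> (1 - \<nu>) <= 1.\<close>

lemma nu_const_bounds:
  fixes x :: "'n::finite \<Rightarrow> real^'d"
  assumes l2: "\<And>j. 0 \<le> l2 j (w \<bullet> x j)" and lam: "lam > 0"
  defines "\<nu> \<equiv> nu_const (Amat l2 x w) lam" and "H \<equiv> hess l2 x lam w"
  shows "0 \<le> \<nu>" "\<nu> < 1" "v \<bullet> (H *v v) - lam * (norm v)\<^sup>2 \<le> \<nu> * (v \<bullet> (H *v v))"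
    and "sigma_max H * (1 - \<nu>) \<le> lam"
proof -
  define G where "G = transpose (Amat l2 x w) ** Amat l2 x w"
  define \<sigma> where "\<sigma> = sigma_max G / CARD('n)"
  have \<sigma>: "0 \<le> \<sigma>" using sigma_max_nonneg[of G] by (simp add: \<sigma>_def)
  have \<nu>: "\<nu> = \<sigma> / (\<sigma> + lam)"
    by (simp add: \<nu>_def nu_const_def G_def[symmetric] \<sigma>_def field_simps)
  show "0 \<le> \<nu>" "\<nu> < 1" using \<sigma> lam by (auto simp: \<nu>)
  have HG: "H *v v = (1 / CARD('n)) *\<^sub>R (G *v v) + lam *\<^sub>R v" for v
    unfolding G_def gram_matrix_mult_vec[of l2 w x, OF l2] H_def hess_mult_vec
    by (simp add: gram_op_def scaleR_right.sum)
  have f: "v \<bullet> (H *v v) - lam * (norm v)\<^sup>2 \<le> \<sigma> * (norm v)\<^sup>2"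
    using form_le_sigma_max[of v G]
    by (simp add: HG inner_add_right dot_square_norm \<sigma>_def divide_right_mono)
  have "lam * (v \<bullet> (H *v v) - lam * (norm v)\<^sup>2) \<le> \<sigma> * (lam * (norm v)\<^sup>2)"
    using mult_left_mono[OF f, of lam] lam by (simp add: mult.left_commute)
  then show "v \<bullet> (H *v v) - lam * (norm v)\<^sup>2 \<le> \<nu> * (v \<bullet> (H *v v))"
    using \<sigma> lam by (simp add: \<nu> field_simps)
  have "sigma_max H \<le> \<sigma> + lam"
    unfolding sigma_max_def
  proof (rule onorm_le)
    fix v
    have "norm (H *v v) \<le> (1 / CARD('n)) * norm (G *v v) + lam * norm v"
      unfolding HG using lam norm_triangle_ineq[of "(1 / CARD('n)) *\<^sub>R (G *v v)" "lam *\<^sub>R v"] by simp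
    also have "\<dots> \<le> (1 / CARD('n)) * (sigma_max G * norm v) + lam * norm v"
      by (intro add_right_mono mult_left_mono norm_le_sigma_max) auto
    finally show "norm (H *v v) \<le> (\<sigma> + lam) * norm v" by (simp add: \<sigma>_def algebra_simps)
  qed
  then have "sigma_max H * lam \<le> (\<sigma> + lam) * lam" using lam by (intro mult_right_mono) auto
  moreover have "1 - \<nu> = lam / (\<sigma> + lam)" using \<sigma> lam by (simp add: \<nu> field_simps)
  ultimately show "sigma_max H * (1 - \<nu>) \<le> lam"
    using \<sigma> lam by (simp only:) (simp add: pos_divide_le_eq mult.commute)
qed

text \<open>Adding the tangent inequalities at two points makes l1 monotone, so its difference
  quotients and their limit are nonnegative.\<close>

lemma convex_second_derivative_nonneg:
  fixes l l1 :: "real \<Rightarrow> real"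
  assumes c: "convex_on UNIV l" and l: "\<And>z. (l has_real_derivative l1 z) (at z)"
    and l1: "(l1 has_real_derivative d) (at z)"
  shows "0 \<le> d"
proof -
  have mono: "0 \<le> (l1 b - l1 a) / (b - a)" for a b
  proof -
    have "l1 a * (b - a) \<le> l b - l a"
      by (rule convex_on_imp_above_tangent[OF c]) (auto intro: l)
    moreover have "l1 b * (a - b) \<le> l a - l b"
      by (rule convex_on_imp_above_tangent[OF c]) (auto intro: l)
    ultimately have "0 \<le> (l1 b - l1 a) * (b - a)" by (simp add: algebra_simps)
    then show ?thesis by (simp add: zero_le_divide_iff zero_le_mult_iff)
  qed
  have "((\<lambda>t. (l1 t - l1 z) / (t - z)) \<longlongrightarrow> d) (at z)"
    using l1 by (simp add: has_field_derivative_iff)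
  then show ?thesis by (rule tendsto_lowerbound) (auto intro!: always_eventually mono)
qed

lemma grad_eq_0_at_minimizer:
  fixes x :: "'n::finite \<Rightarrow> real^'d"
  assumes l: "\<And>j z. (l j has_real_derivative l1 j z) (at z)"
    and min: "\<And>v. obj l x lam ws \<le> obj l x lam v"
  shows "grad l1 x lam ws = 0"
proof -
  define u where "u = grad l1 x lam ws"
  define F where "F t = obj l x lam (ws + t *\<^sub>R u)" for t
  have inner: "u \<bullet> u = (\<Sum>j\<in>UNIV. l1 j (ws \<bullet> x j) * (u \<bullet> x j)) / CARD('n) + lam * (ws \<bullet> u)"
    by (subst (1) u_def) (simp add: grad_def inner_add_left inner_add_right inner_sum_left inner_sum_right inner_commute)
  have "((\<lambda>t. l j ((ws + t *\<^sub>R u) \<bullet> x j)) has_real_derivative l1 j (ws \<bullet> x j) * (u \<bullet> x j)) (at 0)" for j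
  proof -
    have "((\<lambda>t. (ws + t *\<^sub>R u) \<bullet> x j) has_real_derivative (u \<bullet> x j)) (at 0)"
      by (auto simp: inner_add_left intro!: derivative_eq_intros)
    from DERIV_chain2[OF _ this, of "l j" "l1 j (ws \<bullet> x j)"] show ?thesis using l[of j "ws \<bullet> x j"] by simp
  qed
  moreover have "((\<lambda>t. (norm (ws + t *\<^sub>R u))\<^sup>2) has_real_derivative 2 * (ws \<bullet> u)) (at 0)"
  proof -
    have e: "(norm (ws + t *\<^sub>R u))\<^sup>2 = (norm ws)\<^sup>2 + 2 * t * (ws \<bullet> u) + t\<^sup>2 * (norm u)\<^sup>2" for t
      unfolding power2_norm_eq_inner
      by (simp add: inner_add_left inner_add_right inner_commute power2_eq_square algebra_simps)
    show ?thesis unfolding e by (auto intro!: derivative_eq_intros)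
  qed
  ultimately have "(F has_real_derivative
      ((\<Sum>j\<in>UNIV. l1 j (ws \<bullet> x j) * (u \<bullet> x j)) / CARD('n) + lam / 2 * (2 * (ws \<bullet> u)))) (at 0)"
    unfolding F_def[abs_def] obj_def
    by (intro DERIV_add DERIV_cdivide DERIV_cmult DERIV_sum)
  then have "(F has_real_derivative (u \<bullet> u)) (at 0)" by (simp add: inner)
  moreover have "\<forall>t. \<bar>0 - t\<bar> < 1 \<longrightarrow> F 0 \<le> F t" using min by (simp add: F_def)
  ultimately have "u \<bullet> u = 0" using DERIV_local_min[of F "u \<bullet> u" 0 1] by simp
  then show ?thesis by (simp add: u_def)
qed

text \<open>The secant slopes \<open>h j\<close> of \<open>l1 j\<close> between \<open>ws\<close> and \<open>w\<close> play the role of the averaged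
  Hessian \<open>\<integral>\<^sub>0\<^sup>1 \<nabla>\<^sup>2f (ws + \<tau> (w - ws)) d\<tau>\<close>. The first bound is the usual Lipschitz estimate. For
  the second one the Lipschitz estimate is used only for \<open>\<tau> \<ge> 1/2\<close>, and convexity for
  \<open>\<tau> \<le> 1/2\<close>.\<close>

lemma averaged_Hessian:
  fixes x :: "'n::finite \<Rightarrow> real^'d"
  assumes l1: "\<And>j z. (l1 j has_real_derivative l2 j z) (at z)" and l2: "\<And>j z. 0 \<le> l2 j z"
    and lip: "\<And>v v'. onorm (\<lambda>u. (hess l2 x lam v - hess l2 x lam v') *v u) \<le> L * norm (v - v')"
  obtains h where
    "grad l1 x lam w - grad l1 x lam ws = gram_op UNIV (\<lambda>j. h j / CARD('n)) x lam (w - ws)"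
    "\<And>v. \<bar>v \<bullet> (hess l2 x lam w *v v) - v \<bullet> gram_op UNIV (\<lambda>j. h j / CARD('n)) x lam v\<bar>
        \<le> L * norm (w - ws) / 2 * (norm v)\<^sup>2"
    "\<And>v. v \<bullet> (hess l2 x lam w *v v) - v \<bullet> gram_op UNIV (\<lambda>j. h j / CARD('n)) x lam v
        \<le> (v \<bullet> (hess l2 x lam w *v v) - lam * (norm v)\<^sup>2) / 2 + L * norm (w - ws) / 8 * (norm v)\<^sup>2"
proof -
  define \<Delta> where "\<Delta> = w - ws"
  define d where "d j = \<Delta> \<bullet> x j" for j
  \<comment> \<open>If d j = 0 the segment projects to a single point, and the averaged second
    derivative is the value of l2 there.\<close>
  define h where "h j = (if d j = 0 then l2 j (w \<bullet> x j) else (l1 j (w \<bullet> x j) - l1 j (ws \<bullet> x j)) / d j)" for j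
  have wd: "w \<bullet> x j = ws \<bullet> x j + d j" for j by (simp add: d_def \<Delta>_def inner_diff_left)
  have hd: "l1 j (w \<bullet> x j) - l1 j (ws \<bullet> x j) = h j * d j" for j by (simp add: h_def wd)
  have "grad l1 x lam w - grad l1 x lam ws =
      (1 / CARD('n)) *\<^sub>R (\<Sum>j\<in>UNIV. (l1 j (w \<bullet> x j) - l1 j (ws \<bullet> x j)) *\<^sub>R x j) + lam *\<^sub>R \<Delta>"
    by (simp add: grad_def \<Delta>_def scaleR_diff_left scaleR_diff_right sum_subtractf algebra_simps)
  also have "\<dots> = gram_op UNIV (\<lambda>j. h j / CARD('n)) x lam \<Delta>"
    unfolding hd by (simp add: gram_op_def scaleR_right.sum d_def inner_commute)
  finally have 1: "grad l1 x lam w - grad l1 x lam ws = gram_op UNIV (\<lambda>j. h j / CARD('n)) x lam (w - ws)"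
    by (simp add: \<Delta>_def)
  have main: "\<bar>v \<bullet> (hess l2 x lam w *v v) - v \<bullet> gram_op UNIV (\<lambda>j. h j / CARD('n)) x lam v\<bar>
        \<le> L * norm \<Delta> / 2 * (norm v)\<^sup>2 \<and>
     v \<bullet> (hess l2 x lam w *v v) - v \<bullet> gram_op UNIV (\<lambda>j. h j / CARD('n)) x lam v
        \<le> (v \<bullet> (hess l2 x lam w *v v) - lam * (norm v)\<^sup>2) / 2 + L * norm \<Delta> / 8 * (norm v)\<^sup>2" for v
  proof -
    define q where "q t = (\<Sum>j\<in>UNIV. l2 j (ws \<bullet> x j + t * d j) / CARD('n) * (x j \<bullet> v)\<^sup>2)" for t
    \<comment> \<open>A primitive of q written through l1, so that the averaged Hessian arises as
      \<phi> 1 - \<phi> 0 without an integral.\<close>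
    define \<phi> where "\<phi> t = (\<Sum>j\<in>UNIV. (if d j = 0 then t * l2 j (ws \<bullet> x j) else l1 j (ws \<bullet> x j + t * d j) / d j)
        / CARD('n) * (x j \<bullet> v)\<^sup>2)" for t
    define C where "C = L * norm \<Delta> * (norm v)\<^sup>2"
    have form: "v \<bullet> (hess l2 x lam (ws + t *\<^sub>R \<Delta>) *v v) = q t + lam * (norm v)\<^sup>2" for t
      by (simp add: hess_mult_vec gram_op_form q_def inner_add_left d_def)
    have form1: "v \<bullet> (hess l2 x lam w *v v) = q 1 + lam * (norm v)\<^sup>2"
      using form[of 1] by (simp add: \<Delta>_def)
    have lip': "\<bar>q 1 - q t\<bar> \<le> C * (1 - t)" if "t \<le> 1" for t
    proof -
      let ?M = "hess l2 x lam w - hess l2 x lam (ws + t *\<^sub>R \<Delta>)"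
      have "\<bar>q 1 - q t\<bar> = \<bar>v \<bullet> (?M *v v)\<bar>"
        using form1 form[of t] by (simp add: matrix_vector_mult_diff_rdistrib inner_diff_right)
      also have "\<dots> \<le> norm v * norm (?M *v v)" by (rule Cauchy_Schwarz_ineq2)
      also have "\<dots> \<le> norm v * (onorm ((*v) ?M) * norm v)"
        by (intro mult_left_mono onorm matrix_vector_mul_bounded_linear) auto
      also have "\<dots> \<le> norm v * ((L * norm (w - (ws + t *\<^sub>R \<Delta>))) * norm v)"
        by (intro mult_left_mono mult_right_mono lip) auto
      also have "w - (ws + t *\<^sub>R \<Delta>) = (1 - t) *\<^sub>R \<Delta>" by (simp add: \<Delta>_def scaleR_diff_left)
      also have "norm v * ((L * norm ((1 - t) *\<^sub>R \<Delta>)) * norm v) = C * (1 - t)"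
        using that by (simp add: C_def power2_eq_square)
      finally show ?thesis .
    qed
    have d\<phi>: "(\<phi> has_real_derivative q t) (at t)" for t
      unfolding \<phi>_def[abs_def] q_def
    proof (intro DERIV_sum DERIV_cmult_right DERIV_cdivide)
      fix j
      show "((\<lambda>t. if d j = 0 then t * l2 j (ws \<bullet> x j) else l1 j (ws \<bullet> x j + t * d j) / d j)
          has_real_derivative l2 j (ws \<bullet> x j + t * d j)) (at t)"
      proof (cases "d j = 0")
        case True then show ?thesis by (auto intro!: derivative_eq_intros)
      next
        case False
        have "((\<lambda>t. ws \<bullet> x j + t * d j) has_real_derivative d j) (at t)"
          by (auto intro!: derivative_eq_intros)
        from DERIV_cdivide[OF DERIV_chain2[OF l1[of j] this], of "d j"] False show ?thesis by simp
      qed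
    qed
    have \<phi>01: "\<phi> 1 - \<phi> 0 = v \<bullet> gram_op UNIV (\<lambda>j. h j / CARD('n)) x lam v - lam * (norm v)\<^sup>2"
    proof -
      have "\<phi> 1 - \<phi> 0 = (\<Sum>j\<in>UNIV. h j / CARD('n) * (x j \<bullet> v)\<^sup>2)"
        unfolding \<phi>_def sum_subtractf[symmetric]
        by (intro sum.cong refl) (auto simp: h_def wd diff_divide_distrib left_diff_distrib)
      then show ?thesis by (simp add: gram_op_form)
    qed
    \<comment> \<open>Adding or subtracting C (1 - t)^2 / 2 integrates the Lipschitz bound over
      [a, 1]. The choice a = 0 gives the two-sided bound C / 2, and a = 1/2 gives C / 8.\<close>
    have up: "\<phi> 1 - \<phi> a \<le> (1 - a) * q 1 + C * (1 - a)\<^sup>2 / 2"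
      and lo: "(1 - a) * q 1 - C * (1 - a)\<^sup>2 / 2 \<le> \<phi> 1 - \<phi> a" if a: "a \<le> 1" for a
    proof -
      define F where "F t = \<phi> t - t * q 1 + C * (1 - t)\<^sup>2 / 2" for t
      have dF: "(F has_real_derivative (q t - q 1 - C * (1 - t))) (at t)" for t
        unfolding F_def by (auto intro!: derivative_eq_intros d\<phi> simp: field_simps)
      have "F 1 \<le> F a"
      proof (rule DERIV_nonpos_imp_nonincreasing[of a 1 F, OF a])
        fix t assume "a \<le> t" "t \<le> 1"
        then have "q t - q 1 - C * (1 - t) \<le> 0" using lip'[of t] by linarith
        then show "\<exists>y. (F has_real_derivative y) (at t) \<and> y \<le> 0" using dF by blast
      qed
      then show "\<phi> 1 - \<phi> a \<le> (1 - a) * q 1 + C * (1 - a)\<^sup>2 / 2" by (simp add: F_def left_diff_distrib)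
      define E where "E t = \<phi> t - t * q 1 - C * (1 - t)\<^sup>2 / 2" for t
      have dE: "(E has_real_derivative (q t - q 1 + C * (1 - t))) (at t)" for t
        unfolding E_def by (auto intro!: derivative_eq_intros d\<phi> simp: field_simps)
      have "E a \<le> E 1"
      proof (rule DERIV_nonneg_imp_nondecreasing[of a 1 E, OF a])
        fix t assume "a \<le> t" "t \<le> 1"
        then have "0 \<le> q t - q 1 + C * (1 - t)" using lip'[of t] by linarith
        then show "\<exists>y. (E has_real_derivative y) (at t) \<and> y \<ge> 0" using dE by blast
      qed
      then show "(1 - a) * q 1 - C * (1 - a)\<^sup>2 / 2 \<le> \<phi> 1 - \<phi> a" by (simp add: E_def left_diff_distrib)
    qed
    have "\<phi> 0 \<le> \<phi> (1/2)"
    proof (rule DERIV_nonneg_imp_nondecreasing[of 0 "1/2" \<phi>])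
      fix t
      have "0 \<le> q t" unfolding q_def using l2 by (intro sum_nonneg) auto
      then show "\<exists>y. (\<phi> has_real_derivative y) (at t) \<and> y \<ge> 0" using d\<phi> by blast
    qed simp
    then have half: "q 1 / 2 - C / 8 \<le> \<phi> 1 - \<phi> 0"
      using lo[of "1/2"] by (simp add: power2_eq_square)
    have C: "L * norm \<Delta> / 2 * (norm v)\<^sup>2 = C / 2" "L * norm \<Delta> / 8 * (norm v)\<^sup>2 = C / 8"
      by (simp_all add: C_def)
    have "\<phi> 1 - \<phi> 0 \<le> q 1 + C / 2" "q 1 - C / 2 \<le> \<phi> 1 - \<phi> 0"
      using up[of 0] lo[of 0] by simp_all
    then show ?thesis
      unfolding form1 C add_diff_cancel_right' using half \<phi>01 by (intro conjI abs_leI) linarith+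
  qed
  show ?thesis
    by (rule that[of h]) (use 1 main in \<open>auto simp: \<Delta>_def\<close>)
qed

section \<open>Row coherence as the norm bound of a tight frame\<close>

lemma is_onb_exists: "\<exists>B. is_onb B (colspace A)"
proof -
  have "subspace (colspace A)"
    unfolding colspace_def by (intro linear_subspace_image) (auto simp: matrix_vector_mul_linear)
  then show ?thesis
    using orthonormal_basis_subspace[of "colspace A"] unfolding is_onb_def by metis
qed

text \<open>y_j is sqrt n times the projection of the j-th unit vector onto the column space. Its
  squared norm is n |u_j|^2, at most \<mu> d, and pairing it with A v reads off the j-th entry. The
  cardinality of \<open>E\<close> is the rank of A, hence at most d.\<close>

lemma row_coherence_frame:
  fixes A :: "real^'d^'n::finite"
  assumes pos: "row_coherence A > 0"
  obtains E y where "tight_frame E y (row_coherence A * CARD('d))" "card E \<le> CARD('d)"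
    "\<And>v. A *v v \<in> span E" "\<And>v j. y j \<bullet> (A *v v) = sqrt CARD('n) * (A *v v) $ j"
proof -
  define E where "E = (SOME B. is_onb B (colspace A))"
  have onb: "is_onb E (colspace A)" unfolding E_def by (rule someI_ex[OF is_onb_exists])
  have indep: "independent E"
    using onb by (intro pairwise_orthogonal_independent) (auto simp: is_onb_def)
  have finE: "finite E" using indep by (rule independent_imp_finite)
  have onE: "orthonormal_set E" using onb finE by (auto simp: is_onb_def orthonormal_set_def)
  define y where "y j = sqrt CARD('n) *\<^sub>R (\<Sum>u\<in>E. (u $ j) *\<^sub>R u)" for j
  have ys: "y j \<in> span E" for j unfolding y_def by (intro span_scale span_sum span_base)
  have yf: "y j \<bullet> f = sqrt CARD('n) * f $ j" if f: "f \<in> span E" for j f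
  proof -
    have "f = (\<Sum>u\<in>E. (f \<bullet> u) *\<^sub>R u)"
      using orthonormal_basis_expand[of E f] onE f by (simp add: orthonormal_set_def)
    then have "f $ j = (\<Sum>u\<in>E. (f \<bullet> u) *\<^sub>R u) $ j" by simp
    then show ?thesis by (simp add: y_def inner_sum_left inner_sum_right sum_component inner_commute mult.commute)
  qed
  have coh: "row_coherence A = CARD('n) / CARD('d) * Max (range (\<lambda>i. \<Sum>u\<in>E. (u$i)\<^sup>2))"
    by (simp add: row_coherence_def E_def Let_def)
  show ?thesis
  proof (rule that[of E y])
    show "tight_frame E y (row_coherence A * CARD('d))"
    proof
      fix j
      have "(norm (y j))\<^sup>2 = y j \<bullet> y j" by (simp add: dot_square_norm)
      also have "\<dots> = sqrt CARD('n) * y j $ j" by (rule yf[OF ys])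
      also have "\<dots> = CARD('n) * (\<Sum>u\<in>E. (u $ j)\<^sup>2)"
        by (simp add: y_def sum_component power2_eq_square flip: mult.assoc)
      also have "\<dots> \<le> CARD('n) * Max (range (\<lambda>i. \<Sum>u\<in>E. (u$i)\<^sup>2))"
        by (intro mult_left_mono Max_ge) auto
      also have "\<dots> = row_coherence A * CARD('d)" by (simp add: coh)
      finally show "(norm (y j))\<^sup>2 \<le> row_coherence A * CARD('d)" .
    next
      fix u v assume "u \<in> span E" "v \<in> span E"
      then have "(\<Sum>j\<in>UNIV. (y j \<bullet> u) * (y j \<bullet> v)) = (\<Sum>j\<in>UNIV. CARD('n) * (u $ j * v $ j))"
        by (intro sum.cong refl) (simp add: yf)
      then show "(\<Sum>j\<in>UNIV. (y j \<bullet> u) * (y j \<bullet> v)) = CARD('n) * (u \<bullet> v)"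
        by (simp add: inner_vec_def sum_distrib_left)
    qed (use onE ys pos in auto)
    have "card E = dim (colspace A)"
      using indep onb by (metis dim_span_eq_card_independent is_onb_def)
    also have "\<dots> \<le> dim (UNIV :: (real^'d) set)"
      unfolding colspace_def by (intro dim_image_le) (simp add: matrix_vector_mul_linear)
    finally show "card E \<le> CARD('d)" by simp
    show "A *v v \<in> span E" for v using onb by (auto simp: is_onb_def colspace_def)
    then show "y j \<bullet> (A *v v) = sqrt CARD('n) * (A *v v) $ j" for v j by (intro yf)
  qed
qed

section \<open>The robust Newton step\<close>

lemma posdef_matrix_inv:
  fixes M :: "real^'d^'d"
  assumes c: "c > 0" "\<And>v. c * (norm v)\<^sup>2 \<le> v \<bullet> (M *v v)"
  shows "M *v (matrix_inv M *v u) = u"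
proof -
  have "v = 0" if "M *v v = 0" for v
  proof -
    have "c * (norm v)\<^sup>2 \<le> 0" using c(2)[of v] that by simp
    then show ?thesis using c(1) by (simp add: mult_le_0_iff)
  qed
  then have "invertible M"
    by (simp add: invertible_left_inverse matrix_left_invertible_ker)
  then have "M ** matrix_inv M = mat 1"
    unfolding invertible_def matrix_inv_def by (rule someI_ex[THEN conjunct1])
  then show ?thesis by (simp add: matrix_vector_mul_assoc)
qed

text \<open>The Hessian error is applied to the exact gradient and the gradient error is inverted
  separately. For t <= 9/50 the factor 1 - 13/12 t is at least 4/5, whence 5/4, and 13/12 divided by
  it is below 27/20.\<close>

lemma approximate_Newton_direction:
  fixes H G :: "real^'d^'d"
  assumes H: "selfadj ((*v) H)" and c: "c > 0" "\<And>v. c * (norm v)\<^sup>2 \<le> v \<bullet> (H *v v)"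
    and G: "selfadj ((*v) G)" and t: "0 \<le> t" "t \<le> 9/50"
    and lo: "\<And>v. (1 - 13/12 * t) * (v \<bullet> (H *v v)) \<le> v \<bullet> (G *v v)"
    and up: "\<And>v. v \<bullet> (G *v v) \<le> (1 + 13/10 * t) * (v \<bullet> (H *v v))"
    and p: "H *v p = g"
  shows "norm (matrix_inv G *v g' - p) \<le> 27/20 * t * (sqrt (p \<bullet> (H *v p)) / sqrt c) + 5/4 * norm (g' - g) / c"
proof -
  have G45: "4/5 * c * (norm v)\<^sup>2 \<le> v \<bullet> (G *v v)" for v
  proof -
    have "0 \<le> v \<bullet> (H *v v)" using c by (meson mult_nonneg_nonneg less_imp_le order_trans zero_le_power2)
    then have "4/5 * (v \<bullet> (H *v v)) \<le> (1 - 13/12 * t) * (v \<bullet> (H *v v))"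
      using t by (intro mult_right_mono) auto
    then show ?thesis using c(2)[of v] lo[of v] by linarith
  qed
  have Gi: "G *v (matrix_inv G *v u) = u" for u
    by (rule posdef_matrix_inv[of "4/5 * c"]) (use c(1) G45 in auto)
  define e where "e = matrix_inv G *v (H *v p) - p"
  define d where "d = matrix_inv G *v (g' - g)"
  have "sqrt (e \<bullet> (H *v e)) \<le> 27/20 * t * sqrt (p \<bullet> (H *v p))"
    unfolding e_def
  proof (rule relative_inverse_bound[OF H c G matrix_vector_mul_linear Gi, where a = "13/12 * t" and a' = "13/10 * t"])
    have "0 \<le> t * (9/50 - t)" using t by simp
    then show "13/12 * t / (1 - 13/12 * t) \<le> 27/20 * t"
      using t by (simp add: field_simps)
    have "0 \<le> t * t" using t by simp
    then show "13/10 * t / (1 + 13/10 * t) \<le> 27/20 * t"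
      using t by (simp add: field_simps)
  qed (use t lo up in auto)
  then have "sqrt (e \<bullet> (H *v e)) / sqrt c \<le> 27/20 * t * sqrt (p \<bullet> (H *v p)) / sqrt c"
    using c(1) by (intro divide_right_mono) auto
  then have ne: "norm e \<le> 27/20 * t * (sqrt (p \<bullet> (H *v p)) / sqrt c)"
    using norm_le_form[of c e "(*v) H", OF c(1) c(2)] by simp
  have "(4/5 * c * norm d) * norm d \<le> norm d * norm (g' - g)"
    using G45[of d] norm_cauchy_schwarz[of d "g' - g"] Gi[of "g' - g"]
    by (simp add: d_def power2_eq_square mult.assoc)
  then have "4/5 * c * norm d \<le> norm (g' - g)"
    by (cases "d = 0") (auto simp: mult.commute mult_le_cancel_left)
  then have nd: "norm d \<le> 5/4 * norm (g' - g) / c" using c(1) by (simp add: field_simps)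
  have "matrix_inv G *v g' - p = e + d"
    by (simp add: e_def d_def p matrix_vector_mult_diff_distrib)
  then show ?thesis using ne nd norm_triangle_ineq[of e d] by simp
qed

text \<open>The deterministic part: on samples where every honest worker is accurate, the bound
  holds for all Byzantine vectors and every tie-breaking.\<close>

lemma robust_Newton_step:
  fixes l l1 l2 :: "'n::finite \<Rightarrow> real \<Rightarrow> real" and x :: "'n \<Rightarrow> real^'d::finite"
    and w wstar :: "real^'d" and r :: "nat \<Rightarrow> real^'d"
  assumes lam_pos: "lam > 0"
    and l_deriv: "\<And>j z. (l j has_real_derivative l1 j z) (at z)"
    and l1_deriv: "\<And>j z. (l1 j has_real_derivative l2 j z) (at z)"
    and l2_nonneg: "\<And>j z. 0 \<le> l2 j z"
    and wstar_min: "\<And>v. obj l x lam wstar \<le> obj l x lam v"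
    and Byz: "Byz \<subseteq> {..<m}" "real (card Byz) = \<alpha> * real m" and m_pos: "m > 0"
    and q: "real q = (1 - \<beta>) * real m"
    and \<alpha>\<beta>: "0 \<le> \<alpha>" "\<alpha> < \<beta>" "\<beta> < 1/2"
    and \<eta>: "0 < \<eta>" "\<eta> < 1"
    and hess_lip: "\<And>v v'. onorm (\<lambda>u. (hess l2 x lam v - hess l2 x lam v') *v u) \<le> L * norm (v - v')"
  defines "H \<equiv> hess l2 x lam w"
  defines "\<nu> \<equiv> nu_const (Amat l2 x w) lam"
  defines "Z \<equiv> zeta_byz2 \<alpha> \<beta> \<eta> m \<nu> (cond_num H)"
  assumes Z_lt1: "Z < 1"
    and G: "\<And>i. i < m \<Longrightarrow> i \<notin> Byz \<Longrightarrow> selfadj ((*v) (G i))"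
    and lo: "\<And>i v. i < m \<Longrightarrow> i \<notin> Byz \<Longrightarrow>
       (1 - 13/12 * \<eta>) * (v \<bullet> (H *v v) - lam * (norm v)\<^sup>2) \<le> v \<bullet> (G i *v v) - lam * (norm v)\<^sup>2"
    and up: "\<And>i v. i < m \<Longrightarrow> i \<notin> Byz \<Longrightarrow>
       v \<bullet> (G i *v v) - lam * (norm v)\<^sup>2 \<le> (1 + 13/10 * \<eta>) * (v \<bullet> (H *v v) - lam * (norm v)\<^sup>2)"
    and g: "\<And>i. i < m \<Longrightarrow> i \<notin> Byz \<Longrightarrow> norm (g i - grad l1 x lam w) \<le> 2 * t"
    and r: "\<And>i. i < m \<Longrightarrow> i \<notin> Byz \<Longrightarrow> r i = matrix_inv (G i) *v g i"
    and U: "valid_trim m q r U"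
  shows "norm ((w - (1 / real (card U)) *\<^sub>R (\<Sum>i\<in>U. r i)) - wstar)
    \<le> max (sqrt (cond_num H * (Z / (1 - Z))) * norm (w - wstar)) (L / sigma_min H * (norm (w - wstar))\<^sup>2)
      + 5/2 * t / sigma_min H"
proof -
  define \<Delta> where "\<Delta> = w - wstar"
  define c where "c = sigma_min H"
  define C where "C = sigma_max H"
  define K where "K = sqrt (C / c)"
  define \<theta> where "\<theta> = \<alpha> / (1 - \<beta>)"
  define b where "b = L * norm \<Delta> / c"
  define z where "z = 27/20 * (\<eta> * \<nu>)"
  note nu = nu_const_bounds[of l2 w x lam, OF l2_nonneg lam_pos, folded \<nu>_def H_def]
  have saH: "selfadj ((*v) H)"
    unfolding H_def hess_mult_vec[abs_def] by (rule selfadj_gram_op)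
  have Hform: "v \<bullet> (H *v v) = (\<Sum>j\<in>UNIV. l2 j (w \<bullet> x j) / CARD('n) * (x j \<bullet> v)\<^sup>2) + lam * (norm v)\<^sup>2" for v
    by (simp add: H_def hess_mult_vec gram_op_form)
  have Glam: "0 \<le> v \<bullet> (H *v v) - lam * (norm v)\<^sup>2" for v
    unfolding Hform using l2_nonneg by (auto intro!: sum_nonneg)
  have lamc: "lam \<le> c" unfolding c_def using Glam by (intro sigma_min_ge) simp
  have c0: "c > 0" using lamc lam_pos by simp
  have nnH: "0 \<le> v \<bullet> (H *v v)" for v
  proof -
    have "0 \<le> lam * (norm v)\<^sup>2" using lam_pos by simp
    then show ?thesis using Glam[of v] by linarith
  qed
  have cH: "c * (norm v)\<^sup>2 \<le> v \<bullet> (H *v v)" for v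
    unfolding c_def by (rule sigma_min_le_form[OF saH nnH])
  have CH: "v \<bullet> (H *v v) \<le> C * (norm v)\<^sup>2" for v
    unfolding C_def by (rule form_le_sigma_max)
  have \<kappa>: "cond_num H = C / c" by (simp add: cond_num_def C_def c_def)
  have "c \<le> C"
  proof -
    obtain u :: "real^'d" where "norm u = 1" using norm_axis_1 by blast
    then show ?thesis using cH[of u] CH[of u] by simp
  qed
  then have \<kappa>1: "1 \<le> C / c" using c0 by simp
  have K1: "K \<ge> 1" using \<kappa>1 by (simp add: K_def)
  have K2: "K\<^sup>2 = C / c" using \<kappa>1 by (simp add: K_def)
  have K\<nu>: "K\<^sup>2 * (1 - \<nu>) \<le> 1"
    unfolding K2 using nu(4) lamc c0 by (simp add: C_def field_simps)
  have \<theta>01: "0 \<le> \<theta>" "\<theta> \<le> 1" using \<alpha>\<beta> by (auto simp: \<theta>_def field_simps)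
  have Zle: "2 * (\<nu> / (1 - \<eta>))\<^sup>2 + 2 * (2 * K * \<theta>)\<^sup>2 \<le> Z"
  proof -
    have "1 \<le> (1 - \<alpha>) / (1 - \<beta>)" using \<alpha>\<beta> by (simp add: field_simps)
    then have "1 \<le> ((1 - \<alpha>) / (1 - \<beta>))\<^sup>2" by (rule one_le_power)
    then have "1 * (\<nu> / (1 - \<eta>))\<^sup>2 \<le> ((1 - \<alpha>) / (1 - \<beta>))\<^sup>2 * (\<nu> / (1 - \<eta>))\<^sup>2"
      by (intro mult_right_mono) auto
    moreover have "0 \<le> \<nu>\<^sup>2 * ((1 - \<alpha>) / (1 - \<beta>))\<^sup>2 * (\<eta> / sqrt ((1 - \<alpha>) * real m) + \<eta>\<^sup>2 / (1 - \<eta>))\<^sup>2"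
      by simp
    moreover have "0 \<le> 4 * (C / c) * \<theta>\<^sup>2 * (\<nu> / (1 - \<eta>))\<^sup>2" using \<kappa>1 by (intro mult_nonneg_nonneg) auto
    moreover have "2 * (2 * K * \<theta>)\<^sup>2 = 4 * (C / c) * \<theta>\<^sup>2 * 2" by (simp add: power_mult_distrib K2)
    ultimately show ?thesis
      unfolding Z_def zeta_byz2_def \<kappa> \<theta>_def[symmetric] distrib_left by (simp only: mult.assoc)
  qed
  \<comment> \<open>Z < 1 gives \<nu> <= 71/100 (1 - \<eta>), and \<eta> (1 - \<eta>) <=
    1/4.\<close>
  have t_le: "\<eta> * \<nu> \<le> 9/50"
  proof -
    have "(71/100)\<^sup>2 = (5041/10000 :: real)" by (simp add: power2_eq_square)
    then have "(\<nu> / (1 - \<eta>))\<^sup>2 \<le> (71/100)\<^sup>2"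
      using Zle Z_lt1 zero_le_power2[of "2 * K * \<theta>"] by linarith
    then have "\<nu> / (1 - \<eta>) \<le> 71/100" by (rule power2_le_imp_le) simp
    then have "\<nu> \<le> 71/100 * (1 - \<eta>)" using \<eta> by (simp add: field_simps)
    then have "\<eta> * \<nu> \<le> \<eta> * (71/100 * (1 - \<eta>))" using \<eta> by (intro mult_left_mono) auto
    also have "\<dots> \<le> 9/50"
      using zero_le_power2[of "\<eta> - 1/2"] by (simp add: power2_eq_square field_simps)
    finally show ?thesis .
  qed
  have t0: "0 \<le> \<eta> * \<nu>" using \<eta> nu(1) by simp
  have L\<Delta>: "0 \<le> L * norm \<Delta>"
    using hess_lip[of w wstar] onorm_pos_le[OF matrix_vector_mul_bounded_linear] unfolding \<Delta>_def
    by (meson order_trans)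
  have b0: "b \<ge> 0" using L\<Delta> c0 by (simp add: b_def)
  have bc: "b * c = L * norm \<Delta>" using c0 by (simp add: b_def)

  obtain h where h:
    "grad l1 x lam w - grad l1 x lam wstar = gram_op UNIV (\<lambda>j. h j / CARD('n)) x lam \<Delta>"
    "\<And>v. \<bar>v \<bullet> (H *v v) - v \<bullet> gram_op UNIV (\<lambda>j. h j / CARD('n)) x lam v\<bar> \<le> L * norm \<Delta> / 2 * (norm v)\<^sup>2"
    "\<And>v. v \<bullet> (H *v v) - v \<bullet> gram_op UNIV (\<lambda>j. h j / CARD('n)) x lam v
        \<le> (v \<bullet> (H *v v) - lam * (norm v)\<^sup>2) / 2 + L * norm \<Delta> / 8 * (norm v)\<^sup>2"
    using averaged_Hessian[of l1 l2 x lam L w wstar, OF l1_deriv l2_nonneg hess_lip]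
    unfolding H_def \<Delta>_def by blast
  define Hb where "Hb = gram_op UNIV (\<lambda>j. h j / CARD('n)) x lam"
  have gw: "grad l1 x lam w = Hb \<Delta>"
    using h(1) grad_eq_0_at_minimizer[OF l_deriv wstar_min] by (simp add: Hb_def)
  define p where "p = matrix_inv H *v grad l1 x lam w"
  have Hp: "H *v p = grad l1 x lam w" unfolding p_def by (rule posdef_matrix_inv[OF c0 cH])
  have saHb: "selfadj Hb" unfolding Hb_def by (rule selfadj_gram_op)
  have up': "v \<bullet> (H *v v) - v \<bullet> Hb v \<le> \<nu> / 2 * (v \<bullet> (H *v v)) + b / 8 * c * (norm v)\<^sup>2" for v
  proof -
    have "b / 8 * c = L * norm \<Delta> / 8" by (simp add: bc)
    then show ?thesis using h(3)[of v] nu(3)[of v] unfolding Hb_def by simp argo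
  qed
  have ab': "\<bar>v \<bullet> (H *v v) - v \<bullet> Hb v\<bar> \<le> b / 2 * c * (norm v)\<^sup>2" for v
    using h(2)[of v] by (simp add: Hb_def bc)
  have N: "norm (\<Delta> - (1 - \<theta>) *\<^sub>R p) \<le>
      K * max ((1 - \<theta>) * b / 2 - \<theta>) (\<theta> + (1 - \<theta>) * (\<nu> / 2 + b / 8)) * norm \<Delta>"
    "norm p \<le> (1 + b / 2) * norm \<Delta>"
    "sqrt (p \<bullet> (H *v p)) / sqrt c \<le> (K + b / 2) * norm \<Delta>"
    unfolding K_def
    using Newton_direction_bounds[OF saH saHb c0 cH CH nu(1) b0 up' ab' _ \<theta>01, of p \<Delta>] Hp gw by auto

  define e where "e = z * (sqrt (p \<bullet> (H *v p)) / sqrt c) + 5/2 * t / c"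
  have good: "norm (r i - p) \<le> e" if i: "i < m" "i \<notin> Byz" for i
  proof -
    have "norm (matrix_inv (G i) *v g i - p) \<le>
        27/20 * (\<eta> * \<nu>) * (sqrt (p \<bullet> (H *v p)) / sqrt c) + 5/4 * norm (g i - grad l1 x lam w) / c"
    proof (rule approximate_Newton_direction[OF saH c0 cH G[OF i] t0 t_le])
      fix v
      have "13/12 * \<eta> * (v \<bullet> (H *v v) - lam * (norm v)\<^sup>2) \<le> 13/12 * \<eta> * (\<nu> * (v \<bullet> (H *v v)))"
        using \<eta> nu(3)[of v] by (intro mult_left_mono) auto
      then show "(1 - 13/12 * (\<eta> * \<nu>)) * (v \<bullet> (H *v v)) \<le> v \<bullet> (G i *v v)"
        using lo[OF i, of v] by (simp add: algebra_simps)
      have "13/10 * \<eta> * (v \<bullet> (H *v v) - lam * (norm v)\<^sup>2) \<le> 13/10 * \<eta> * (\<nu> * (v \<bullet> (H *v v)))"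
        using \<eta> nu(3)[of v] by (intro mult_left_mono) auto
      then show "v \<bullet> (G i *v v) \<le> (1 + 13/10 * (\<eta> * \<nu>)) * (v \<bullet> (H *v v))"
        using up[OF i, of v] by (simp add: algebra_simps)
    qed (rule Hp)
    also have "5/4 * norm (g i - grad l1 x lam w) / c \<le> 5/4 * (2 * t) / c"
      using g[OF i] c0 by (intro divide_right_mono mult_left_mono) auto
    finally show ?thesis unfolding r[OF i] e_def z_def by simp
  qed
  have U': "U \<subseteq> {..<m}" "card U = q" "\<And>i j. i \<in> U \<Longrightarrow> j < m \<Longrightarrow> j \<notin> U \<Longrightarrow> norm (r i) \<le> norm (r j)"
    using U by (auto simp: valid_trim_def)
  have finU: "finite U" using U'(1) finite_subset by blast
  have q0: "q > 0"
  proof -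
    have "0 < (1 - \<beta>) * real m" using \<alpha>\<beta> m_pos by simp
    then show ?thesis using q by simp
  qed
  \<comment> \<open>U and the Byzantine workers together number (1 - \<beta> + \<alpha>) m < m, so
    some honest worker is trimmed; its vector is at least as long as every retained one.\<close>
  have "\<exists>j<m. j \<notin> U \<and> j \<notin> Byz"
  proof (rule ccontr)
    assume "\<not> ?thesis"
    then have "{..<m} \<subseteq> U \<union> Byz" by auto
    then have "card {..<m} \<le> card (U \<union> Byz)"
      using finU finite_subset[OF Byz(1)] by (intro card_mono) auto
    also have "\<dots> \<le> q + card Byz" using card_Un_le[of U Byz] U'(2) by simp
    finally have "real m \<le> real q + real (card Byz)" by simp
    moreover have "\<alpha> * real m < \<beta> * real m" using \<alpha>\<beta> m_pos by simp
    ultimately show False using q Byz(2) by (simp add: algebra_simps)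
  qed
  then obtain j0 where j0: "j0 < m" "j0 \<notin> U" "j0 \<notin> Byz" by blast
  have bad: "norm (r i) \<le> norm p + e" if "i \<in> U \<inter> Byz" for i
  proof -
    have "norm (r i) \<le> norm (r j0)" using that j0 by (intro U'(3)) auto
    also have "\<dots> \<le> norm p + norm (r j0 - p)" using norm_triangle_ineq[of p "r j0 - p"] by simp
    finally show ?thesis using good[OF j0(1,3)] by simp
  qed
  have "real (card (U \<inter> Byz)) \<le> real (card Byz)"
    using finite_subset[OF Byz(1)] by (intro of_nat_mono card_mono) auto
  also have "\<dots> = \<theta> * real (card U)" using Byz(2) q U'(2) \<alpha>\<beta> by (simp add: \<theta>_def)
  finally have cardB: "real (card (U \<inter> Byz)) \<le> \<theta> * real (card U)" .
  have "norm (\<Delta> - (1 / real (card U)) *\<^sub>R (\<Sum>i\<in>U. r i)) \<le> norm (\<Delta> - (1 - \<theta>) *\<^sub>R p) + \<theta> * norm p + e"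
    using U' q0 by (intro trimmed_mean_error[OF finU _ _ bad cardB] good) auto
  also have "\<dots> \<le> (K * max ((1 - \<theta>) * b / 2 - \<theta>) (\<theta> + (1 - \<theta>) * (\<nu> / 2 + b / 8)) + \<theta> * (1 + b / 2)
      + z * (K + b / 2)) * norm \<Delta> + 5/2 * t / c"
  proof -
    have "\<theta> * norm p \<le> \<theta> * (1 + b / 2) * norm \<Delta>"
      using mult_left_mono[OF N(2) \<theta>01(1)] by (simp add: mult.assoc)
    moreover have "z * (sqrt (p \<bullet> (H *v p)) / sqrt c) \<le> z * (K + b / 2) * norm \<Delta>"
      using mult_left_mono[OF N(3), of z] t0 by (simp add: z_def mult.assoc)
    ultimately show ?thesis using N(1) unfolding e_def distrib_right by linarith
  qed
  also have "\<dots> \<le> max (K * sqrt (Z / (1 - Z))) b * norm \<Delta> + 5/2 * t / c"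
    using contraction_bound[OF \<eta> nu(1) K1 K\<nu> \<theta>01(1) _ _ Zle Z_lt1 b0, of z] t0
    by (intro add_right_mono mult_right_mono) (auto simp: z_def)
  also have "max (K * sqrt (Z / (1 - Z))) b * norm \<Delta> =
      max (sqrt (cond_num H * (Z / (1 - Z))) * norm \<Delta>) (L / c * (norm \<Delta>)\<^sup>2)"
  proof -
    have "K * sqrt (Z / (1 - Z)) = sqrt (cond_num H * (Z / (1 - Z)))"
      unfolding \<kappa> K_def by (rule real_sqrt_mult[symmetric])
    moreover have "b * norm \<Delta> = L / c * (norm \<Delta>)\<^sup>2" by (simp add: b_def power2_eq_square)
    ultimately show ?thesis by (simp add: max_mult_distrib_right)
  qed
  finally show ?thesis unfolding \<Delta>_def c_def by (simp add: algebra_simps)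
qed

text \<open>The deviations \<open>13/10 \<eta>\<close> and \<open>13/12 \<eta>\<close> exceed \<open>\<eta>\<close>, so that both Chernoff
  exponents are at least \<open>7/4\<close> instead of \<open>1\<close>. This pays for the union bound over the three
  failure modes of a worker, because trimming forces \<open>m \<ge> 3\<close>.\<close>

lemma worker_Hessian_failure:
  fixes l2 :: "'n::finite \<Rightarrow> real \<Rightarrow> real" and x :: "'n \<Rightarrow> real^'d::finite"
    and s :: nat and w :: "real^'d" and lam :: real
  defines "\<mu> \<equiv> row_coherence (Amat l2 x w)" and "Q \<equiv> \<lambda>v. v \<bullet> (hess l2 x lam w *v v) - lam * (norm v)\<^sup>2"
    and "QS \<equiv> \<lambda>S v. v \<bullet> (loc_hess l2 x lam s S w *v v) - lam * (norm v)\<^sup>2"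
  assumes l2: "\<And>j z. 0 \<le> l2 j z" and \<mu>: "\<mu> > 0" and \<eta>: "0 < \<eta>" "\<eta> < 1"
    and \<Lambda>: "\<Lambda> > 0" and s: "real s \<ge> 3 * \<mu> * real CARD('d) / \<eta>\<^sup>2 * \<Lambda>"
  shows "measure_pmf.prob (iid_uniform s) {S. \<exists>v. (1 + 13/10 * \<eta>) * Q v < QS S v} \<le> CARD('d) * exp (- (7/4 * \<Lambda>))"
    and "measure_pmf.prob (iid_uniform s) {S. \<exists>v. QS S v < (1 - 13/12 * \<eta>) * Q v} \<le> CARD('d) * exp (- (7/4 * \<Lambda>))"
proof -
  define A where "A = Amat l2 x w"
  define R where "R = \<mu> * CARD('d)"
  have pos: "row_coherence A > 0" and R: "R = row_coherence A * CARD('d)"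
    using \<mu> by (simp_all add: \<mu>_def A_def R_def)
  obtain E y where fr: "tight_frame E y R" and cE: "card E \<le> CARD('d)"
    and AE: "\<And>v. A *v v \<in> span E" and yA: "\<And>v j. y j \<bullet> (A *v v) = sqrt CARD('n) * (A *v v) $ j"
    by (rule row_coherence_frame[OF pos]) (simp only: R)
  interpret tight_frame E y R by (rule fr)
  have "0 < 3 * \<mu> * real CARD('d) / \<eta>\<^sup>2 * \<Lambda>" using \<mu> \<eta> \<Lambda> by simp
  then have s0: "s > 0" using s by simp
  have sR: "3 * \<Lambda> / \<eta>\<^sup>2 \<le> s / R"
  proof -
    have "3 * \<Lambda> / \<eta>\<^sup>2 * R \<le> s" using s by (simp add: R_def mult.commute mult.left_commute)
    then show ?thesis using R_pos by (simp add: pos_le_divide_eq)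
  qed
  \<comment> \<open>Without the ridge term both quadratic forms depend on v only through f = A v,
    which lies in the span of the frame.\<close>
  have Qf: "CARD('n) * Q v = (norm (A *v v))\<^sup>2" for v
    unfolding Q_def hess_mult_vec gram_op_form A_def Amat_gram_form[of l2 w x, OF l2]
    by (simp add: sum_distrib_left)
  have Qf': "CARD('n) * (s * QS S v) = (\<Sum>k<s. (y (S k) \<bullet> (A *v v))\<^sup>2)" for S v
    unfolding QS_def loc_hess_mult_vec gram_op_form yA
    using s0 l2 by (simp add: sum_distrib_left A_def Amat_nth power_mult_distrib)
  have cEe: "card E * exp (- u) \<le> CARD('d) * exp (- (7/4 * \<Lambda>))" if "7/4 * \<Lambda> \<le> u" for u
    using cE that by (intro mult_mono) auto
  have "measure_pmf.prob (iid_uniform s) {S. \<exists>v. (1 + 13/10 * \<eta>) * Q v < QS S v}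
      \<le> measure_pmf.prob (iid_uniform s)
        {S. \<exists>f\<in>span E. (1 + 13/10 * \<eta>) * real s * (norm f)\<^sup>2 < (\<Sum>k<s. (y (S k) \<bullet> f)\<^sup>2)}"
  proof (rule measure_pmf.finite_measure_mono)
    show "{S. \<exists>v. (1 + 13/10 * \<eta>) * Q v < QS S v} \<subseteq>
        {S. \<exists>f\<in>span E. (1 + 13/10 * \<eta>) * real s * (norm f)\<^sup>2 < (\<Sum>k<s. (y (S k) \<bullet> f)\<^sup>2)}"
    proof
      fix S assume "S \<in> {S. \<exists>v. (1 + 13/10 * \<eta>) * Q v < QS S v}"
      then obtain v where "(1 + 13/10 * \<eta>) * Q v < QS S v" by blast
      then have "CARD('n) * (s * ((1 + 13/10 * \<eta>) * Q v)) < CARD('n) * (s * QS S v)" using s0 by simp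
      moreover have "CARD('n) * (s * ((1 + 13/10 * \<eta>) * Q v)) = (1 + 13/10 * \<eta>) * real s * (CARD('n) * Q v)"
        by (simp only: ac_simps)
      ultimately have "(1 + 13/10 * \<eta>) * real s * (norm (A *v v))\<^sup>2 < (\<Sum>k<s. (y (S k) \<bullet> (A *v v))\<^sup>2)"
        by (simp only: Qf Qf')
      then show "S \<in> {S. \<exists>f\<in>span E. (1 + 13/10 * \<eta>) * real s * (norm f)\<^sup>2 < (\<Sum>k<s. (y (S k) \<bullet> f)\<^sup>2)}"
        using AE[of v] by blast
    qed
  qed simp
  also have "\<dots> \<le> card E * exp (- (s / R * ((13/10 * \<eta>)\<^sup>2 / (2 + 2 * (13/10 * \<eta>) / 3))))"
    using \<eta> by (intro chernoff_upper) auto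
  also have "\<dots> \<le> CARD('d) * exp (- (7/4 * \<Lambda>))"
  proof (rule cEe)
    \<comment> \<open>The worst case is \<eta> = 1, where 3 (13/10)^2 / (2 + 13/15) is just above
      7/4.\<close>
    have "7/4 * \<Lambda> \<le> (3 * \<Lambda> / \<eta>\<^sup>2) * ((13/10 * \<eta>)\<^sup>2 / (2 + 2 * (13/10 * \<eta>) / 3))"
      using \<eta> \<Lambda> by (simp add: field_simps power2_eq_square)
    also have "\<dots> \<le> s / R * ((13/10 * \<eta>)\<^sup>2 / (2 + 2 * (13/10 * \<eta>) / 3))"
      using \<eta> by (intro mult_right_mono sR) auto
    finally show "7/4 * \<Lambda> \<le> s / R * ((13/10 * \<eta>)\<^sup>2 / (2 + 2 * (13/10 * \<eta>) / 3))" .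
  qed
  finally show "measure_pmf.prob (iid_uniform s) {S. \<exists>v. (1 + 13/10 * \<eta>) * Q v < QS S v}
      \<le> CARD('d) * exp (- (7/4 * \<Lambda>))" .
  have sub: "{S. \<exists>v. QS S v < (1 - 13/12 * \<eta>) * Q v} \<subseteq>
      {S. \<exists>f\<in>span E. (\<Sum>k<s. (y (S k) \<bullet> f)\<^sup>2) < (1 - 13/12 * \<eta>) * real s * (norm f)\<^sup>2}"
  proof
    fix S assume "S \<in> {S. \<exists>v. QS S v < (1 - 13/12 * \<eta>) * Q v}"
    then obtain v where "QS S v < (1 - 13/12 * \<eta>) * Q v" by blast
    then have "CARD('n) * (s * QS S v) < CARD('n) * (s * ((1 - 13/12 * \<eta>) * Q v))" using s0 by simp
    moreover have "CARD('n) * (s * ((1 - 13/12 * \<eta>) * Q v)) = (1 - 13/12 * \<eta>) * real s * (CARD('n) * Q v)"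
      by (simp only: ac_simps)
    ultimately have "(\<Sum>k<s. (y (S k) \<bullet> (A *v v))\<^sup>2) < (1 - 13/12 * \<eta>) * real s * (norm (A *v v))\<^sup>2"
      by (simp only: Qf Qf')
    then show "S \<in> {S. \<exists>f\<in>span E. (\<Sum>k<s. (y (S k) \<bullet> f)\<^sup>2) < (1 - 13/12 * \<eta>) * real s * (norm f)\<^sup>2}"
      using AE[of v] by blast
  qed
  show "measure_pmf.prob (iid_uniform s) {S. \<exists>v. QS S v < (1 - 13/12 * \<eta>) * Q v} \<le> CARD('d) * exp (- (7/4 * \<Lambda>))"
  proof (cases "13/12 * \<eta> \<le> 1")
    case True
    have "measure_pmf.prob (iid_uniform s) {S. \<exists>v. QS S v < (1 - 13/12 * \<eta>) * Q v}
        \<le> measure_pmf.prob (iid_uniform s)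
          {S. \<exists>f\<in>span E. (\<Sum>k<s. (y (S k) \<bullet> f)\<^sup>2) < (1 - 13/12 * \<eta>) * real s * (norm f)\<^sup>2}"
      by (rule measure_pmf.finite_measure_mono[OF sub]) simp
    also have "\<dots> \<le> card E * exp (- (s / R * ((13/12 * \<eta>)\<^sup>2 / 2)))"
      using \<eta> True by (intro chernoff_lower) auto
    also have "\<dots> \<le> CARD('d) * exp (- (7/4 * \<Lambda>))"
    proof (rule cEe)
      \<comment> \<open>3 (13/12)^2 / 2 is just above 7/4.\<close>
      have "7/4 * \<Lambda> \<le> (3 * \<Lambda> / \<eta>\<^sup>2) * ((13/12 * \<eta>)\<^sup>2 / 2)"
        using \<eta> \<Lambda> by (simp add: field_simps power2_eq_square)
      also have "\<dots> \<le> s / R * ((13/12 * \<eta>)\<^sup>2 / 2)"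
        by (intro mult_right_mono sR) auto
      finally show "7/4 * \<Lambda> \<le> s / R * ((13/12 * \<eta>)\<^sup>2 / 2)" .
    qed
    finally show ?thesis .
  next
    case False
    \<comment> \<open>With 1 - 13/12 \<eta> negative the failure event is empty, as a sum of squares
      is nonnegative.\<close>
    have "0 \<le> (\<Sum>k<s. (y (S k) \<bullet> f)\<^sup>2)" for S f by (intro sum_nonneg) auto
    moreover have "(1 - 13/12 * \<eta>) * real s * (norm f)\<^sup>2 \<le> 0" for f :: "real^'n"
      using False by (intro mult_nonpos_nonneg) auto
    ultimately have "\<not> (\<Sum>k<s. (y (S k) \<bullet> f)\<^sup>2) < (1 - 13/12 * \<eta>) * real s * (norm f)\<^sup>2" for S f
      by (meson not_less order_trans)
    then have "{S. \<exists>v. QS S v < (1 - 13/12 * \<eta>) * Q v} = {}"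
      using sub by blast
    then show ?thesis by simp
  qed
qed

text \<open>Doubling the deviation makes 2 (1 + a) = 1 + (1 + 2 a), so the Hoeffding parameter is 1
  + 2 a and its exponent at least 2 a^2 = 4 ln (1 / u). The price is a factor 2 in the gradient
  error, for which \<epsilon>_byz has room.\<close>

lemma worker_gradient_failure:
  fixes l1 :: "'n::finite \<Rightarrow> real \<Rightarrow> real" and x :: "'n \<Rightarrow> real^'d::finite" and s :: nat
  assumes s: "s > 0" and m: "0 < u" "u < 1"
  shows "measure_pmf.prob (iid_uniform s)
      {S. 2 * ((1 + sqrt (2 * ln (1 / u))) * sqrt (1 / s) * Max (range (\<lambda>j. norm (bvec l1 x w j))))
          < norm (loc_grad l1 x lam s S w - grad l1 x lam w)} \<le> u ^ 4"
proof -
  define B where "B = Max (range (\<lambda>j. norm (bvec l1 x w j)))"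
  define a where "a = sqrt (2 * ln (1 / u))"
  have ln: "ln (1 / u) > 0" using m by (simp add: ln_div)
  have a0: "a > 0" and a2: "a\<^sup>2 = 2 * ln (1 / u)" using ln by (auto simp: a_def)
  have "measure_pmf.prob (iid_uniform s) {S. B / sqrt s * (1 + (1 + 2 * a)) <
      norm ((1 / real s) *\<^sub>R (\<Sum>i<s. bvec l1 x w (S i)) - (1 / real CARD('n)) *\<^sub>R (\<Sum>j\<in>UNIV. bvec l1 x w j))}
     \<le> exp (- (1 + 2 * a)\<^sup>2 / 2)"
    using a0 s by (intro vector_Hoeffding) (auto simp: B_def)
  also have "\<dots> \<le> exp (- (4 * ln (1 / u)))"
    using a0 a2 by (simp add: power2_eq_square algebra_simps)
  also have "\<dots> = u ^ 4"
  proof -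
    have "- (4 * ln (1 / u)) = ln (u ^ 4)" using m by (simp add: ln_div ln_realpow)
    then show ?thesis using m by (simp only: exp_ln zero_less_power)
  qed
  also have "{S. B / sqrt s * (1 + (1 + 2 * a)) <
      norm ((1 / real s) *\<^sub>R (\<Sum>i<s. bvec l1 x w (S i)) - (1 / real CARD('n)) *\<^sub>R (\<Sum>j\<in>UNIV. bvec l1 x w j))}
    = {S. 2 * ((1 + a) * sqrt (1 / s) * B) < norm (loc_grad l1 x lam s S w - grad l1 x lam w)}"
    by (simp add: loc_grad_def grad_def bvec_def real_sqrt_divide field_simps)
  finally show ?thesis by (simp add: a_def B_def)
qed

theorem theorem2:
  fixes l l1 l2 :: "'n::finite \<Rightarrow> real \<Rightarrow> real"
    and x :: "'n \<Rightarrow> real^'d::finite"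
    and lam :: real and w wstar :: "real^'d"
    and m s :: nat and \<alpha> \<beta> \<eta> \<delta> \<mu> L :: real
    and Byz :: "nat set"
  assumes lam_pos: "lam > 0"
    and l_deriv: "\<forall>j z. (l j has_real_derivative l1 j z) (at z)"
    and l1_deriv: "\<forall>j z. (l1 j has_real_derivative l2 j z) (at z)"
    and l_convex: "\<forall>j. convex_on UNIV (l j)"
    and l_smooth: "\<forall>j. \<exists>K. \<forall>a b. \<bar>l1 j a - l1 j b\<bar> \<le> K * \<bar>a - b\<bar>"
    and wstar_min: "\<forall>v. obj l x lam wstar \<le> obj l x lam v"
    and m_pos: "m > 0"
    and Byz: "Byz \<subseteq> {..<m}" "real (card Byz) = \<alpha> * real m"
    and trim_int: "(1 - \<beta>) * real m \<in> \<nat>"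
    and \<alpha>\<beta>: "0 \<le> \<alpha>" "\<alpha> < \<beta>" "\<beta> < 1/2"
    and \<eta>: "0 < \<eta>" "\<eta> < 1"
    and \<delta>: "0 < \<delta>" "\<delta> < 1"
    and \<mu>: "\<mu> = row_coherence (Amat l2 x w)" "1 \<le> \<mu>" "\<mu> \<le> real CARD('n) / real CARD('d)"
    and s_large: "real s \<ge> 3 * \<mu> * real CARD('d) / \<eta>^2 * ln (real m * real CARD('d) / \<delta>)"
    and hess_lip: "\<forall>v v'. onorm (\<lambda>u. (hess l2 x lam v - hess l2 x lam v') *v u) \<le> L * norm (v - v')"
    and \<zeta>_lt1: "zeta_byz2 \<alpha> \<beta> \<eta> m (nu_const (Amat l2 x w) lam) (cond_num (hess l2 x lam w)) < 1"
  shows "let H = hess l2 x lam w; smin = sigma_min H; \<kappa> = cond_num H;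
             \<nu> = nu_const (Amat l2 x w) lam;
             \<epsilon> = eps_const \<eta> smin \<delta> m s (Max (range (\<lambda>j. norm (bvec l1 x w j))));
             \<epsilon>2 = eps_byz2 \<alpha> \<beta> \<kappa> \<epsilon>;
             \<zeta>2 = zeta_byz2 \<alpha> \<beta> \<eta> m \<nu> \<kappa>;
             q = nat \<lfloor>(1 - \<beta>) * real m\<rfloor>
         in measure_pmf.prob (sample_pmf m s)
           {\<omega>. \<forall>(v::nat \<Rightarrow> real^'d) U. valid_trim m q (recv l1 l2 x lam s w Byz \<omega> v) U \<longrightarrow>
                 norm ((w - (1 / real (card U)) *\<^sub>R (\<Sum>i\<in>U. recv l1 l2 x lam s w Byz \<omega> v i)) - wstar)
                 \<le> max (sqrt (\<kappa> * (\<zeta>2 / (1 - \<zeta>2))) * norm (w - wstar))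
                         (L / smin * (norm (w - wstar))^2)
                   + 2 * sqrt \<epsilon>2 / sqrt smin}
           > 1 - \<delta>"
proof -
  define H where "H = hess l2 x lam w"
  define c where "c = sigma_min H"
  define \<nu> where "\<nu> = nu_const (Amat l2 x w) lam"
  define B where "B = Max (range (\<lambda>j. norm (bvec l1 x w j)))"
  define t where "t = (1 + sqrt (2 * ln (real m / \<delta>))) * sqrt (1 / real s) * B"
  define q where "q = nat \<lfloor>(1 - \<beta>) * real m\<rfloor>"
  define Z where "Z = zeta_byz2 \<alpha> \<beta> \<eta> m \<nu> (cond_num H)"
  define \<epsilon> where "\<epsilon> = eps_const \<eta> c \<delta> m s B"
  \<comment> \<open>The Byzantine vectors are quantified inside the event, so they may depend on all
    samples.\<close>
  define Good where "Good = {\<omega>. \<forall>v U. valid_trim m q (recv l1 l2 x lam s w Byz \<omega> v) U \<longrightarrow>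
      norm ((w - (1 / real (card U)) *\<^sub>R (\<Sum>i\<in>U. recv l1 l2 x lam s w Byz \<omega> v i)) - wstar)
      \<le> max (sqrt (cond_num H * (Z / (1 - Z))) * norm (w - wstar)) (L / c * (norm (w - wstar))^2)
        + 2 * sqrt (eps_byz2 \<alpha> \<beta> (cond_num H) \<epsilon>) / sqrt c}"
  define Q where "Q v = v \<bullet> (H *v v) - lam * (norm v)\<^sup>2" for v
  define QS where "QS S v = v \<bullet> (loc_hess l2 x lam s S w *v v) - lam * (norm v)\<^sup>2" for S v
  define bad1 where "bad1 S \<longleftrightarrow> (\<exists>v. (1 + 13/10 * \<eta>) * Q v < QS S v)" for S
  define bad2 where "bad2 S \<longleftrightarrow> (\<exists>v. QS S v < (1 - 13/12 * \<eta>) * Q v)" for S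
  define bad3 where "bad3 S \<longleftrightarrow> 2 * t < norm (loc_grad l1 x lam s S w - grad l1 x lam w)" for S

  have l2: "0 \<le> l2 j z" for j z
    using l_convex l_deriv l1_deriv by (intro convex_second_derivative_nonneg[of "l j" "l1 j" "l2 j z" z]) auto
  have lip: "onorm (\<lambda>u. (hess l2 x lam v - hess l2 x lam v') *v u) \<le> L * norm (v - v')" for v v'
    using hess_lip by blast
  have q: "real q = (1 - \<beta>) * real m"
    using trim_int by (auto simp: q_def Nats_def)
  have m3: "m \<ge> 3"
  proof -
    \<comment> \<open>The integer q lies strictly between m / 2 and m, which excludes m = 1 and m =
      2.\<close>
    have "real m / 2 < real q" "real q < real m" unfolding q using \<alpha>\<beta> m_pos by (auto simp: field_simps)
    then have "real m < real (2 * q)" "q < m" by auto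
    then have "m < 2 * q" by (simp only: of_nat_less_iff)
    then show ?thesis using \<open>q < m\<close> by linarith
  qed
  define \<Lambda> where "\<Lambda> = ln (real m * real CARD('d) / \<delta>)"
  have md: "3 \<le> real m * real CARD('d) / \<delta>" "3 \<le> real m / \<delta>"
  proof -
    have "1 \<le> real CARD('d)" by (simp add: Suc_le_eq)
    then have "3 * 1 \<le> real m * real CARD('d)" using m3 by (intro mult_mono) auto
    moreover have "a \<le> a / \<delta>" if "0 \<le> a" for a
      using that \<delta> mult_right_mono[of \<delta> 1 a] by (simp add: pos_le_divide_eq mult.commute)
    from this[of "real m * real CARD('d)"] this[of "real m"]
    have "real m * real CARD('d) \<le> real m * real CARD('d) / \<delta>" "real m \<le> real m / \<delta>" by auto
    ultimately show "3 \<le> real m * real CARD('d) / \<delta>" "3 \<le> real m / \<delta>" using m3 by linarith+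
  qed
  have \<Lambda>0: "\<Lambda> > 0" unfolding \<Lambda>_def using md(1) by (intro ln_gt_zero) auto
  have s0: "s > 0"
  proof -
    have "0 < 3 * \<mu> * real CARD('d) / \<eta>^2 * \<Lambda>" using \<mu>(2) \<eta> \<Lambda>0 by simp
    then show ?thesis using s_large by (simp add: \<Lambda>_def)
  qed

  have Good: "\<omega> \<in> Good"
    if g: "\<And>i. i < m \<Longrightarrow> \<not> bad1 (\<lambda>k. \<omega> (i, k)) \<and> \<not> bad2 (\<lambda>k. \<omega> (i, k)) \<and> \<not> bad3 (\<lambda>k. \<omega> (i, k))" for \<omega>
    unfolding Good_def
  proof (intro CollectI allI impI)
    fix v U assume U: "valid_trim m q (recv l1 l2 x lam s w Byz \<omega> v) U"
    have "norm ((w - (1 / real (card U)) *\<^sub>R (\<Sum>i\<in>U. recv l1 l2 x lam s w Byz \<omega> v i)) - wstar)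
      \<le> max (sqrt (cond_num H * (Z / (1 - Z))) * norm (w - wstar)) (L / c * (norm (w - wstar))^2) + 5/2 * t / c"
      unfolding H_def Z_def \<nu>_def c_def
    proof (rule robust_Newton_step[OF lam_pos _ _ l2 _ Byz m_pos q \<alpha>\<beta> \<eta> lip \<zeta>_lt1, where
          G = "\<lambda>i. loc_hess l2 x lam s (\<lambda>k. \<omega> (i, k)) w" and g = "\<lambda>i. loc_grad l1 x lam s (\<lambda>k. \<omega> (i, k)) w"])
      fix i assume i: "i < m" "i \<notin> Byz"
      show "selfadj ((*v) (loc_hess l2 x lam s (\<lambda>k. \<omega> (i, k)) w))"
        unfolding loc_hess_mult_vec[abs_def] by (rule selfadj_gram_op)
      show "recv l1 l2 x lam s w Byz \<omega> v i =
          matrix_inv (loc_hess l2 x lam s (\<lambda>k. \<omega> (i, k)) w) *v loc_grad l1 x lam s (\<lambda>k. \<omega> (i, k)) w"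
        using i by (simp add: recv_def)
      show "norm (loc_grad l1 x lam s (\<lambda>k. \<omega> (i, k)) w - grad l1 x lam w) \<le> 2 * t"
        using g[OF i(1)] by (simp add: bad3_def not_less)
      fix u
      show "(1 - 13/12 * \<eta>) * (u \<bullet> (hess l2 x lam w *v u) - lam * (norm u)\<^sup>2)
          \<le> u \<bullet> (loc_hess l2 x lam s (\<lambda>k. \<omega> (i, k)) w *v u) - lam * (norm u)\<^sup>2"
        using g[OF i(1)] by (auto simp: bad2_def not_less Q_def QS_def H_def)
      show "u \<bullet> (loc_hess l2 x lam s (\<lambda>k. \<omega> (i, k)) w *v u) - lam * (norm u)\<^sup>2
          \<le> (1 + 13/10 * \<eta>) * (u \<bullet> (hess l2 x lam w *v u) - lam * (norm u)\<^sup>2)"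
        using g[OF i(1)] by (auto simp: bad1_def not_less Q_def QS_def H_def)
    qed (use l_deriv l1_deriv wstar_min U in auto)
    \<comment> \<open>The factor of \<epsilon>^2 in \<epsilon>_byz^2 is at least 3, while (5/4)^2 =
      25/16 suffices.\<close>
    also have "5/2 * t / c \<le> 2 * sqrt (eps_byz2 \<alpha> \<beta> (cond_num H) \<epsilon>) / sqrt c"
    proof -
      have Qge: "lam * (norm v)\<^sup>2 \<le> v \<bullet> (H *v v)" for v
        unfolding H_def hess_mult_vec gram_op_form using l2 by (auto intro!: sum_nonneg)
      have c0: "c > 0" using sigma_min_ge[of lam H, OF Qge] lam_pos by (simp add: c_def)
      have "0 \<le> B" unfolding B_def by (meson Max_ge finite_imageI finite norm_ge_zero order_trans rangeI)
      then have t0: "0 \<le> t" unfolding t_def using md(2) by (intro mult_nonneg_nonneg add_nonneg_nonneg) auto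
      have \<epsilon>: "\<epsilon> = t / (1 - \<eta>) / sqrt c" by (simp add: \<epsilon>_def eps_const_def t_def)
      have \<epsilon>t: "t / sqrt c \<le> \<epsilon>"
      proof -
        have "t * 1 \<le> t / (1 - \<eta>)" using t0 \<eta> by (simp add: field_simps)
        then show ?thesis unfolding \<epsilon> using c0 by (intro divide_right_mono) auto
      qed
      have "0 \<le> cond_num H" using sigma_max_nonneg[of H] c0 by (simp add: cond_num_def c_def)
      then have "0 \<le> 4 * cond_num H * (\<alpha> / (1 - \<beta>))\<^sup>2" by simp
      moreover have "1 \<le> ((1 - \<alpha>) / (1 - \<beta>))\<^sup>2"
        using \<alpha>\<beta> by (intro one_le_power) (simp add: field_simps)
      ultimately have "25/16 \<le> 3 * ((1 - \<alpha>) / (1 - \<beta>))\<^sup>2 + 4 * cond_num H * (\<alpha> / (1 - \<beta>))\<^sup>2"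
        by linarith
      then have "25/16 * \<epsilon>\<^sup>2 \<le> eps_byz2 \<alpha> \<beta> (cond_num H) \<epsilon>"
        unfolding eps_byz2_def by (intro mult_right_mono) auto
      then have "5/4 * \<epsilon> \<le> sqrt (eps_byz2 \<alpha> \<beta> (cond_num H) \<epsilon>)"
        by (intro real_le_rsqrt) (simp add: power2_eq_square)
      then have "5/4 * (t / sqrt c) \<le> sqrt (eps_byz2 \<alpha> \<beta> (cond_num H) \<epsilon>)" using \<epsilon>t by linarith
      then have "2 * (5/4 * (t / sqrt c)) / sqrt c \<le> 2 * sqrt (eps_byz2 \<alpha> \<beta> (cond_num H) \<epsilon>) / sqrt c"
        using c0 by (intro divide_right_mono) auto
      then show ?thesis using c0 by (simp add: mult.assoc)
    qed
    finally show "norm ((w - (1 / real (card U)) *\<^sub>R (\<Sum>i\<in>U. recv l1 l2 x lam s w Byz \<omega> v i)) - wstar)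
      \<le> max (sqrt (cond_num H * (Z / (1 - Z))) * norm (w - wstar)) (L / c * (norm (w - wstar))^2)
        + 2 * sqrt (eps_byz2 \<alpha> \<beta> (cond_num H) \<epsilon>) / sqrt c" by simp
  qed

  define p where "p = measure_pmf.prob (sample_pmf m s :: (nat \<times> nat \<Rightarrow> 'n) pmf)"
  define \<rho> where "\<rho> = CARD('d) * exp (- (7/4 * \<Lambda>))"
  have p1: "p {\<omega>. bad1 (\<lambda>k. \<omega> (i, k))} \<le> \<rho>" if "i < m" for i
  proof -
    have "p {\<omega>. bad1 (\<lambda>k. \<omega> (i, k))} = measure_pmf.prob (iid_uniform s) {S. bad1 S}"
      unfolding p_def by (rule prob_worker[OF that]) (simp add: bad1_def QS_def loc_hess_def)
    also have "\<dots> \<le> \<rho>"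
      unfolding bad1_def Q_def QS_def H_def \<rho>_def
      using worker_Hessian_failure(1)[where x = x and w = w and s = s and lam = lam, OF l2 _ \<eta> \<Lambda>0] s_large \<mu> by (simp add: \<Lambda>_def)
    finally show ?thesis .
  qed
  have p2: "p {\<omega>. bad2 (\<lambda>k. \<omega> (i, k))} \<le> \<rho>" if "i < m" for i
  proof -
    have "p {\<omega>. bad2 (\<lambda>k. \<omega> (i, k))} = measure_pmf.prob (iid_uniform s) {S. bad2 S}"
      unfolding p_def by (rule prob_worker[OF that]) (simp add: bad2_def QS_def loc_hess_def)
    also have "\<dots> \<le> \<rho>"
      unfolding bad2_def Q_def QS_def H_def \<rho>_def
      using worker_Hessian_failure(2)[where x = x and w = w and s = s and lam = lam, OF l2 _ \<eta> \<Lambda>0] s_large \<mu> by (simp add: \<Lambda>_def)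
    finally show ?thesis .
  qed
  have p3: "p {\<omega>. bad3 (\<lambda>k. \<omega> (i, k))} \<le> (\<delta> / m) ^ 4" if "i < m" for i
  proof -
    have "p {\<omega>. bad3 (\<lambda>k. \<omega> (i, k))} = measure_pmf.prob (iid_uniform s) {S. bad3 S}"
      unfolding p_def by (rule prob_worker[OF that]) (simp add: bad3_def loc_grad_def)
    also have "\<dots> \<le> (\<delta> / m) ^ 4"
      unfolding bad3_def t_def B_def
      using worker_gradient_failure[where u = "\<delta> / m" and ?l1.0 = l1 and x = x and w = w and lam = lam, OF s0] \<delta> m3 by (simp add: field_simps)
    finally show ?thesis .
  qed
  \<comment> \<open>exp (- \<Lambda>) = \<delta> / (m d) <= 1/3 and (1/3)^(3/4) <= 45/100, so each
    of the two Hessian failures costs at most 45/100 \<delta> over all workers. The gradient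
    failures cost at most \<delta> / 27, and the total stays strictly below \<delta>.\<close>
  have fail: "m * (\<rho> + \<rho> + (\<delta> / m) ^ 4) < \<delta>"
  proof -
    define a where "a = \<delta> / (m * CARD('d))"
    have a: "0 < a" "a \<le> 1/3" using md(1) \<delta> m3 by (auto simp: a_def field_simps)
    have ea: "exp (- \<Lambda>) = a"
      unfolding \<Lambda>_def exp_minus using \<delta> m3 by (subst exp_ln) (auto simp: a_def)
    have "exp (- (3/4 * \<Lambda>)) ^ 4 = exp (- \<Lambda>) ^ 3" by (simp flip: exp_of_nat_mult)
    also have "\<dots> \<le> (1/3) ^ 3" unfolding ea using a by (intro power_mono) auto
    also have "\<dots> \<le> (45/100 :: real) ^ 4" by (simp add: eval_nat_numeral)
    \<comment> \<open>The root rule is stated for \<open>Suc n\<close>, so the fourth power has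
      index 3.\<close>
    finally have e34: "exp (- (3/4 * \<Lambda>)) \<le> 45/100" by (rule power_le_imp_le_base[of _ 3, simplified]) auto
    have "7/4 * \<Lambda> = \<Lambda> + 3/4 * \<Lambda>" by simp
    then have "m * \<rho> = (m * CARD('d) * exp (- \<Lambda>)) * exp (- (3/4 * \<Lambda>))"
      unfolding \<rho>_def by (simp only: minus_add_distrib exp_add of_nat_mult mult.assoc)
    also have "m * CARD('d) * exp (- \<Lambda>) = \<delta>" unfolding ea a_def using m3 by simp
    finally have "m * \<rho> = \<delta> * exp (- (3/4 * \<Lambda>))" .
    then have mr: "m * \<rho> \<le> \<delta> * (45/100)" using e34 \<delta> by simp
    have "m * (\<delta> / m) ^ 4 = \<delta> * (\<delta> / m) ^ 3" using m3 by (simp add: eval_nat_numeral)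
    also have "\<dots> \<le> \<delta> * (1/3) ^ 3"
      using \<delta> m3 by (intro mult_left_mono power_mono) (auto simp: field_simps)
    finally have "m * (\<delta> / m) ^ 4 \<le> \<delta> * (1/27)" by (simp add: eval_nat_numeral)
    then show ?thesis using mr \<delta>(1) unfolding distrib_left by linarith
  qed
  have "1 - p Good = p (- Good)"
    unfolding p_def by (subst measure_pmf.prob_compl[symmetric]) (auto simp: Compl_eq_Diff_UNIV)
  also have "\<dots> \<le> p (\<Union>i<m. {\<omega>. bad1 (\<lambda>k. \<omega> (i, k))} \<union> {\<omega>. bad2 (\<lambda>k. \<omega> (i, k))} \<union> {\<omega>. bad3 (\<lambda>k. \<omega> (i, k))})"
    unfolding p_def by (rule measure_pmf.finite_measure_mono) (use Good in auto)
  also have "\<dots> \<le> (\<Sum>i<m. p ({\<omega>. bad1 (\<lambda>k. \<omega> (i, k))} \<union> {\<omega>. bad2 (\<lambda>k. \<omega> (i, k))} \<union> {\<omega>. bad3 (\<lambda>k. \<omega> (i, k))}))"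
    unfolding p_def by (rule measure_pmf.finite_measure_subadditive_finite) auto
  also have "\<dots> \<le> (\<Sum>i<m. \<rho> + \<rho> + (\<delta> / m) ^ 4)"
  proof (rule sum_mono)
    fix i assume i: "i \<in> {..<m}"
    have sub: "p (X \<union> Y) \<le> p X + p Y" for X Y
      unfolding p_def by (rule measure_Un_le) auto
    show "p ({\<omega>. bad1 (\<lambda>k. \<omega> (i, k))} \<union> {\<omega>. bad2 (\<lambda>k. \<omega> (i, k))} \<union> {\<omega>. bad3 (\<lambda>k. \<omega> (i, k))})
        \<le> \<rho> + \<rho> + (\<delta> / m) ^ 4"
      using i p1[of i] p2[of i] p3[of i]
        sub[of "{\<omega>. bad1 (\<lambda>k. \<omega> (i, k))} \<union> {\<omega>. bad2 (\<lambda>k. \<omega> (i, k))}" "{\<omega>. bad3 (\<lambda>k. \<omega> (i, k))}"]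
        sub[of "{\<omega>. bad1 (\<lambda>k. \<omega> (i, k))}" "{\<omega>. bad2 (\<lambda>k. \<omega> (i, k))}"] by simp
  qed
  also have "\<dots> = m * (\<rho> + \<rho> + (\<delta> / m) ^ 4)" by simp
  finally have "p Good > 1 - \<delta>" using fail by linarith
  then show ?thesis
    unfolding Let_def p_def Good_def q_def Z_def \<epsilon>_def B_def c_def \<nu>_def H_def .
qed

end
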